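(* Let $F(z,w)=(f(z)-\delta w,z)$ be a transcendental Hénon map. Then for every integer $N\ge3$, $F$ has infinitely many distinct periodic cycles of minimal period $N$.
   Context: A transcendental Hénon map is $F(z,w)=(f(z)-\delta w,z)$ with $f$ a transcendental entire function (entire and not a polynomial) and $\delta\in\mathbb C\setminus\{0\}$. *)

theory Defs
  imports "HOL-Complex_Analysis.Complex_Analysis" "HOL-Computational_Algebra.Polynomial"
begin

definition transcendental_entire :: "(complex \<Rightarrow> complex) \<Rightarrow> bool" where
  "transcendental_entire f \<longleftrightarrow> f holomorphic_on UNIV \<and> \<not> (\<exists>p. \<forall>z. f z = poly p z)"

definition henon_map :: "(complex \<Rightarrow> complex) \<Rightarrow> complex \<Rightarrow> complex \<times> complex \<Rightarrow> complex \<times> complex" where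
  "henon_map f \<delta> = (\<lambda>(z, w). (f z - \<delta> * w, z))"

definition minimal_period :: "('a \<Rightarrow> 'a) \<Rightarrow> nat \<Rightarrow> 'a \<Rightarrow> bool" where
  "minimal_period F N p \<longleftrightarrow> 0 < N \<and> (F ^^ N) p = p \<and> (\<forall>k. 0 < k \<and> k < N \<longrightarrow> (F ^^ k) p \<noteq> p)"

definition cycle_of :: "('a \<Rightarrow> 'a) \<Rightarrow> nat \<Rightarrow> 'a \<Rightarrow> 'a set" where
  "cycle_of F N p = {(F ^^ k) p | k. k < N}"

definition cycles_of_period :: "('a \<Rightarrow> 'a) \<Rightarrow> nat \<Rightarrow> 'a set set" where
  "cycles_of_period F N = {cycle_of F N p | p. minimal_period F N p}"

end

(*
Points of period N correspond to cyclic solutions of f z_i = z_{i+1} + delta * z_{i-1}. With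
F_n z = f (r_n z) / r_n, r_n = n + 1, the same system holds for F_n in the variable z / r_n, and
(F_n) is not normal at some point other than 0, since otherwise f would be a polynomial.

Existence of solutions: suppose discs D_i are given such that, for a target t_i which f attains in
D_i, the values y + delta * w (y in D_{i+1}, w in D_{i-1}) are closer to t_i than f(boundary of D_i).
Then there is a solution with z_i in D_i. The variables are eliminated one at a time: the possible
values of z_j, given z_{j-1} and z_N, are the zeros of a function which is holomorphic in these
data, and the monic polynomial with these roots has holomorphic coefficients by the argument
principle and Newton's identities. So only one-variable arguments are used, although the solutions
need not be simple.

Finding the discs: pass to subsequences of (F_n) so as to collect Zalcman points outside 0. Either
2N of them are found, or the non-normality is concentrated in finitely many points. In the first
case the Zalcman limit at a point b omits at most one value e_b, and counting yields points
w_0, ..., w_{N-1} with w_{i+1} + delta * w_{i-1} different from e_{w_i} and w_0 different from the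
others; the counting needs N >= 3, so that w_{i-1}, w_i, w_{i+1} are independent. The required discs
shrink to the w_i. In the second case F_n tends to infinity off these points and 0, so that small
discs D around one such point b and D' around 0 satisfy the hypothesis with all targets 0, and one
takes z_0 in D and all other z_i in D'.
*)

theory Submission
  imports Defs
begin

subsection \<open>Contour integrals with a parameter\<close>

text \<open>The factors r_n tend to infinity, so a solution whose rescaled z_0 stays away from 0
  gives a periodic point of F of size comparable with r_n. Cycles are finite sets, so unbounded
  periodic points of minimal period N force infinitely many cycles. This is why Zalcman points are
  wanted outside 0, while the other coordinates may well be close to 0.

  Normality is expressed by the bound on the spherical derivative from Marty's criterion, so that
  only complex-valued functions occur. The possible limit infinity is controlled by Schottky's
  theorem, since functions of modulus above 1 omit 0 and 1.

  A periodic solution is a zero of N equations in N unknowns, for which a degree in several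
  variables would be the natural tool. The elimination replaces it. What is carried along is a root
  multiset of constant positive size whose polynomial has coefficients that are jointly continuous
  and separately holomorphic. Finally z_0 and z_N are identified, and a single equation in one
  variable remains.\<close>

lemma continuous_on_contour_integral_param:
  fixes g :: "'p::topological_space \<Rightarrow> complex \<Rightarrow> complex"
  assumes cont: "continuous_on (P \<times> path_image \<gamma>) (\<lambda>(p, w). g p w)"
    and \<gamma>: "valid_path \<gamma>" "continuous_on {0..1} (\<lambda>t. vector_derivative \<gamma> (at t))"
  shows "continuous_on P (\<lambda>p. contour_integral \<gamma> (g p))"
proof -
  have c\<gamma>: "continuous_on {0..1} \<gamma>"
    using \<gamma>(1) by (simp add: valid_path_imp_path flip: path_def)
  have 1: "continuous_on (P \<times> cbox 0 (1::real)) (\<lambda>x. g (fst x) (\<gamma> (snd x)))"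
  proof -
    have "continuous_on (P \<times> cbox 0 (1::real)) (\<lambda>x. (fst x, \<gamma> (snd x)))"
      by (intro continuous_intros continuous_on_compose2[OF c\<gamma>]) auto
    moreover have "(\<lambda>x. (fst x, \<gamma> (snd x))) ` (P \<times> cbox 0 (1::real)) \<subseteq> P \<times> path_image \<gamma>"
      by (auto simp: path_image_def)
    ultimately show ?thesis
      using continuous_on_compose2[OF cont] by (fastforce simp: split_beta)
  qed
  have 2: "continuous_on (P \<times> cbox 0 (1::real)) (\<lambda>x. vector_derivative \<gamma> (at (snd x)))"
    by (rule continuous_on_compose2[OF \<gamma>(2)]) (auto intro!: continuous_intros)
  have "continuous_on P (\<lambda>p. integral (cbox 0 1) (\<lambda>t. g p (\<gamma> t) * vector_derivative \<gamma> (at t)))"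
    by (rule integral_continuous_on_param)
       (use continuous_on_mult[OF 1 2] in \<open>simp add: split_beta\<close>)
  thus ?thesis
    by (simp add: contour_integral_integral)
qed

text \<open>Morera's theorem: by Fubini the integral over a triangle moves inside the integral over
  \<gamma>, where it vanishes by Cauchy's theorem for each fixed \<open>w\<close>. Thus no
  derivative in the parameter has to be produced or estimated.\<close>

lemma holomorphic_on_contour_integral_param:
  fixes g :: "complex \<Rightarrow> complex \<Rightarrow> complex"
  assumes "open U"
    and cont: "continuous_on (U \<times> path_image \<gamma>) (\<lambda>(p, w). g p w)"
    and hol: "\<And>w. w \<in> path_image \<gamma> \<Longrightarrow> (\<lambda>p. g p w) holomorphic_on U"
    and \<gamma>: "valid_path \<gamma>" "continuous_on {0..1} (\<lambda>t. vector_derivative \<gamma> (at t))"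
  shows "(\<lambda>p. contour_integral \<gamma> (g p)) holomorphic_on U"
proof -
  have c\<gamma>: "continuous_on {0..1} \<gamma>"
    using \<gamma>(1) by (simp add: valid_path_imp_path flip: path_def)
  have cP: "continuous_on U (\<lambda>p. contour_integral \<gamma> (g p))"
    by (rule continuous_on_contour_integral_param[OF cont \<gamma>])
  have "(\<lambda>p. contour_integral \<gamma> (g p)) analytic_on U"
  proof (rule Morera_triangle[OF cP \<open>open U\<close>], intro impI)
    fix a b c assume hull: "convex hull {a, b, c} \<subseteq> U"
    have seg: "closed_segment a b \<subseteq> U" "closed_segment b c \<subseteq> U" "closed_segment c a \<subseteq> U"
      unfolding segment_convex_hull by (rule order_trans[OF hull_mono hull]; force)+
    have swap: "contour_integral (linepath u v) (\<lambda>p. contour_integral \<gamma> (g p)) =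
        contour_integral \<gamma> (\<lambda>w. contour_integral (linepath u v) (\<lambda>p. g p w))"
      and int: "(\<lambda>w. contour_integral (linepath u v) (\<lambda>p. g p w)) contour_integrable_on \<gamma>"
      if s: "closed_segment u v \<subseteq> U" for u v
    proof -
      have c: "continuous_on (path_image (linepath u v) \<times> path_image \<gamma>) (\<lambda>(y1, y2). g y1 y2)"
        by (rule continuous_on_subset[OF cont]) (use s in auto)
      show "contour_integral (linepath u v) (\<lambda>p. contour_integral \<gamma> (g p)) =
        contour_integral \<gamma> (\<lambda>w. contour_integral (linepath u v) (\<lambda>p. g p w))"
        by (rule contour_integral_swap[OF c _ \<gamma>(1) _ \<gamma>(2)]) auto
      have c': "continuous_on (path_image \<gamma> \<times> path_image (linepath u v)) (\<lambda>(w, p). g p w)"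
      proof -
        have "continuous_on (path_image \<gamma> \<times> path_image (linepath u v)) (\<lambda>x. (snd x, fst x))"
          by (intro continuous_intros)
        moreover have "(\<lambda>x. (snd x, fst x)) ` (path_image \<gamma> \<times> path_image (linepath u v)) \<subseteq>
            path_image (linepath u v) \<times> path_image \<gamma>" by auto
        ultimately show ?thesis
          using continuous_on_compose2[OF c] by (fastforce simp: split_beta)
      qed
      have "continuous_on (path_image \<gamma>) (\<lambda>w. contour_integral (linepath u v) (\<lambda>p. g p w))"
        by (rule continuous_on_contour_integral_param[OF c']) auto
      thus "(\<lambda>w. contour_integral (linepath u v) (\<lambda>p. g p w)) contour_integrable_on \<gamma>"
        unfolding contour_integrable_on
        by (intro integrable_continuous_real continuous_on_mult \<gamma>(2))
           (rule continuous_on_compose2[OF _ c\<gamma>], auto simp: path_image_def)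
    qed
    have zero: "contour_integral (linepath a b) (\<lambda>p. g p w) + contour_integral (linepath b c) (\<lambda>p. g p w) +
        contour_integral (linepath c a) (\<lambda>p. g p w) = 0" if w: "w \<in> path_image \<gamma>" for w
    proof -
      have h: "(\<lambda>p. g p w) holomorphic_on U" by (rule hol[OF w])
      have "((\<lambda>p. g p w) has_contour_integral 0) (linepath a b +++ linepath b c +++ linepath c a)"
        by (rule Cauchy_theorem_triangle) (rule holomorphic_on_subset[OF h hull])
      moreover have "(\<lambda>p. g p w) contour_integrable_on linepath u v" if "closed_segment u v \<subseteq> U" for u v
        using that by (intro contour_integrable_continuous_linepath
            continuous_on_subset[OF holomorphic_on_imp_continuous_on[OF h]])
      ultimately show ?thesis
        using seg by (auto dest!: contour_integral_unique simp: algebra_simps)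
    qed
    have "contour_integral (linepath a b) (\<lambda>p. contour_integral \<gamma> (g p)) +
       contour_integral (linepath b c) (\<lambda>p. contour_integral \<gamma> (g p)) +
       contour_integral (linepath c a) (\<lambda>p. contour_integral \<gamma> (g p)) =
       contour_integral \<gamma> (\<lambda>w. contour_integral (linepath a b) (\<lambda>p. g p w) + contour_integral (linepath b c) (\<lambda>p. g p w) +
        contour_integral (linepath c a) (\<lambda>p. g p w))"
      using seg by (simp add: swap int contour_integral_add contour_integrable_add)
    also have "\<dots> = contour_integral \<gamma> (\<lambda>w. 0)"
      by (rule contour_integral_cong) (use zero in auto)
    finally show "contour_integral (linepath a b) (\<lambda>p. contour_integral \<gamma> (g p)) +
       contour_integral (linepath b c) (\<lambda>p. contour_integral \<gamma> (g p)) +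
       contour_integral (linepath c a) (\<lambda>p. contour_integral \<gamma> (g p)) = 0" by simp
  qed
  thus ?thesis by (rule analytic_imp_holomorphic)
qed

lemma circlepath_C1:
  "continuous_on {0..1} (\<lambda>t. vector_derivative (circlepath c r) (at t))"
  by (auto simp: vector_derivative_circlepath intro!: continuous_intros)

subsection \<open>Monic polynomials with a given multiset of roots\<close>

text \<open>A multiset depending on a parameter is treated as continuous or holomorphic if the
  coefficients of this polynomial are. This makes sense also where roots collide and cannot be
  followed individually.\<close>

definition root_poly :: "complex multiset \<Rightarrow> complex poly" where
  "root_poly M = (\<Prod>e\<in>#M. [:-e, 1:])"

lemma root_poly_empty [simp]: "root_poly {#} = 1"
  and root_poly_add [simp]: "root_poly (add_mset e M) = [:-e, 1:] * root_poly M"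
  by (simp_all add: root_poly_def)

lemma root_poly_nonzero [simp]: "root_poly M \<noteq> 0"
  by (induction M) (auto simp del: mult_pCons_left)

lemma degree_root_poly [simp]: "degree (root_poly M) = size M"
  by (induction M) (auto simp del: mult_pCons_left simp: degree_mult_eq)

lemma poly_root_poly_eq_0_iff: "poly (root_poly M) x = 0 \<longleftrightarrow> x \<in># M"
  by (induction M) (auto simp del: mult_pCons_left simp: algebra_simps)

lemma poly_pderiv_root_poly:
  assumes "x \<notin># M"
  shows "poly (pderiv (root_poly M)) x = poly (root_poly M) x * (\<Sum>e\<in>#M. 1 / (x - e))"
  using assms
proof (induction M)
  case (add e M)
  hence "x \<noteq> e" by auto
  moreover have "pderiv (root_poly (add_mset e M)) = root_poly M + [:-e, 1:] * pderiv (root_poly M)"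
    unfolding root_poly_add by (subst pderiv_mult) (simp add: pderiv_pCons)
  ultimately have "poly (pderiv (root_poly (add_mset e M))) x =
      poly (root_poly M) x + (x - e) * poly (pderiv (root_poly M)) x"
    by (simp only:) (simp add: algebra_simps)
  also have "\<dots> = (x - e) * poly (root_poly M) x * (1 / (x - e) + (\<Sum>e\<in>#M. 1 / (x - e)))"
    using add \<open>x \<noteq> e\<close> by (simp add: distrib_left)
  also have "(x - e) * poly (root_poly M) x = poly (root_poly (add_mset e M)) x"
    by (simp add: algebra_simps)
  finally show ?case by simp
qed simp

text \<open>Newton's identities, read off from the logarithmic derivative of the reversed polynomial
  as a formal power series.\<close>

lemma newton_fps:
  fixes M :: "complex multiset"
  defines "V \<equiv> fps_of_poly (reflect_poly (root_poly M))"
  shows "fps_deriv V = - (V * Abs_fps (\<lambda>i. \<Sum>e\<in>#M. e ^ Suc i))"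
  unfolding V_def
proof (induction M)
  case empty
  show ?case by (simp add: fps_eq_iff)
next
  case (add e M)
  define V where "V = fps_of_poly (reflect_poly (root_poly M))"
  define S where "S = Abs_fps (\<lambda>i. \<Sum>e\<in>#M. e ^ Suc i)"
  define G where "G = Abs_fps (\<lambda>i. e ^ Suc i)"
  define L where "L = (1 - fps_const e * fps_X :: complex fps)"
  have refl: "reflect_poly [:-e, 1:] = [:1, -e:]"
    by (rule poly_eqI) (auto simp: coeff_reflect_poly coeff_pCons split: nat.splits)
  have 1: "fps_of_poly (reflect_poly (root_poly (add_mset e M))) = L * V"
    by (simp del: mult_pCons_left add: reflect_poly_mult fps_of_poly_mult refl V_def L_def fps_of_poly_pCons)
  have 2: "Abs_fps (\<lambda>i. \<Sum>e\<in>#add_mset e M. e ^ Suc i) = S + G"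
    by (simp add: fps_eq_iff S_def G_def)
  \<comment> \<open>\<open>G\<close> is the geometric series e / (1 - eX), the power-sum series of
    the single root \<open>e\<close>.\<close>
  have LG: "L * G = fps_const e"
  proof (rule fps_ext)
    fix n show "(L * G) $ n = fps_const e $ n"
      by (cases n) (simp_all add: L_def G_def left_diff_distrib mult.assoc)
  qed
  have "fps_deriv (L * V) = L * fps_deriv V - fps_const e * V"
    by (simp add: L_def algebra_simps)
  also have "fps_deriv V = - (V * S)"
    using add by (simp add: V_def S_def)
  also have "L * - (V * S) - fps_const e * V = - (L * V * (S + G))"
    using LG by (simp add: algebra_simps)
  finally show ?case by (simp only: 1 2)
qed

lemma newton_coeff:
  fixes M :: "complex multiset"
  defines "V \<equiv> coeff (reflect_poly (root_poly M))"
  shows "of_nat (Suc k) * V (Suc k) = - (\<Sum>i\<le>k. V i * (\<Sum>e\<in>#M. e ^ Suc (k - i)))"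
proof -
  have "fps_deriv (fps_of_poly (reflect_poly (root_poly M))) $ k = 
    (- (fps_of_poly (reflect_poly (root_poly M)) * Abs_fps (\<lambda>i. \<Sum>e\<in>#M. e ^ Suc i))) $ k"
    by (simp only: newton_fps)
  thus ?thesis
    by (simp add: V_def fps_mult_nth atLeast0AtMost del: of_nat_Suc)
qed

text \<open>Newton's recursion is run for an abstract property \<open>Q\<close>, which is later
  continuity and later holomorphy. It starts at the leading coefficient 1 and descends, hence the
  reflected polynomial; the constant size makes the place of the i-th coefficient independent of the
  parameter.\<close>

lemma coeff_root_poly_induct:
  fixes \<Psi> :: "'p \<Rightarrow> complex multiset"
  assumes size: "\<And>p. p \<in> P \<Longrightarrow> size (\<Psi> p) = d"
    and Q_sum: "\<And>A (g :: nat \<Rightarrow> 'p \<Rightarrow> complex). (\<And>i. Q (g i)) \<Longrightarrow> Q (\<lambda>p. \<Sum>i\<le>(A::nat). g i p)"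
    and Q_mult: "\<And>f g. Q f \<Longrightarrow> Q g \<Longrightarrow> Q (\<lambda>p. f p * g p)"
    and Q_const: "\<And>c. Q (\<lambda>_. c)"
    and Q_cong: "\<And>f g. Q f \<Longrightarrow> (\<And>p. p \<in> P \<Longrightarrow> f p = g p) \<Longrightarrow> Q g"
    and Q_power_sum: "\<And>k. Q (\<lambda>p. \<Sum>e\<in>#\<Psi> p. e ^ k)"
  shows "Q (\<lambda>p. coeff (root_poly (\<Psi> p)) i)"
proof -
  define V where "V = (\<lambda>k p. coeff (reflect_poly (root_poly (\<Psi> p))) k)"
  have V: "Q (V k)" for k
  proof (induction k rule: less_induct)
    case (less k)
    show ?case
    proof (cases k)
      case 0
      have "lead_coeff (root_poly M) = 1" for M
        by (induction M) (simp_all del: mult_pCons_left add: lead_coeff_mult)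
      hence V1: "V k p = 1" for p
        using 0 by (simp add: V_def)
      show ?thesis
        by (rule Q_cong[OF Q_const[of 1]]) (simp add: V1)
    next
      case (Suc l)
      \<comment> \<open>Cut off at \<open>l\<close>, because \<open>Q_sum\<close> wants
        \<open>Q\<close> for every index and the induction hypothesis supplies it only below
        \<open>k\<close>.\<close>
      define g where "g = (\<lambda>i p. if i \<le> l then V i p * (\<Sum>e\<in>#\<Psi> p. e ^ Suc (l - i)) else 0)"
      have "Q (g i)" for i
        using less.IH[of i] Suc unfolding g_def
        by (cases "i \<le> l") (auto intro!: Q_mult Q_const simp del: power_Suc simp: Q_power_sum)
      hence "Q (\<lambda>p. (- 1 / of_nat (Suc l)) * (\<Sum>i\<le>l. g i p))"
        by (intro Q_mult Q_const Q_sum)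
      thus ?thesis
      proof (rule Q_cong)
        fix p show "(- 1 / of_nat (Suc l)) * (\<Sum>i\<le>l. g i p) = V k p"
          using newton_coeff[of l "\<Psi> p"] unfolding V_def g_def Suc
          by (simp add: field_simps del: of_nat_Suc)
      qed
    qed
  qed
  show ?thesis
  proof (cases "i \<le> d")
    case True
    show ?thesis
      by (rule Q_cong[OF V[of "d - i"]]) (use True size in \<open>auto simp: V_def coeff_reflect_poly\<close>)
  next
    case False
    thus ?thesis
      by (intro Q_cong[OF Q_const[of 0]]) (use size in \<open>auto simp: coeff_eq_0\<close>)
  qed
qed

subsection \<open>Zeros depending on a parameter\<close>

text \<open>\<open>Abs_multiset\<close> has its intended value only for finitely many zeros. The
  context below secures this by forbidding zeros on the circle, which also rules out the zero
  function.\<close>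

definition zeros_mset :: "(complex \<Rightarrow> complex) \<Rightarrow> complex set \<Rightarrow> complex multiset" where
  "zeros_mset f D = Abs_multiset (\<lambda>x. if x \<in> D \<and> f x = 0 then nat (zorder f x) else 0)"

lemma sum_mset_image_count:
  fixes h :: "'a \<Rightarrow> 'b :: comm_semiring_1"
  shows "(\<Sum>x\<in>#M. h x) = (\<Sum>x\<in>set_mset M. of_nat (count M x) * h x)"
proof (induction M)
  case (add e M)
  have "(\<Sum>x\<in>set_mset (add_mset e M). of_nat (count (add_mset e M) x) * h x) =
        (\<Sum>x\<in>insert e (set_mset M). of_nat (count M x) * h x + (if x = e then h e else 0))"
    by (intro sum.cong) (auto simp: algebra_simps)
  also have "\<dots> = (\<Sum>x\<in>insert e (set_mset M). of_nat (count M x) * h x) + h e"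
    by (subst sum.distrib) simp
  also have "(\<Sum>x\<in>insert e (set_mset M). of_nat (count M x) * h x) =
      (\<Sum>x\<in>set_mset M. of_nat (count M x) * h x)"
    by (rule sum.mono_neutral_right) (auto simp: not_in_iff)
  finally show ?case using add by (simp add: add.commute)
qed simp

context
  fixes f :: "complex \<Rightarrow> complex" and c :: complex and r R :: real
  assumes hol: "f holomorphic_on ball c R" and r: "0 < r" "r < R"
    and nz: "\<And>x. x \<in> sphere c r \<Longrightarrow> f x \<noteq> 0"
begin

private lemma nonconst: "\<exists>\<beta>\<in>ball c R. f \<beta> \<noteq> 0"
  using nz[of "c + of_real r"] r by (intro bexI[of _ "c + of_real r"]) (auto simp: dist_norm)

private lemma count_zeros_mset:
  "count (zeros_mset f (ball c r)) x = (if x \<in> ball c r \<and> f x = 0 then nat (zorder f x) else 0)"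
proof -
  have "finite {x \<in> cball c r. f x = 0}"
  proof (cases "f constant_on ball c R")
    case True
    hence "{x \<in> cball c r. f x = 0} = {}"
      using nonconst r by (auto simp: constant_on_def)
    thus ?thesis by (simp only: finite.emptyI)
  next
    case False
    thus ?thesis
      by (intro holomorphic_compact_finite_zeros[OF hol]) (use r in auto)
  qed
  hence "finite {x. 0 < (if x \<in> ball c r \<and> f x = 0 then nat (zorder f x) else 0)}"
    by (rule rev_finite_subset) (auto split: if_splits)
  thus ?thesis
    by (simp add: zeros_mset_def count_Abs_multiset)
qed

private lemma zorder_pos: "zorder f x > 0" if "x \<in> ball c R" "f x = 0"
proof -
  obtain \<beta> where "\<beta> \<in> ball c R" "f \<beta> \<noteq> 0" using nonconst by auto
  hence "eventually (\<lambda>w. f w \<noteq> 0 \<and> w \<in> ball c R) (at x)"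
    using that by (intro non_zero_neighbour_alt[OF hol]) auto
  hence "frequently (\<lambda>w. f w \<noteq> 0) (at x)"
    by (intro eventually_frequently) (auto elim: eventually_mono)
  thus ?thesis
    using zorder_pos_iff[OF hol] that by auto
qed

lemma in_zeros_mset_iff: "x \<in># zeros_mset f (ball c r) \<longleftrightarrow> x \<in> ball c r \<and> f x = 0"
  using zorder_pos[of x] r by (auto simp: count_zeros_mset simp flip: count_greater_zero_iff)

lemma sum_zeros_mset:
  assumes h: "h holomorphic_on ball c R"
  shows "(\<Sum>x\<in>#zeros_mset f (ball c r). h x) =
    contour_integral (circlepath c r) (\<lambda>x. deriv f x * h x / f x) / (2 * of_real pi * \<i>)"
proof -
  \<comment> \<open>The argument principle is applied on an intermediate disc: zeros may accumulate
    at the boundary of \<open>ball c R\<close>, but \<open>cball c r'\<close> contains finitely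
    many. Those outside radius \<open>r\<close> have winding number 0.\<close>
  define r' where "r' = (r + R) / 2"
  have r': "r < r'" "r' < R" using r by (auto simp: r'_def)
  define Z where "Z = {w \<in> ball c r'. f w = 0 \<or> w \<in> {}}"
  have fin: "finite Z"
  proof (cases "f constant_on ball c R")
    case True
    hence "Z = {}"
      using nonconst r r' by (auto simp: constant_on_def Z_def)
    thus ?thesis by simp
  next
    case False
    have "finite {x \<in> cball c r'. f x = 0}"
      by (intro holomorphic_compact_finite_zeros[OF hol _ _ _ _ False]) (use r' in auto)
    thus ?thesis by (rule rev_finite_subset) (auto simp: Z_def)
  qed
  have sub: "ball c r' \<subseteq> ball c R" using r' by auto
  have "contour_integral (circlepath c r) (\<lambda>x. deriv f x * h x / f x) =
    2 * pi * \<i> * (\<Sum>p\<in>Z. winding_number (circlepath c r) p * h p * zorder f p)"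
    unfolding Z_def
  proof (rule argument_principle)
    show "f holomorphic_on ball c r' - {}" "h holomorphic_on ball c r'"
      using hol h holomorphic_on_subset[OF _ sub] by auto
    show "path_image (circlepath c r) \<subseteq> ball c r' - {w \<in> ball c r'. f w = 0 \<or> w \<in> {}}"
      using r r' nz by auto
    show "\<forall>z. z \<notin> ball c r' \<longrightarrow> winding_number (circlepath c r) z = 0"
      using r r' by (auto intro!: winding_number_zero_outside[of _ "cball c r"])
    show "finite {w \<in> ball c r'. f w = 0 \<or> w \<in> {}}" using fin by (simp add: Z_def)
  qed auto
  also have "(\<Sum>p\<in>Z. winding_number (circlepath c r) p * h p * zorder f p) =
    (\<Sum>p\<in>set_mset (zeros_mset f (ball c r)). of_nat (count (zeros_mset f (ball c r)) p) * h p)"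
  proof (rule sum.mono_neutral_cong_right[OF fin])
    show "set_mset (zeros_mset f (ball c r)) \<subseteq> Z"
      using r' by (auto simp: in_zeros_mset_iff Z_def)
    show "\<forall>i\<in>Z - set_mset (zeros_mset f (ball c r)).
       winding_number (circlepath c r) i * h i * complex_of_int (zorder f i) = 0"
    proof
      fix i assume "i \<in> Z - set_mset (zeros_mset f (ball c r))"
      hence "i \<notin> ball c r" "f i = 0" by (auto simp: in_zeros_mset_iff Z_def)
      hence "i \<notin> cball c r" using nz by (auto simp: less_le)
      hence "winding_number (circlepath c r) i = 0"
        using r by (intro winding_number_zero_outside[of _ "cball c r"]) auto
      thus "winding_number (circlepath c r) i * h i * complex_of_int (zorder f i) = 0" by simp
    qed
    fix x assume "x \<in># zeros_mset f (ball c r)"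
    hence x: "x \<in> ball c r" "f x = 0" by (auto simp: in_zeros_mset_iff)
    hence "winding_number (circlepath c r) x = 1"
      by (intro winding_number_circlepath) (auto simp: dist_norm norm_minus_commute)
    moreover have "zorder f x > 0" using x r by (intro zorder_pos) auto
    hence "complex_of_int (zorder f x) = of_nat (nat (zorder f x))"
      by (metis of_int_of_nat_eq zero_less_imp_eq_int nat_int)
    ultimately show "winding_number (circlepath c r) x * h x * complex_of_int (zorder f x) =
         of_nat (count (zeros_mset f (ball c r)) x) * h x"
      using x by (simp add: count_zeros_mset)
  qed
  also have "\<dots> = (\<Sum>x\<in>#zeros_mset f (ball c r). h x)"
    by (simp add: sum_mset_image_count)
  finally show ?thesis by simp
qed

end

section \<open>Parameter dependence of derivatives and of power sums over zeros\<close>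

lemma deriv_eq_circle_integral:
  assumes "f holomorphic_on ball c R" "x \<in> ball c s" "s < R"
  shows "deriv f x = contour_integral (circlepath c s) (\<lambda>w. f w / (w - x)\<^sup>2) / (2 * of_real pi * \<i>)"
proof -
  have sub: "cball c s \<subseteq> ball c R" "ball c s \<subseteq> ball c R" using assms by auto
  have "(f has_field_derivative (1 / (2 * of_real pi * \<i>) *
      contour_integral (circlepath c s) (\<lambda>u. f u / (u - x)\<^sup>2))) (at x)"
    using assms by (intro Cauchy_derivative_integral_circlepath)
      (auto intro: holomorphic_on_subset[OF assms(1) sub(2)]
        holomorphic_on_imp_continuous_on holomorphic_on_subset[OF assms(1) sub(1)])
  thus ?thesis by (simp add: DERIV_imp_deriv)
qed

text \<open>Cauchy's formula expresses the derivative through values of \<open>A\<close> on a fixed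
  circle, so it inherits their continuity. The pair \<open>(p, x)\<close> is the parameter of that
  integral, one reason for allowing arbitrary topological parameter spaces.\<close>

lemma continuous_on_deriv_param:
  fixes A :: "'p::topological_space \<Rightarrow> complex \<Rightarrow> complex"
  assumes cont: "continuous_on (P \<times> ball c R) (\<lambda>(p, x). A p x)"
    and hol: "\<And>p. p \<in> P \<Longrightarrow> A p holomorphic_on ball c R" and s: "0 < s" "s < R"
  shows "continuous_on (P \<times> ball c s) (\<lambda>(p, x). deriv (A p) x)"
proof -
  have "continuous_on ((P \<times> ball c s) \<times> path_image (circlepath c s)) (\<lambda>z. (fst (fst z), snd z))"
    by (intro continuous_intros)
  moreover have "(\<lambda>z. (fst (fst z), snd z)) ` ((P \<times> ball c s) \<times> path_image (circlepath c s)) \<subseteq> P \<times> ball c R"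
    using s by auto
  ultimately have 1: "continuous_on ((P \<times> ball c s) \<times> path_image (circlepath c s)) (\<lambda>z. A (fst (fst z)) (snd z))"
    using continuous_on_compose2[OF cont] by (fastforce simp: split_beta)
  have "continuous_on (P \<times> ball c s)
      (\<lambda>q. contour_integral (circlepath c s) (\<lambda>w. A (fst q) w / (w - snd q)\<^sup>2))"
  proof (rule continuous_on_contour_integral_param)
    show "continuous_on ((P \<times> ball c s) \<times> path_image (circlepath c s)) (\<lambda>(q, w). A (fst q) w / (w - snd q)\<^sup>2)"
      using 1 s by (auto simp: split_beta intro!: continuous_intros)
  qed (auto simp: circlepath_C1)
  hence "continuous_on (P \<times> ball c s)
      (\<lambda>q. contour_integral (circlepath c s) (\<lambda>w. A (fst q) w / (w - snd q)\<^sup>2) / (2 * of_real pi * \<i>))"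
    by (intro continuous_intros) auto
  thus ?thesis
    by (rule continuous_on_eq) (use deriv_eq_circle_integral[OF hol _ s(2)] in auto)
qed

lemma holomorphic_on_deriv_param:
  fixes A :: "complex \<Rightarrow> complex \<Rightarrow> complex"
  assumes "open U" and cont: "continuous_on (U \<times> ball c R) (\<lambda>(p, x). A p x)"
    and hol: "\<And>p. p \<in> U \<Longrightarrow> A p holomorphic_on ball c R"
    and hol': "\<And>x. x \<in> ball c R \<Longrightarrow> (\<lambda>p. A p x) holomorphic_on U"
    and s: "0 < s" "s < R" and x: "x \<in> ball c s"
  shows "(\<lambda>p. deriv (A p) x) holomorphic_on U"
proof -
  have 1: "continuous_on (U \<times> path_image (circlepath c s)) (\<lambda>(p, x). A p x)"
    by (rule continuous_on_subset[OF cont]) (use s in auto)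
  have "(\<lambda>p. contour_integral (circlepath c s) (\<lambda>w. A p w / (w - x)\<^sup>2)) holomorphic_on U"
  proof (rule holomorphic_on_contour_integral_param[OF \<open>open U\<close>])
    show "continuous_on (U \<times> path_image (circlepath c s)) (\<lambda>(p, w). A p w / (w - x)\<^sup>2)"
      using 1 s x by (auto simp: split_beta intro!: continuous_intros)
    fix w assume "w \<in> path_image (circlepath c s)"
    thus "(\<lambda>p. A p w / (w - x)\<^sup>2) holomorphic_on U"
      using s x by (intro holomorphic_intros hol') auto
  qed (auto simp: circlepath_C1)
  hence "(\<lambda>p. contour_integral (circlepath c s) (\<lambda>w. A p w / (w - x)\<^sup>2) / (2 * of_real pi * \<i>)) holomorphic_on U"
    by (intro holomorphic_intros) auto
  thus ?thesis
    by (rule holomorphic_transform) (use deriv_eq_circle_integral[OF hol x s(2)] in auto)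
qed

text \<open>By the argument principle the sum is a contour integral of
  \<open>deriv (A p) x * E p x ^ k / A p x\<close>. The weight \<open>E\<close> is a quantity
  attached to a zero: the zero itself when a coordinate is eliminated, and the value prescribed by
  the last equation when the cycle is closed.\<close>

lemma continuous_on_power_sum_zeros:
  fixes A E :: "'p::topological_space \<Rightarrow> complex \<Rightarrow> complex"
  assumes A: "continuous_on (P \<times> ball c R) (\<lambda>(p, x). A p x)"
    "\<And>p. p \<in> P \<Longrightarrow> A p holomorphic_on ball c R"
    and E: "continuous_on (P \<times> ball c R) (\<lambda>(p, x). E p x)"
    "\<And>p. p \<in> P \<Longrightarrow> E p holomorphic_on ball c R"
    and r: "0 < r" "r < R" and nz: "\<And>p x. p \<in> P \<Longrightarrow> x \<in> sphere c r \<Longrightarrow> A p x \<noteq> 0"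
  shows "continuous_on P (\<lambda>p. \<Sum>x\<in>#zeros_mset (A p) (ball c r). E p x ^ k)"
proof -
  define s where "s = (r + R) / 2"
  have s: "0 < s" "s < R" "r < s" using r by (auto simp: s_def)
  have sub: "P \<times> sphere c r \<subseteq> P \<times> ball c s" "P \<times> sphere c r \<subseteq> P \<times> ball c R"
    using s r by auto
  have "continuous_on (P \<times> sphere c r) (\<lambda>(p, x). deriv (A p) x * E p x ^ k / A p x)"
    using continuous_on_subset[OF continuous_on_deriv_param[OF A s(1,2)] sub(1)]
      continuous_on_subset[OF A(1) sub(2)] continuous_on_subset[OF E(1) sub(2)] nz
    unfolding split_beta by (intro continuous_intros) auto
  hence "continuous_on P (\<lambda>p. contour_integral (circlepath c r) (\<lambda>x. deriv (A p) x * E p x ^ k / A p x))"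
    by (intro continuous_on_contour_integral_param) (use r in \<open>auto simp: circlepath_C1\<close>)
  hence "continuous_on P (\<lambda>p. contour_integral (circlepath c r)
      (\<lambda>x. deriv (A p) x * E p x ^ k / A p x) / (2 * of_real pi * \<i>))"
    by (intro continuous_intros) auto
  thus ?thesis
    by (rule continuous_on_eq)
       (subst sum_zeros_mset[OF A(2) r nz], auto intro!: holomorphic_intros E(2))
qed

lemma holomorphic_on_power_sum_zeros:
  fixes A E :: "complex \<Rightarrow> complex \<Rightarrow> complex"
  assumes "open P" and A: "continuous_on (P \<times> ball c R) (\<lambda>(p, x). A p x)"
    "\<And>p. p \<in> P \<Longrightarrow> A p holomorphic_on ball c R"
    "\<And>x. x \<in> ball c R \<Longrightarrow> (\<lambda>p. A p x) holomorphic_on P"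
    and E: "continuous_on (P \<times> ball c R) (\<lambda>(p, x). E p x)"
    "\<And>p. p \<in> P \<Longrightarrow> E p holomorphic_on ball c R"
    "\<And>x. x \<in> ball c R \<Longrightarrow> (\<lambda>p. E p x) holomorphic_on P"
    and r: "0 < r" "r < R" and nz: "\<And>p x. p \<in> P \<Longrightarrow> x \<in> sphere c r \<Longrightarrow> A p x \<noteq> 0"
  shows "(\<lambda>p. \<Sum>x\<in>#zeros_mset (A p) (ball c r). E p x ^ k) holomorphic_on P"
proof -
  define s where "s = (r + R) / 2"
  have s: "0 < s" "s < R" "r < s" using r by (auto simp: s_def)
  have sub: "P \<times> sphere c r \<subseteq> P \<times> ball c s" "P \<times> sphere c r \<subseteq> P \<times> ball c R"
    using s r by auto
  have "continuous_on (P \<times> sphere c r) (\<lambda>(p, x). deriv (A p) x * E p x ^ k / A p x)"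
    using continuous_on_subset[OF continuous_on_deriv_param[OF A(1,2) s(1,2)] sub(1)]
      continuous_on_subset[OF A(1) sub(2)] continuous_on_subset[OF E(1) sub(2)] nz
    unfolding split_beta by (intro continuous_intros) auto
  hence "(\<lambda>p. contour_integral (circlepath c r) (\<lambda>x. deriv (A p) x * E p x ^ k / A p x)) holomorphic_on P"
  proof (intro holomorphic_on_contour_integral_param[OF \<open>open P\<close>])
    fix w assume "w \<in> path_image (circlepath c r)"
    thus "(\<lambda>p. deriv (A p) w * E p w ^ k / A p w) holomorphic_on P"
      using s r nz by (intro holomorphic_intros A E holomorphic_on_deriv_param[OF \<open>open P\<close> A s(1,2)]) auto
  qed (use r in \<open>auto simp: circlepath_C1\<close>)
  hence "(\<lambda>p. contour_integral (circlepath c r)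
      (\<lambda>x. deriv (A p) x * E p x ^ k / A p x) / (2 * of_real pi * \<i>)) holomorphic_on P"
    by (intro holomorphic_intros) auto
  thus ?thesis
    by (rule holomorphic_transform)
       (subst sum_zeros_mset[OF A(2) r nz], auto intro!: holomorphic_intros E(2))
qed

text \<open>The number of zeros is a power sum with weight 1; being continuous and integer valued,
  it cannot change on a connected set.\<close>

lemma size_zeros_mset_constant:
  fixes A :: "'p::topological_space \<Rightarrow> complex \<Rightarrow> complex"
  assumes A: "continuous_on (P \<times> ball c R) (\<lambda>(p, x). A p x)"
    "\<And>p. p \<in> P \<Longrightarrow> A p holomorphic_on ball c R"
    and r: "0 < r" "r < R" and nz: "\<And>p x. p \<in> P \<Longrightarrow> x \<in> sphere c r \<Longrightarrow> A p x \<noteq> 0"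
    and "connected P"
  obtains d where "\<And>p. p \<in> P \<Longrightarrow> size (zeros_mset (A p) (ball c r)) = d"
proof -
  have "continuous_on P (\<lambda>p. \<Sum>x\<in>#zeros_mset (A p) (ball c r). 1 ^ 0 :: complex)"
    by (rule continuous_on_power_sum_zeros[OF A _ _ r nz, where E = "\<lambda>_ _. 1"]) (auto intro: holomorphic_intros)
  hence cont: "continuous_on P (\<lambda>p. of_nat (size (zeros_mset (A p) (ball c r))) :: complex)"
    by simp
  have "(\<lambda>p. of_nat (size (zeros_mset (A p) (ball c r))) :: complex) constant_on P"
  proof (rule continuous_discrete_range_constant[OF \<open>connected P\<close> cont])
    fix p assume "p \<in> P"
    show "\<exists>e>0. \<forall>y. y \<in> P \<and> (of_nat (size (zeros_mset (A y) (ball c r))) :: complex) \<noteq> of_nat (size (zeros_mset (A p) (ball c r))) \<longrightarrow>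
       e \<le> cmod (of_nat (size (zeros_mset (A y) (ball c r))) - of_nat (size (zeros_mset (A p) (ball c r))))"
    proof (intro exI[of _ 1] conjI allI impI)
      fix y assume "y \<in> P \<and> (of_nat (size (zeros_mset (A y) (ball c r))) :: complex) \<noteq> of_nat (size (zeros_mset (A p) (ball c r)))"
      hence *: "int (size (zeros_mset (A y) (ball c r))) \<noteq> int (size (zeros_mset (A p) (ball c r)))" by auto
      have "of_nat (size (zeros_mset (A y) (ball c r))) - of_nat (size (zeros_mset (A p) (ball c r))) =
        complex_of_real (of_int (int (size (zeros_mset (A y) (ball c r))) - int (size (zeros_mset (A p) (ball c r)))))"
        by simp
      thus "1 \<le> cmod (of_nat (size (zeros_mset (A y) (ball c r))) - of_nat (size (zeros_mset (A p) (ball c r))))"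
        using * by (simp only: norm_of_real)
    qed auto
  qed
  hence "size (zeros_mset (A p) (ball c r)) = size (zeros_mset (A q) (ball c r))" if "p \<in> P" "q \<in> P" for p q
    using that unfolding constant_on_def by (metis of_nat_eq_iff)
  thus ?thesis
    using that[of "size (zeros_mset (A (SOME p. p \<in> P)) (ball c r))"] by (metis someI)
qed

lemma continuous_on_coeff_root_poly_zeros:
  fixes A E :: "'p::topological_space \<Rightarrow> complex \<Rightarrow> complex"
  assumes A: "continuous_on (P \<times> ball c R) (\<lambda>(p, x). A p x)"
    "\<And>p. p \<in> P \<Longrightarrow> A p holomorphic_on ball c R"
    and E: "continuous_on (P \<times> ball c R) (\<lambda>(p, x). E p x)"
    "\<And>p. p \<in> P \<Longrightarrow> E p holomorphic_on ball c R"
    and r: "0 < r" "r < R" and nz: "\<And>p x. p \<in> P \<Longrightarrow> x \<in> sphere c r \<Longrightarrow> A p x \<noteq> 0"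
    and size: "\<And>p. p \<in> P \<Longrightarrow> size (zeros_mset (A p) (ball c r)) = d"
  shows "continuous_on P (\<lambda>p. coeff (root_poly (image_mset (E p) (zeros_mset (A p) (ball c r)))) i)"
proof (rule coeff_root_poly_induct[where Q = "continuous_on P"])
  show "size (image_mset (E p) (zeros_mset (A p) (ball c r))) = d" if "p \<in> P" for p
    using size[OF that] by simp
  show "continuous_on P (\<lambda>p. \<Sum>e\<in>#image_mset (E p) (zeros_mset (A p) (ball c r)). e ^ k)" for k
    using continuous_on_power_sum_zeros[OF A E r nz, of k] by (simp add: image_mset.compositionality o_def)
  show "continuous_on P g" if "continuous_on P f" "\<And>p. p \<in> P \<Longrightarrow> f p = g p" for f g :: "'p \<Rightarrow> complex"
    using that by (rule continuous_on_eq)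
qed (auto intro: continuous_intros)

lemma holomorphic_on_coeff_root_poly_zeros:
  fixes A E :: "complex \<Rightarrow> complex \<Rightarrow> complex"
  assumes "open P" and A: "continuous_on (P \<times> ball c R) (\<lambda>(p, x). A p x)"
    "\<And>p. p \<in> P \<Longrightarrow> A p holomorphic_on ball c R"
    "\<And>x. x \<in> ball c R \<Longrightarrow> (\<lambda>p. A p x) holomorphic_on P"
    and E: "continuous_on (P \<times> ball c R) (\<lambda>(p, x). E p x)"
    "\<And>p. p \<in> P \<Longrightarrow> E p holomorphic_on ball c R"
    "\<And>x. x \<in> ball c R \<Longrightarrow> (\<lambda>p. E p x) holomorphic_on P"
    and r: "0 < r" "r < R" and nz: "\<And>p x. p \<in> P \<Longrightarrow> x \<in> sphere c r \<Longrightarrow> A p x \<noteq> 0"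
    and size: "\<And>p. p \<in> P \<Longrightarrow> size (zeros_mset (A p) (ball c r)) = d"
  shows "(\<lambda>p. coeff (root_poly (image_mset (E p) (zeros_mset (A p) (ball c r)))) i) holomorphic_on P"
proof (rule coeff_root_poly_induct[where Q = "\<lambda>g. g holomorphic_on P"])
  show "size (image_mset (E p) (zeros_mset (A p) (ball c r))) = d" if "p \<in> P" for p
    using size[OF that] by simp
  show "(\<lambda>p. \<Sum>e\<in>#image_mset (E p) (zeros_mset (A p) (ball c r)). e ^ k) holomorphic_on P" for k
    using holomorphic_on_power_sum_zeros[OF \<open>open P\<close> A E r nz, of k]
    by (simp add: image_mset.compositionality o_def)
  show "g holomorphic_on P" if "f holomorphic_on P" "\<And>p. p \<in> P \<Longrightarrow> f p = g p" for f g
    using that by (rule holomorphic_transform)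
qed (auto intro: holomorphic_intros)

text \<open>If no \<open>x\<close> had \<open>f x\<close> among the roots \<open>M x\<close>, then
  \<open>(f x - t) * (\<Sum>y\<in>#M x. 1 / (f x - y))\<close> would be holomorphic with real part above \<open>1/2\<close>
  on the circle, yet it vanishes where \<open>f\<close> takes the value \<open>t\<close>.\<close>

lemma exists_value_among_roots:
  fixes M :: "complex \<Rightarrow> complex multiset"
  assumes f: "f holomorphic_on ball c R" and r: "0 < r" "r < R"
    and coeff: "\<And>i. (\<lambda>x. coeff (root_poly (M x)) i) holomorphic_on ball c R"
    and size: "\<And>x. x \<in> ball c R \<Longrightarrow> size (M x) = d" and "d > 0"
    and close: "\<And>x y. x \<in> sphere c r \<Longrightarrow> y \<in># M x \<Longrightarrow> cmod (y - t) < cmod (f x - t)"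
    and x0: "x0 \<in> ball c r" "f x0 = t"
  shows "\<exists>x\<in>ball c r. f x \<in># M x"
proof (rule ccontr)
  assume neg: "\<not> (\<exists>x\<in>ball c r. f x \<in># M x)"
  define W where "W = (\<lambda>x. poly (root_poly (M x)) (f x))"
  define W' where "W' = (\<lambda>x. poly (pderiv (root_poly (M x))) (f x))"
  have notin: "f x \<notin># M x" if "x \<in> cball c r" for x
    using neg close[of x "f x"] that by (cases "x \<in> ball c r") (auto simp: less_le)
  have subR: "cball c r \<subseteq> ball c R" using r by auto
  have "(\<lambda>x. \<Sum>i\<le>d. coeff (root_poly (M x)) i * f x ^ i) holomorphic_on ball c R"
    by (intro holomorphic_intros coeff f)
  hence Whol: "W holomorphic_on ball c R"
    by (rule holomorphic_transform) (simp add: W_def poly_altdef size)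
  have "(\<lambda>x. \<Sum>i\<le>d - 1. of_nat (Suc i) * coeff (root_poly (M x)) (Suc i) * f x ^ i) holomorphic_on ball c R"
    by (intro holomorphic_intros coeff f)
  hence W'hol: "W' holomorphic_on ball c R"
    by (rule holomorphic_transform) (simp add: W'_def poly_altdef size degree_pderiv coeff_pderiv)
  have W0: "W x \<noteq> 0" if "x \<in> cball c r" for x
    using notin[OF that] by (simp add: W_def poly_root_poly_eq_0_iff)
  define q where "q = (\<lambda>x. (f x - t) * W' x / W x)"
  have qhol: "q holomorphic_on cball c r"
    unfolding q_def using W0
    by (intro holomorphic_intros holomorphic_on_subset[OF Whol subR] holomorphic_on_subset[OF W'hol subR]
        holomorphic_on_subset[OF f subR])
  have Re_q: "Re (q x) > 0" if x: "x \<in> sphere c r" for x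
  proof -
    have "W' x = W x * (\<Sum>y\<in>#M x. 1 / (f x - y))"
      unfolding W_def W'_def using notin[of x] x by (intro poly_pderiv_root_poly) auto
    hence "q x = (f x - t) * (\<Sum>y\<in>#M x. 1 / (f x - y))"
      using W0[of x] x by (simp add: q_def del: sum_mset_distrib_left)
    hence q: "q x = (\<Sum>y\<in>#M x. (f x - t) / (f x - y))"
      by (simp add: sum_mset_distrib_left)
    have pos: "Re ((f x - t) / (f x - y)) > 0" if "y \<in># M x" for y
    proof -
      define u v where "u = f x - t" and "v = y - t"
      have lt: "cmod v < cmod u" using close[OF x that] by (simp add: u_def v_def)
      have "Re (u * cnj v) \<le> cmod u * cmod v"
        using complex_Re_le_cmod[of "u * cnj v"] by (simp add: norm_mult)
      also have "\<dots> < cmod u * cmod u" using lt by (intro mult_strict_left_mono) (auto intro: le_less_trans[OF norm_ge_zero])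
      also have "\<dots> = Re (u * cnj u)" by (simp add: complex_norm_square[symmetric] power2_eq_square flip: of_real_mult)
      finally have "Re (u * cnj (u - v)) > 0" by (simp add: algebra_simps)
      moreover have "u - v \<noteq> 0" using lt by auto
      ultimately have "Re (u / (u - v)) > 0"
        by (simp add: Re_complex_div_gt_0)
      thus ?thesis by (simp add: u_def v_def)
    qed
    have ne: "M x \<noteq> {#}" using size[of x] \<open>d > 0\<close> x r by auto
    have "Re (\<Sum>y\<in>#N. (f x - t) / (f x - y)) \<ge> 0 \<and> (N \<noteq> {#} \<longrightarrow> Re (\<Sum>y\<in>#N. (f x - t) / (f x - y)) > 0)"
      if "\<forall>y\<in>#N. Re ((f x - t) / (f x - y)) > 0" for N
      using that
    proof (induction N)
      case (add y N)
      thus ?case by (auto intro: add_pos_nonneg)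
    qed simp
    thus ?thesis using q ne pos by auto
  qed
  have "continuous_on (sphere c r) (\<lambda>x. Re (q x))"
    by (intro continuous_intros holomorphic_on_imp_continuous_on holomorphic_on_subset[OF qhol]) auto
  then obtain z where z: "z \<in> sphere c r" "\<And>x. x \<in> sphere c r \<Longrightarrow> Re (q z) \<le> Re (q x)"
    using continuous_attains_inf[of "sphere c r" "\<lambda>x. Re (q x)"] r by auto
  \<comment> \<open>Minimum principle for the real part of \<open>q\<close>, in the guise of the
    maximum principle for \<open>exp (- q x)\<close>.\<close>
  have "cmod (exp (- q x0)) \<le> exp (- Re (q z))"
  proof (rule maximum_modulus_frontier[where S = "cball c r" and f = "\<lambda>x. exp (- q x)"])
    show "(\<lambda>x. exp (- q x)) holomorphic_on interior (cball c r)"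
      by (intro holomorphic_intros holomorphic_on_subset[OF qhol] interior_subset)
    show "continuous_on (closure (cball c r)) (\<lambda>x. exp (- q x))"
      using holomorphic_on_imp_continuous_on[OF qhol] by (auto intro!: continuous_intros)
  qed (use x0 z r in \<open>auto simp: norm_exp_eq_Re\<close>)
  moreover have "q x0 = 0" using x0 by (simp add: q_def)
  ultimately show False using Re_q[OF z(1)] by simp
qed

subsection \<open>Henon orbits through prescribed discs\<close>

text \<open>Consecutive entries are the two coordinates of a point: the n-th iterate of
  \<open>(y, b)\<close> is entry \<open>Suc n\<close> paired with entry \<open>n\<close>. The map
  thus becomes a scalar recursion in which \<open>b\<close> precedes \<open>y\<close>.\<close>

fun henon_orbit :: "(complex \<Rightarrow> complex) \<Rightarrow> complex \<Rightarrow> complex \<Rightarrow> complex \<Rightarrow> nat \<Rightarrow> complex" where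
  "henon_orbit f \<delta> b y 0 = b"
| "henon_orbit f \<delta> b y (Suc 0) = y"
| "henon_orbit f \<delta> b y (Suc (Suc n)) = f (henon_orbit f \<delta> b y (Suc n)) - \<delta> * henon_orbit f \<delta> b y n"

lemma henon_orbit_shift:
  "henon_orbit f \<delta> b y (Suc n) = henon_orbit f \<delta> y (f y - \<delta> * b) n"
proof (induction n rule: less_induct)
  case (less n)
  show ?case
  proof (cases n)
    case (Suc m)
    show ?thesis
    proof (cases m)
      case (Suc k)
      thus ?thesis using less.IH[of k] less.IH[of m] \<open>n = Suc m\<close> by simp
    qed (use Suc in auto)
  qed auto
qed

lemma continuous_on_henon_orbit:
  assumes "f holomorphic_on UNIV" "continuous_on P b" "continuous_on P y"
  shows "continuous_on P (\<lambda>p. henon_orbit f \<delta> (b p) (y p) n)"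
proof (induction n rule: less_induct)
  case (less n)
  have f: "continuous_on UNIV f" using assms(1) by (rule holomorphic_on_imp_continuous_on)
  consider "n = 0" | "n = Suc 0" | m where "n = Suc (Suc m)" by (metis not0_implies_Suc)
  thus ?case
  proof cases
    case 3
    thus ?thesis using less.IH[of m] less.IH[of "Suc m"]
      by (auto intro!: continuous_intros continuous_on_compose2[OF f])
  qed (use assms in auto)
qed

lemma holomorphic_on_henon_orbit:
  assumes "f holomorphic_on UNIV" "b holomorphic_on P" "y holomorphic_on P"
  shows "(\<lambda>p. henon_orbit f \<delta> (b p) (y p) n) holomorphic_on P"
proof (induction n rule: less_induct)
  case (less n)
  consider "n = 0" | "n = Suc 0" | m where "n = Suc (Suc m)" by (metis not0_implies_Suc)
  thus ?case
  proof cases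
    case 3
    thus ?thesis using less.IH[of m] less.IH[of "Suc m"]
      by (auto intro!: holomorphic_intros holomorphic_on_compose_gen[OF _ assms(1), unfolded o_def])
  qed (use assms in auto)
qed

text \<open>Here \<open>a\<close> is the last coordinate of a chain and \<open>b\<close> the one
  preceding the roots. Joint continuity is what the parameter integrals require; holomorphy is used
  in one variable at a time. The condition \<open>d > 0\<close> carries the existence of
  solutions.\<close>

definition root_family :: "complex set \<Rightarrow> complex set \<Rightarrow> (complex \<Rightarrow> complex \<Rightarrow> complex multiset) \<Rightarrow> nat \<Rightarrow> bool" where
  "root_family V U M d \<longleftrightarrow> d > 0 \<and> (\<forall>a\<in>V. \<forall>b\<in>U. size (M a b) = d) \<and>
     (\<forall>i. continuous_on (V \<times> U) (\<lambda>(a, b). coeff (root_poly (M a b)) i)) \<and>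
     (\<forall>i. \<forall>b\<in>U. (\<lambda>a. coeff (root_poly (M a b)) i) holomorphic_on V) \<and>
     (\<forall>i. \<forall>a\<in>V. (\<lambda>b. coeff (root_poly (M a b)) i) holomorphic_on U)"

text \<open>Given the values \<open>M a x\<close> of the next coordinate in terms of the current one \<open>x\<close> and the last
  one \<open>a\<close>, the multiset \<open>Z a b\<close> below consists of the current coordinates compatible with the
  previous one \<open>b\<close>.\<close>

locale elimination_step =
  fixes f :: "complex \<Rightarrow> complex" and \<delta> :: complex and c t :: complex and r R :: real
    and U V W :: "complex set" and M :: "complex \<Rightarrow> complex \<Rightarrow> complex multiset" and d :: nat
  assumes f: "f holomorphic_on UNIV" and r: "0 < r" "r < R"
    and fam: "root_family V (ball c R) M d"
    and M_sub: "\<And>a b y. a \<in> V \<Longrightarrow> b \<in> ball c R \<Longrightarrow> y \<in># M a b \<Longrightarrow> y \<in> W"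
    and close: "\<And>x y w. x \<in> sphere c r \<Longrightarrow> y \<in> W \<Longrightarrow> w \<in> U \<Longrightarrow> cmod (y + \<delta> * w - t) < cmod (f x - t)"
    and hit: "\<exists>x\<in>ball c r. f x = t"
begin

text \<open>Vanishes exactly when the successor \<open>f x - \<delta> * b\<close> forced by the
  recursion is one of the admissible next coordinates.\<close>

definition A :: "complex \<Rightarrow> complex \<Rightarrow> complex \<Rightarrow> complex" where
  "A a b x = poly (root_poly (M a x)) (f x - \<delta> * b)"

definition Z :: "complex \<Rightarrow> complex \<Rightarrow> complex multiset" where
  "Z a b = zeros_mset (A a b) (ball c r)"

lemma A_altdef:
  "a \<in> V \<Longrightarrow> x \<in> ball c R \<Longrightarrow> A a b x = (\<Sum>i\<le>d. coeff (root_poly (M a x)) i * (f x - \<delta> * b) ^ i)"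
  using fam by (simp add: A_def poly_altdef root_family_def)

lemma A_eq_0_iff: "A a b x = 0 \<longleftrightarrow> f x - \<delta> * b \<in># M a x"
  by (simp add: A_def poly_root_poly_eq_0_iff)

text \<open>A zero on the circle would have its successor in \<open>W\<close>, and inserting this
  successor for \<open>y\<close> in \<open>close\<close> gives
  \<open>cmod (f x - t) < cmod (f x - t)\<close>. So no zero crosses the circle as the parameters
  vary.\<close>

lemma A_nz: "A a b x \<noteq> 0" if "a \<in> V" "b \<in> U" "x \<in> sphere c r"
  using M_sub[of a x "f x - \<delta> * b"] close[of x "f x - \<delta> * b" b] that r
  by (auto simp: A_eq_0_iff)

lemma holomorphic_A: "A a b holomorphic_on ball c R" if "a \<in> V"
proof -
  have "(\<lambda>x. \<Sum>i\<le>d. coeff (root_poly (M a x)) i * (f x - \<delta> * b) ^ i) holomorphic_on ball c R"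
    using fam that by (intro holomorphic_intros holomorphic_on_subset[OF f]) (auto simp: root_family_def)
  thus ?thesis
    by (rule holomorphic_transform) (use that in \<open>simp add: A_altdef\<close>)
qed

text \<open>The parameters are composed with \<alpha> and \<beta> so that one statement covers pairs
  \<open>(a, b)\<close>, either variable alone, and the diagonal \<open>a = b\<close> on which the
  cycle is closed.\<close>

lemma continuous_A:
  fixes \<alpha> \<beta> :: "'p::topological_space \<Rightarrow> complex"
  assumes "continuous_on P \<alpha>" "continuous_on P \<beta>" "\<alpha> ` P \<subseteq> V"
  shows "continuous_on (P \<times> ball c R) (\<lambda>(p, x). A (\<alpha> p) (\<beta> p) x)"
proof -
  have 1: "continuous_on (P \<times> ball c R) (\<lambda>z. coeff (root_poly (M (\<alpha> (fst z)) (snd z))) i)" for i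
  proof -
    have "continuous_on (P \<times> ball c R) (\<lambda>z. (\<alpha> (fst z), snd z))"
      by (intro continuous_intros continuous_on_compose2[OF assms(1)]) auto
    moreover have "(\<lambda>z. (\<alpha> (fst z), snd z)) ` (P \<times> ball c R) \<subseteq> V \<times> ball c R"
      using assms(3) by auto
    moreover have "continuous_on (V \<times> ball c R) (\<lambda>(a, b). coeff (root_poly (M a b)) i)"
      using fam by (simp add: root_family_def)
    ultimately show ?thesis
      using continuous_on_compose2 by (fastforce simp: split_beta)
  qed
  have "continuous_on (P \<times> ball c R)
      (\<lambda>z. \<Sum>i\<le>d. coeff (root_poly (M (\<alpha> (fst z)) (snd z))) i * (f (snd z) - \<delta> * \<beta> (fst z)) ^ i)"
    by (intro continuous_intros 1 continuous_on_compose2[OF holomorphic_on_imp_continuous_on[OF f]]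
        continuous_on_compose2[OF assms(2)]) auto
  thus ?thesis
    by (rule continuous_on_eq) (use assms(3) in \<open>auto simp: A_altdef image_subset_iff\<close>)
qed

lemma holomorphic_A_param:
  assumes "\<alpha> holomorphic_on P" "\<beta> holomorphic_on P" "\<alpha> ` P \<subseteq> V" "x \<in> ball c R"
  shows "(\<lambda>p. A (\<alpha> p) (\<beta> p) x) holomorphic_on P"
proof -
  have "(\<lambda>p. coeff (root_poly (M (\<alpha> p) x)) i) holomorphic_on P" for i
    using holomorphic_on_compose_gen[OF assms(1), of "\<lambda>a. coeff (root_poly (M a x)) i" V] fam assms(3,4)
    by (simp add: root_family_def o_def)
  hence "(\<lambda>p. \<Sum>i\<le>d. coeff (root_poly (M (\<alpha> p) x)) i * (f x - \<delta> * \<beta> p) ^ i) holomorphic_on P"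
    by (intro holomorphic_intros assms)
  thus ?thesis
    by (rule holomorphic_transform) (use assms in \<open>auto simp: A_altdef image_subset_iff\<close>)
qed

lemma in_Z_iff: "a \<in> V \<Longrightarrow> b \<in> U \<Longrightarrow> x \<in># Z a b \<longleftrightarrow> x \<in> ball c r \<and> f x - \<delta> * b \<in># M a x"
  unfolding Z_def using A_nz by (subst in_zeros_mset_iff[OF holomorphic_A r]) (auto simp: A_eq_0_iff)

text \<open>The existence argument is applied to \<open>f x - \<delta> * b\<close> with target
  \<open>t - \<delta> * b\<close>, which turns \<open>close\<close> and \<open>hit\<close> into its
  hypotheses for the roots \<open>M a x\<close>.\<close>

lemma Z_nonempty: "Z a b \<noteq> {#}" if ab: "a \<in> V" "b \<in> U"
proof -
  obtain x0 where x0: "x0 \<in> ball c r" "f x0 = t" using hit by auto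
  have "\<exists>x\<in>ball c r. f x - \<delta> * b \<in># M a x"
  proof (rule exists_value_among_roots[where t = "t - \<delta> * b" and ?x0.0 = x0 and d = d, OF _ r])
    fix x y assume "x \<in> sphere c r" "y \<in># M a x"
    thus "cmod (y - (t - \<delta> * b)) < cmod (f x - \<delta> * b - (t - \<delta> * b))"
      using M_sub[of a x y] close[of x y b] ab r by (auto simp: algebra_simps)
  qed (use x0 fam ab in \<open>auto simp: root_family_def intro!: holomorphic_intros holomorphic_on_subset[OF f]\<close>)
  thus ?thesis using in_Z_iff[OF ab] by force
qed

lemma size_Z:
  assumes "connected U" "connected V"
  obtains n where "n > 0" "\<And>a b. a \<in> V \<Longrightarrow> b \<in> U \<Longrightarrow> size (Z a b) = n"
proof (cases "V \<times> U = {}")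
  case True
  thus ?thesis by (intro that[of 1]) auto
next
  case False
  obtain n where n: "\<And>p. p \<in> V \<times> U \<Longrightarrow> size (zeros_mset (A (fst p) (snd p)) (ball c r)) = n"
    by (rule size_zeros_mset_constant[OF continuous_A[of "V \<times> U" fst snd] holomorphic_A r])
       (use A_nz assms in \<open>auto intro!: continuous_intros connected_Times\<close>)
  hence *: "size (Z a b) = n" if "a \<in> V" "b \<in> U" for a b
    using that by (force simp: Z_def)
  moreover have "n > 0"
    using False * Z_nonempty by (metis mem_Sigma_iff ex_in_conv nonempty_has_size surj_pair)
  ultimately show ?thesis using that by blast
qed

text \<open>\<open>Z\<close> satisfies the condition imposed on \<open>M\<close>, for a chain with
  one more coordinate, so that eliminations can be iterated.\<close>

lemma root_family_Z:
  assumes "connected U" "connected V" "open U" "open V"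
  shows "\<exists>n. root_family V U Z n"
proof -
  obtain n where n: "n > 0" "\<And>a b. a \<in> V \<Longrightarrow> b \<in> U \<Longrightarrow> size (Z a b) = n"
    using size_Z assms by blast
  show ?thesis
    unfolding root_family_def
  proof (intro exI[of _ n] conjI allI ballI)
    fix i
    have "continuous_on (V \<times> U) (\<lambda>p. coeff (root_poly (image_mset (\<lambda>x. x) (zeros_mset (A (fst p) (snd p)) (ball c r)))) i)"
      by (rule continuous_on_coeff_root_poly_zeros[OF continuous_A[of "V \<times> U" fst snd] holomorphic_A _ _ r, where d = n])
         (use n A_nz in \<open>auto intro!: continuous_intros holomorphic_intros simp: Z_def split_beta\<close>)
    thus "continuous_on (V \<times> U) (\<lambda>(a, b). coeff (root_poly (Z a b)) i)"
      by (simp add: Z_def split_beta)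
  next
    fix i b assume b: "b \<in> U"
    have "(\<lambda>a. coeff (root_poly (image_mset (\<lambda>x. x) (zeros_mset (A a b) (ball c r)))) i) holomorphic_on V"
      by (rule holomorphic_on_coeff_root_poly_zeros[OF \<open>open V\<close> continuous_A[of V "\<lambda>a. a" "\<lambda>_. b"] holomorphic_A
            holomorphic_A_param[of "\<lambda>a. a" V "\<lambda>_. b"] _ _ _ r, where d = n])
         (use n A_nz b in \<open>auto intro!: continuous_intros holomorphic_intros simp: Z_def split_beta\<close>)
    thus "(\<lambda>a. coeff (root_poly (Z a b)) i) holomorphic_on V"
      by (simp add: Z_def)
  next
    fix i a assume a: "a \<in> V"
    have "(\<lambda>b. coeff (root_poly (image_mset (\<lambda>x. x) (zeros_mset (A a b) (ball c r)))) i) holomorphic_on U"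
      by (rule holomorphic_on_coeff_root_poly_zeros[OF \<open>open U\<close> continuous_A[of U "\<lambda>_. a" "\<lambda>b. b"] holomorphic_A
            holomorphic_A_param[of "\<lambda>_. a" U "\<lambda>b. b"] _ _ _ r, where d = n])
         (use n A_nz a in \<open>auto intro!: continuous_intros holomorphic_intros simp: Z_def split_beta\<close>)
    thus "(\<lambda>b. coeff (root_poly (Z a b)) i) holomorphic_on U"
      by (simp add: Z_def)
  qed (use n in auto)
qed

end

text \<open>The condition concerns the disc of index \<open>Suc i\<close> between its neighbours
  \<open>i\<close> and \<open>Suc (Suc i)\<close>, which avoids a predecessor of 0. Solutions are
  found at radius \<open>r\<close>. The neighbours range over the larger radius \<open>R\<close>,
  because they act as parameters and holomorphy is needed on open sets around the closed
  discs.\<close>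

definition controlled_disc ::
  "(complex \<Rightarrow> complex) \<Rightarrow> complex \<Rightarrow> (nat \<Rightarrow> complex) \<Rightarrow> (nat \<Rightarrow> complex) \<Rightarrow> (nat \<Rightarrow> real) \<Rightarrow> (nat \<Rightarrow> real) \<Rightarrow> nat \<Rightarrow> bool"
  where "controlled_disc f \<delta> c t r R i \<longleftrightarrow> 0 < r (Suc i) \<and> r (Suc i) < R (Suc i) \<and>
    (\<forall>x\<in>sphere (c (Suc i)) (r (Suc i)). \<forall>y\<in>ball (c (Suc (Suc i))) (R (Suc (Suc i))). \<forall>w\<in>ball (c i) (R i).
       cmod (y + \<delta> * w - t (Suc i)) < cmod (f x - t (Suc i))) \<and>
    (\<exists>x\<in>ball (c (Suc i)) (r (Suc i)). f x = t (Suc i))"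

text \<open>The entries of index 0 and \<open>Suc L\<close> are prescribed, the \<open>L\<close>
  entries between them are solved for, and \<open>M a b\<close> lists the possible entries of index
  1. For \<open>L = 0\<close> this entry is \<open>a\<close> itself, so only the radius
  \<open>R 1\<close> is available for it. In the induction step the tail is solved first and the
  entry of index 1 is eliminated afterwards.\<close>

lemma exists_tail_family:
  assumes f: "f holomorphic_on UNIV" and "\<And>i. i < L \<Longrightarrow> controlled_disc f \<delta> c t r R i"
  shows "\<exists>M d. root_family (ball (c (Suc L)) (R (Suc L))) (ball (c 0) (R 0)) M d \<and>
    (\<forall>a\<in>ball (c (Suc L)) (R (Suc L)). \<forall>b\<in>ball (c 0) (R 0). \<forall>y\<in>#M a b.
       y \<in> ball (c 1) (R 1) \<and> (\<forall>i\<in>{1..L}. henon_orbit f \<delta> b y i \<in> ball (c i) (r i)) \<and>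
       henon_orbit f \<delta> b y (Suc L) = a)"
  using assms(2)
proof (induction L arbitrary: c t r R)
  case 0
  have cf: "coeff [:-a, 1:] i = (if i = 0 then -a else if i = Suc 0 then 1 else 0)" for a :: complex and i
    by (simp add: coeff_pCons split: nat.splits)
  have cont: "continuous_on S (\<lambda>z. if i = 0 then - fst z else k)"
    and hol: "(\<lambda>z. if i = 0 then - z else k) holomorphic_on T"
    for S :: "(complex \<times> complex) set" and T and i :: nat and k
    by (cases "i = 0"; auto intro!: holomorphic_intros continuous_intros)+
  show ?case
    by (intro exI[of _ "\<lambda>a b. {#a#}"] exI[of _ 1])
       (auto simp: root_family_def cf intro!: cont hol simp: split_beta
          simp del: coeff_pCons_0)
next
  case (Suc L)
  have "controlled_disc f \<delta> (\<lambda>i. c (Suc i)) (\<lambda>i. t (Suc i)) (\<lambda>i. r (Suc i)) (\<lambda>i. R (Suc i)) i" if "i < L" for i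
    using Suc.prems[of "Suc i"] that by (simp add: controlled_disc_def)
  from Suc.IH[OF this] obtain M d where
    fam: "root_family (ball (c (Suc (Suc L))) (R (Suc (Suc L)))) (ball (c 1) (R 1)) M d" and
    M: "\<And>a b y. a \<in> ball (c (Suc (Suc L))) (R (Suc (Suc L))) \<Longrightarrow> b \<in> ball (c 1) (R 1) \<Longrightarrow> y \<in># M a b \<Longrightarrow>
       y \<in> ball (c 2) (R 2) \<and> (\<forall>i\<in>{1..L}. henon_orbit f \<delta> b y i \<in> ball (c (Suc i)) (r (Suc i))) \<and>
       henon_orbit f \<delta> b y (Suc L) = a"
    by (auto simp: numeral_2_eq_2)
  have "controlled_disc f \<delta> c t r R 0" using Suc.prems by simp
  then interpret elimination_step f \<delta> "c 1" "t 1" "r 1" "R 1" "ball (c 0) (R 0)"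
    "ball (c (Suc (Suc L))) (R (Suc (Suc L)))" "ball (c 2) (R 2)" M d
    using f fam M by unfold_locales (auto simp: controlled_disc_def numeral_2_eq_2)
  have "y \<in> ball (c 1) (R 1) \<and> (\<forall>i\<in>{1..Suc L}. henon_orbit f \<delta> b y i \<in> ball (c i) (r i)) \<and>
       henon_orbit f \<delta> b y (Suc (Suc L)) = a"
    if ab: "a \<in> ball (c (Suc (Suc L))) (R (Suc (Suc L)))" "b \<in> ball (c 0) (R 0)" "y \<in># Z a b" for a b y
  proof -
    have y: "y \<in> ball (c 1) (r 1)" "f y - \<delta> * b \<in># M a y"
      using in_Z_iff[OF ab(1,2)] ab(3) by auto
    have y': "y \<in> ball (c 1) (R 1)" using y r by auto
    show ?thesis
    proof (intro conjI ballI)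
      fix i assume i: "i \<in> {1..Suc L}"
      show "henon_orbit f \<delta> b y i \<in> ball (c i) (r i)"
      proof (cases "i = 1")
        case False
        then obtain j where "i = Suc j" "j \<in> {1..L}" using i by (cases i) auto
        thus ?thesis using M[OF ab(1) y' y(2)] by (auto simp: henon_orbit_shift)
      qed (use y in auto)
    qed (use M[OF ab(1) y' y(2)] y' in \<open>auto simp: henon_orbit_shift\<close>)
  qed
  thus ?case
    using root_family_Z by (intro exI[of _ Z]) auto
qed

text \<open>Entries 0 and N are both set to \<open>s\<close>; the tail family and one more
  elimination solve all equations except the one at index N. With \<open>x\<close> the entry of
  index 1, that one reads \<open>f s = E s x\<close>, again a value to be found among the roots of a
  holomorphic family.\<close>

theorem henon_orbit_through_discs:
  assumes f: "f holomorphic_on UNIV" and "N \<ge> 2"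
    and disc: "\<And>i. i < N \<Longrightarrow> controlled_disc f \<delta> c t r R i"
    and per: "c N = c 0" "c (Suc N) = c 1" "R N = R 0" "R (Suc N) = R 1"
  obtains b y where "b \<in> ball (c N) (r N)" "\<And>i. 0 < i \<Longrightarrow> i < N \<Longrightarrow> henon_orbit f \<delta> b y i \<in> ball (c i) (r i)"
    "henon_orbit f \<delta> b y N = b" "henon_orbit f \<delta> b y (Suc N) = y"
proof -
  obtain L where N: "N = Suc (Suc L)" using \<open>N \<ge> 2\<close> by (metis Suc_le_D numeral_2_eq_2 Suc_le_mono)
  have "controlled_disc f \<delta> (\<lambda>i. c (Suc i)) (\<lambda>i. t (Suc i)) (\<lambda>i. r (Suc i)) (\<lambda>i. R (Suc i)) i" if "i < L" for i
    using disc[of "Suc i"] that N by (simp add: controlled_disc_def)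
  note exists_tail_family[OF f, where L = L and c = "\<lambda>i. c (Suc i)" and t = "\<lambda>i. t (Suc i)"
      and r = "\<lambda>i. r (Suc i)" and R = "\<lambda>i. R (Suc i)", OF this]
  from this obtain M d where
    fam: "root_family (ball (c N) (R N)) (ball (c 1) (R 1)) M d" and
    M: "\<And>a b y. a \<in> ball (c N) (R N) \<Longrightarrow> b \<in> ball (c 1) (R 1) \<Longrightarrow> y \<in># M a b \<Longrightarrow>
       y \<in> ball (c 2) (R 2) \<and> (\<forall>i\<in>{1..L}. henon_orbit f \<delta> b y i \<in> ball (c (Suc i)) (r (Suc i))) \<and>
       henon_orbit f \<delta> b y (Suc L) = a"
    by (auto simp: numeral_2_eq_2 N)
  have "controlled_disc f \<delta> c t r R 0" using disc N by simp
  \<comment> \<open>The previous and the last coordinate range over the same disc, so that the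
    diagonal \<open>a = b\<close> makes sense.\<close>
  then interpret elimination_step f \<delta> "c 1" "t 1" "r 1" "R 1" "ball (c N) (R N)"
    "ball (c N) (R N)" "ball (c 2) (R 2)" M d
    using f fam M per by unfold_locales (auto simp: controlled_disc_def numeral_2_eq_2)
  define E where "E = (\<lambda>s x. x + \<delta> * henon_orbit f \<delta> s x (Suc L))"
  have last: "controlled_disc f \<delta> c t r R (Suc L)" using disc N by simp
  hence rN: "0 < r N" "r N < R N" by (auto simp: controlled_disc_def N)
  obtain x0 where x0: "x0 \<in> ball (c N) (r N)" "f x0 = t N"
    using last by (auto simp: controlled_disc_def N)
  obtain n where n: "n > 0" "\<And>a b. a \<in> ball (c N) (R N) \<Longrightarrow> b \<in> ball (c N) (R N) \<Longrightarrow> size (Z a b) = n"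
    using size_Z by auto
  have Z: "x \<in> ball (c 1) (r 1)" "henon_orbit f \<delta> s x N = s"
      "\<And>i. 0 < i \<Longrightarrow> i < N \<Longrightarrow> henon_orbit f \<delta> s x i \<in> ball (c i) (r i)"
    if s: "s \<in> ball (c N) (R N)" and x: "x \<in># Z s s" for s x
  proof -
    have x: "x \<in> ball (c 1) (r 1)" "f x - \<delta> * s \<in># M s x"
      using in_Z_iff[OF s s] x by auto
    have x': "x \<in> ball (c 1) (R 1)" using x r by auto
    show "x \<in> ball (c 1) (r 1)" by fact
    show "henon_orbit f \<delta> s x N = s"
      using M[OF s x' x(2)] by (simp add: N henon_orbit_shift del: henon_orbit.simps(3))
    fix i assume i: "0 < i" "i < N"
    show "henon_orbit f \<delta> s x i \<in> ball (c i) (r i)"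
    proof (cases "i = 1")
      case False
      then obtain j where "i = Suc j" "j \<in> {1..L}" using i N by (cases i) auto
      thus ?thesis using M[OF s x' x(2)] by (auto simp: henon_orbit_shift)
    qed (use x in auto)
  qed
  have contE: "continuous_on (ball (c N) (R N) \<times> ball (c 1) (R 1)) (\<lambda>(s, x). E s x)"
    unfolding E_def split_beta by (intro continuous_intros continuous_on_henon_orbit[OF f])
  have holE: "E s holomorphic_on X" "(\<lambda>s. E s x) holomorphic_on X" for s x X
    unfolding E_def by (intro holomorphic_intros holomorphic_on_henon_orbit[OF f])+
  have "\<exists>s\<in>ball (c N) (r N). f s \<in># image_mset (E s) (Z s s)"
  proof (rule exists_value_among_roots[OF _ rN, where d = n])
    show "(\<lambda>s. coeff (root_poly (image_mset (E s) (Z s s))) i) holomorphic_on ball (c N) (R N)" for i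
      unfolding Z_def
      by (rule holomorphic_on_coeff_root_poly_zeros[OF _ continuous_A[of _ "\<lambda>s. s" "\<lambda>s. s"] holomorphic_A
            holomorphic_A_param[of "\<lambda>s. s" _ "\<lambda>s. s"] contE holE r, where d = n])
         (use n(2)[unfolded Z_def] A_nz in \<open>auto intro!: continuous_intros holomorphic_intros\<close>)
    fix s y assume s: "s \<in> sphere (c N) (r N)" and "y \<in># image_mset (E s) (Z s s)"
    then obtain x where x: "x \<in># Z s s" "y = E s x" by auto
    have s': "s \<in> ball (c N) (R N)" using s rN by auto
    have "x \<in> ball (c 1) (R 1)" using Z(1)[OF s' x(1)] r by auto
    moreover have "henon_orbit f \<delta> s x (Suc L) \<in> ball (c (Suc L)) (R (Suc L))"
      using Z(3)[OF s' x(1), of "Suc L"] disc[of L] by (auto simp: N controlled_disc_def)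
    ultimately show "cmod (y - t N) < cmod (f s - t N)"
      using last s per by (auto simp: controlled_disc_def N x E_def)
  qed (use n x0 holomorphic_on_subset[OF f] in auto)
  then obtain s x where sx: "s \<in> ball (c N) (r N)" "x \<in># Z s s" "f s = E s x" by auto
  have s: "s \<in> ball (c N) (R N)" using sx(1) rN by auto
  have "henon_orbit f \<delta> s x (Suc N) = f (henon_orbit f \<delta> s x N) - \<delta> * henon_orbit f \<delta> s x (Suc L)"
    using N by simp
  also have "\<dots> = x" using Z(2)[OF s sx(2)] sx(3) by (simp add: E_def)
  finally show ?thesis
    using that[of s x] Z[OF s sx(2)] sx(1) by blast
qed

lemma henon_map_funpow:
  "(henon_map f \<delta> ^^ n) (y, b) = (henon_orbit f \<delta> b y (Suc n), henon_orbit f \<delta> b y n)"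
  by (induction n) (auto simp: henon_map_def)

text \<open>The second coordinate of the k-th iterate lies in the disc of index k, so disjointness
  from the N-th disc excludes an earlier return. The other discs may overlap one another.\<close>

corollary henon_cycle_through_discs:
  assumes "f holomorphic_on UNIV" and "N \<ge> 2"
    and "\<And>i. i < N \<Longrightarrow> controlled_disc f \<delta> c t r R i"
    and "c N = c 0" "c (Suc N) = c 1" "R N = R 0" "R (Suc N) = R 1"
    and disj: "\<And>i. 0 < i \<Longrightarrow> i < N \<Longrightarrow> ball (c N) (r N) \<inter> ball (c i) (r i) = {}"
  obtains p where "minimal_period (henon_map f \<delta>) N p" "snd p \<in> ball (c N) (r N)"
proof -
  obtain b y where b: "b \<in> ball (c N) (r N)" "\<And>i. 0 < i \<Longrightarrow> i < N \<Longrightarrow> henon_orbit f \<delta> b y i \<in> ball (c i) (r i)"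
    "henon_orbit f \<delta> b y N = b" "henon_orbit f \<delta> b y (Suc N) = y"
    using henon_orbit_through_discs[OF assms(1-7)] by blast
  have "henon_orbit f \<delta> b y k \<noteq> b" if "0 < k" "k < N" for k
    using b(1) b(2)[OF that] disj[OF that] by auto
  hence "minimal_period (henon_map f \<delta>) N (y, b)"
    unfolding minimal_period_def henon_map_funpow
    using b(3,4) \<open>N \<ge> 2\<close> by (auto simp del: henon_orbit.simps(3))
  thus ?thesis using that b by auto
qed

subsection \<open>Locally bounded spherical derivatives\<close>

text \<open>The spherical derivative is at most \<open>C\<close>, with the denominator cleared; this
  is the bound in Marty's criterion.\<close>

definition sph_bound :: "(complex \<Rightarrow> complex) \<Rightarrow> real \<Rightarrow> complex set \<Rightarrow> bool" where
  "sph_bound f C S \<longleftrightarrow> (\<forall>z\<in>S. cmod (deriv f z) \<le> C * (1 + (cmod (f z))\<^sup>2))"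

lemma sph_bound_subset: "sph_bound f C S \<Longrightarrow> T \<subseteq> S \<Longrightarrow> sph_bound f C T"
  by (auto simp: sph_bound_def)

text \<open>Until the modulus first reaches \<open>T + 1\<close> on the segment from
  \<open>p\<close> to \<open>x\<close>, the derivative is at most
  \<open>C * (1 + (T + 1)\<^sup>2)\<close>, so the modulus rises by less than 1.\<close>

lemma sph_bound_growth:
  assumes f: "f holomorphic_on ball p r" and sph: "sph_bound f C (ball p r)" and "C \<ge> 0"
    and p: "cmod (f p) \<le> T" and x: "x \<in> ball p r" and small: "C * (1 + (T + 1)\<^sup>2) * dist p x < 1"
  shows "cmod (f x) \<le> T + 1"
proof (rule ccontr)
  assume "\<not> cmod (f x) \<le> T + 1"
  hence x1: "cmod (f x) > T + 1" by simp
  define \<gamma> where "\<gamma> = (\<lambda>t::real. p + of_real t * (x - p))"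
  define g where "g = (\<lambda>t. cmod (f (\<gamma> t)))"
  have \<gamma>_dist: "dist p (\<gamma> t) \<le> dist p x" if "t \<in> {0..1}" for t
    using that by (auto simp: \<gamma>_def dist_norm norm_mult norm_minus_commute intro!: mult_left_le_one_le)
  have \<gamma>_in: "\<gamma> t \<in> ball p r" if "t \<in> {0..1}" for t
    using \<gamma>_dist[OF that] x by simp
  have "continuous_on {0..1} (\<lambda>t. f (\<gamma> t))"
    by (rule continuous_on_compose2[OF holomorphic_on_imp_continuous_on[OF f]])
       (use \<gamma>_in in \<open>auto simp: \<gamma>_def intro!: continuous_intros\<close>)
  hence contg: "continuous_on {0..1} g" unfolding g_def by (intro continuous_intros)
  have g01: "g 0 \<le> T" "g 1 > T + 1" using p x1 by (auto simp: g_def \<gamma>_def)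
  define X where "X = {t \<in> {0..1}. g t = T + 1}"
  have "X \<noteq> {}"
    using IVT'[of g 0 "T + 1" 1] g01 contg by (force simp: X_def)
  moreover have "compact X"
  proof -
    have "closed X"
      unfolding X_def using contg by (intro continuous_closed_preimage_constant) auto
    moreover have "X \<subseteq> {0..1}" by (auto simp: X_def)
    ultimately show ?thesis by (metis compact_Icc compact_Int_closed inf.absorb_iff2)
  qed
  ultimately obtain s where s: "s \<in> X" "\<And>t. t \<in> X \<Longrightarrow> s \<le> t"
    using compact_attains_inf[of X] by auto
  have below: "g t \<le> T + 1" if t: "t \<in> {0..s}" for t
  proof (rule ccontr)
    assume "\<not> g t \<le> T + 1"
    then obtain t' where "0 \<le> t'" "t' \<le> t" "g t' = T + 1"
      using IVT'[of g 0 "T + 1" t] g01 t s continuous_on_subset[OF contg, of "{0..t}"] by (auto simp: X_def)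
    hence "t' \<in> X" using t s by (auto simp: X_def)
    hence "s \<le> t'" by (rule s)
    hence "t' = t" using \<open>t' \<le> t\<close> t by auto
    thus False using \<open>g t' = T + 1\<close> \<open>\<not> g t \<le> T + 1\<close> by simp
  qed
  define B where "B = C * (1 + (T + 1)\<^sup>2)"
  have B: "B \<ge> 0" using \<open>C \<ge> 0\<close> by (simp add: B_def)
  have "cmod (f (\<gamma> s) - f p) \<le> B * cmod (\<gamma> s - p)"
  proof (rule field_differentiable_bound[of "closed_segment p (\<gamma> s)" f "deriv f"])
    fix z assume "z \<in> closed_segment p (\<gamma> s)"
    then obtain u where u: "0 \<le> u" "u \<le> 1" "z = (1 - u) *\<^sub>R p + u *\<^sub>R \<gamma> s"
      by (auto simp: closed_segment_def)
    hence z: "z = \<gamma> (u * s)" by (simp add: \<gamma>_def scaleR_conv_of_real algebra_simps)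
    have us: "u * s \<in> {0..s}" using u s by (auto simp: X_def mult_left_le_one_le)
    hence zin: "z \<in> ball p r" unfolding z using s by (intro \<gamma>_in) (auto simp: X_def)
    thus "(f has_field_derivative deriv f z) (at z within closed_segment p (\<gamma> s))"
      by (meson f holomorphic_derivI open_ball has_field_derivative_at_within)
    have "cmod (f z) \<le> T + 1" using below[OF us] by (simp add: z g_def)
    hence "(cmod (f z))\<^sup>2 \<le> (T + 1)\<^sup>2" by (intro power_mono) auto
    hence "C * (1 + (cmod (f z))\<^sup>2) \<le> B" unfolding B_def using \<open>C \<ge> 0\<close> by (intro mult_left_mono) auto
    thus "cmod (deriv f z) \<le> B" using sph zin by (force simp: sph_bound_def)
  qed auto
  also have "\<dots> \<le> B * dist p x"
    using \<gamma>_dist[of s] s B by (intro mult_left_mono) (auto simp: X_def dist_norm norm_minus_commute)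
  also have "\<dots> < 1" using small by (simp add: B_def)
  finally have "cmod (f (\<gamma> s) - f p) < 1" .
  moreover have "cmod (f (\<gamma> s)) = T + 1" using s by (simp add: X_def g_def)
  ultimately show False
    using norm_triangle_ineq2[of "f (\<gamma> s)" "f p"] p by linarith
qed

text \<open>Growth from \<open>T = 2\<close> has the constant \<open>10 * C\<close> and keeps the
  modulus at most 3. If \<open>cmod (f p) > 2\<close>, a value of modulus at most 1 at
  \<open>z\<close> would, by growth from \<open>T = 1\<close> with the constant
  \<open>5 * C\<close>, force \<open>cmod (f p) \<le> 2\<close>.\<close>

lemma sph_bound_dichotomy:
  assumes f: "f holomorphic_on ball p r" and sph: "sph_bound f C (ball p r)" and "C \<ge> 0"
    and \<rho>: "0 < \<rho>" "2 * \<rho> \<le> r" "10 * C * \<rho> \<le> 1"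
  shows "(\<forall>z\<in>ball p \<rho>. cmod (f z) \<le> 3) \<or> (\<forall>z\<in>ball p \<rho>. cmod (f z) > 1)"
proof (cases "cmod (f p) \<le> 2")
  case True
  have small: "10 * C * dist p x < 1" if "dist p x < \<rho>" for x
    using that \<rho> \<open>C \<ge> 0\<close> by (cases "C = 0") (auto intro: less_le_trans[OF mult_strict_left_mono])
  have "cmod (f z) \<le> 2 + 1" if "z \<in> ball p \<rho>" for z
    using small[of z] that \<rho> by (intro sph_bound_growth[OF f sph \<open>C \<ge> 0\<close> True]) (auto simp: algebra_simps)
  thus ?thesis by auto
next
  case False
  have "cmod (f z) > 1" if z: "z \<in> ball p \<rho>" for z
  proof (rule ccontr)
    assume "\<not> cmod (f z) > 1"
    have sub: "ball z \<rho> \<subseteq> ball p r"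
    proof
      fix x assume "x \<in> ball z \<rho>"
      thus "x \<in> ball p r" using z \<rho> dist_triangle[of p x z] by simp
    qed
    have "5 * C * dist z p \<le> 5 * C * \<rho>"
      using z \<open>C \<ge> 0\<close> by (intro mult_left_mono) (auto simp: dist_commute)
    also have "\<dots> < 1" using \<rho> by simp
    finally have "cmod (f p) \<le> 1 + 1"
      using \<open>\<not> cmod (f z) > 1\<close> z
      by (intro sph_bound_growth[OF holomorphic_on_subset[OF f sub] sph_bound_subset[OF sph sub] \<open>C \<ge> 0\<close>])
         (auto simp: dist_commute algebra_simps)
    thus False using False by simp
  qed
  thus ?thesis by auto
qed

text \<open>The bound of Schottky's theorem at half the radius:
  \<open>2 + 2 * T + 12 * t / (1 - t)\<close> is \<open>14 + 2 * T\<close> at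
  \<open>t = 1/2\<close>.\<close>

definition Schottky_bound :: "real \<Rightarrow> real" where
  "Schottky_bound T = exp (pi * exp (pi * (14 + 2 * T)))"

lemma Schottky_half:
  assumes f: "f holomorphic_on cball q s" and "s > 0" and gt: "\<And>z. z \<in> cball q s \<Longrightarrow> cmod (f z) > 1"
    and q: "cmod (f q) \<le> T" and z: "dist q z \<le> s / 2"
  shows "cmod (f z) \<le> Schottky_bound T"
proof -
  define h where "h = (\<lambda>w. f (q + of_real s * w))"
  have sub: "(\<lambda>w. q + of_real s * w) ` cball 0 1 \<subseteq> cball q s"
    using \<open>s > 0\<close> by (auto simp: dist_norm norm_mult)
  have hol: "h holomorphic_on cball 0 1"
    unfolding h_def by (rule holomorphic_on_compose_gen[OF _ f sub, unfolded o_def]) (intro holomorphic_intros)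
  have "cmod (h ((z - q) / of_real s)) \<le> exp (pi * exp (pi * (2 + 2 * T + 12 * (1/2) / (1 - 1/2))))"
  proof (rule Schottky[OF hol])
    show "\<not> (h w = 0 \<or> h w = 1)" if "w \<in> cball 0 1" for w
      using gt[of "q + of_real s * w"] sub that by (force simp: h_def)
  qed (use q z \<open>s > 0\<close> in \<open>auto simp: h_def norm_divide dist_norm norm_minus_commute field_simps\<close>)
  moreover have "h ((z - q) / of_real s) = f z" using \<open>s > 0\<close> by (simp add: h_def)
  ultimately show ?thesis by (simp add: Schottky_bound_def algebra_simps)
qed

definition locally_sph_bounded :: "(nat \<Rightarrow> complex \<Rightarrow> complex) \<Rightarrow> complex \<Rightarrow> bool" where
  "locally_sph_bounded F p \<longleftrightarrow> (\<exists>r>0. \<exists>C. \<forall>\<^sub>F n in sequentially. sph_bound (F n) C (ball p r))"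

lemma locally_sph_bounded_nonneg:
  assumes "locally_sph_bounded F p"
  obtains r C where "r > 0" "C \<ge> 0" "\<forall>\<^sub>F n in sequentially. sph_bound (F n) C (ball p r)"
proof -
  obtain r C where rC: "r > 0" "\<forall>\<^sub>F n in sequentially. sph_bound (F n) C (ball p r)"
    using assms by (auto simp: locally_sph_bounded_def)
  have "\<forall>\<^sub>F n in sequentially. sph_bound (F n) (max C 0) (ball p r)"
    using rC(2)
  proof eventually_elim
    case (elim n)
    have "C * (1 + (cmod (F n z))\<^sup>2) \<le> max C 0 * (1 + (cmod (F n z))\<^sup>2)" for z
      by (intro mult_right_mono) auto
    thus ?case using elim unfolding sph_bound_def by (meson order_trans)
  qed
  thus ?thesis using that[of r "max C 0"] rC by simp
qed

text \<open>Equicontinuity where values are of bounded size: the radius depends on \<open>T\<close>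
  but not on \<open>n\<close>.\<close>

lemma pointwise_bounded_imp_near:
  fixes F :: "nat \<Rightarrow> complex \<Rightarrow> complex"
  assumes F: "\<And>n. F n holomorphic_on UNIV" and sph: "locally_sph_bounded F p"
  shows "\<exists>r>0. \<forall>\<^sub>F n in sequentially. \<forall>x\<in>ball p r. \<forall>y\<in>ball p r. cmod (F n x) \<le> T \<longrightarrow> cmod (F n y) \<le> T + 1"
proof -
  obtain r C where rC: "r > 0" "C \<ge> 0" "\<forall>\<^sub>F n in sequentially. sph_bound (F n) C (ball p r)"
    using locally_sph_bounded_nonneg[OF sph] .
  define B where "B = C * (1 + (T + 1)\<^sup>2)"
  have "B \<ge> 0" using rC by (simp add: B_def)
  \<comment> \<open>The first term lets \<open>ball x (2 * \<rho>)\<close> fit into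
    \<open>ball p r\<close>, the second makes \<open>B * (2 * \<rho>)\<close> less than 1.\<close>
  define \<rho> where "\<rho> = min (r / 4) (1 / (4 * (B + 1)))"
  have \<rho>: "\<rho> > 0" using rC \<open>B \<ge> 0\<close> by (simp add: \<rho>_def)
  have "\<rho> * (4 * (B + 1)) \<le> 1 / (4 * (B + 1)) * (4 * (B + 1))"
    using \<open>B \<ge> 0\<close> by (intro mult_right_mono) (auto simp: \<rho>_def)
  hence \<rho>B: "\<rho> * (4 * (B + 1)) \<le> 1" using \<open>B \<ge> 0\<close> by simp
  have "\<forall>\<^sub>F n in sequentially. \<forall>x\<in>ball p \<rho>. \<forall>y\<in>ball p \<rho>. cmod (F n x) \<le> T \<longrightarrow> cmod (F n y) \<le> T + 1"
    using rC(3)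
  proof eventually_elim
    case (elim n)
    show ?case
    proof (intro ballI impI)
      fix x y assume xy: "x \<in> ball p \<rho>" "y \<in> ball p \<rho>" "cmod (F n x) \<le> T"
      have xy': "dist x y < 2 * \<rho>"
        using xy dist_triangle_less_add[of x p \<rho> y \<rho>] by (simp add: dist_commute)
      have sub: "ball x (2 * \<rho>) \<subseteq> ball p r"
      proof
        fix z assume "z \<in> ball x (2 * \<rho>)"
        thus "z \<in> ball p r" using xy dist_triangle[of p z x] rC(1) by (simp add: \<rho>_def min_def split: if_splits)
      qed
      have "B * dist x y \<le> B * (2 * \<rho>)" using xy' \<open>B \<ge> 0\<close> by (intro mult_left_mono) auto
      also have "\<dots> < 1" using \<rho>B \<rho> by (simp add: algebra_simps)
      finally have "B * dist x y < 1" .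
      thus "cmod (F n y) \<le> T + 1"
        using xy xy' by (intro sph_bound_growth[OF holomorphic_on_subset[OF F] sph_bound_subset[OF elim sub] \<open>C \<ge> 0\<close>])
          (auto simp: B_def)
    qed
  qed
  thus ?thesis using \<rho> by blast
qed

text \<open>The points with bounded values form an open and closed subset of \<open>S\<close>,
  provided the neighbourhoods do not depend on the bound. Growth alone gives a radius shrinking with
  \<open>T\<close>. Instead the dichotomy is used on a ball chosen before the bound, and in its
  second case Schottky's theorem carries any bound from \<open>x\<close> to
  \<open>y\<close>.\<close>

lemma pointwise_bounded_propagates:
  fixes F :: "nat \<Rightarrow> complex \<Rightarrow> complex"
  assumes F: "\<And>n. F n holomorphic_on UNIV" and "open S" "connected S"
    and sph: "\<And>p. p \<in> S \<Longrightarrow> locally_sph_bounded F p"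
    and ab: "a \<in> S" "b \<in> S" and a: "\<forall>\<^sub>F n in sequentially. cmod (F n a) \<le> T"
  shows "\<exists>B. \<forall>\<^sub>F n in sequentially. cmod (F n b) \<le> B"
proof (rule connected_induction_simple[OF \<open>connected S\<close>, where P = "\<lambda>b. \<exists>B. \<forall>\<^sub>F n in sequentially. cmod (F n b) \<le> B"])
  fix p assume p: "p \<in> S"
  obtain r C where rC: "r > 0" "C \<ge> 0" "\<forall>\<^sub>F n in sequentially. sph_bound (F n) C (ball p r)"
    using locally_sph_bounded_nonneg[OF sph[OF p]] .
  define \<rho> where "\<rho> = min (r / 2) (1 / (10 * (C + 1)))"
  have \<rho>: "0 < \<rho>" "2 * \<rho> \<le> r" using rC by (auto simp: \<rho>_def)
  have "\<rho> * (10 * (C + 1)) \<le> 1 / (10 * (C + 1)) * (10 * (C + 1))"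
    using rC by (intro mult_right_mono) (auto simp: \<rho>_def)
  hence \<rho>C: "10 * C * \<rho> \<le> 1" using rC \<rho> by (simp add: algebra_simps)
  \<comment> \<open>Radius \<open>\<rho> / 8\<close> gives \<open>dist x y < \<rho> / 4\<close>,
    half the radius of \<open>cball x (\<rho> / 2)\<close>, which stays inside
    \<open>ball p \<rho>\<close>.\<close>
  have "\<exists>B. \<forall>\<^sub>F n in sequentially. cmod (F n y) \<le> B"
    if xy: "x \<in> ball p (\<rho> / 8)" "y \<in> ball p (\<rho> / 8)" and B: "\<forall>\<^sub>F n in sequentially. cmod (F n x) \<le> B" for x y B
  proof -
    have "\<forall>\<^sub>F n in sequentially. cmod (F n y) \<le> max 3 (Schottky_bound B)"
      using B rC(3)
    proof eventually_elim
      case (elim n)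
      consider "\<forall>z\<in>ball p \<rho>. cmod (F n z) \<le> 3" | "\<forall>z\<in>ball p \<rho>. cmod (F n z) > 1"
        using sph_bound_dichotomy[OF holomorphic_on_subset[OF F] elim(2) rC(2) \<rho> \<rho>C] by blast
      thus ?case
      proof cases
        case 1
        moreover have "y \<in> ball p \<rho>" using xy \<rho> by simp
        ultimately show ?thesis by force
      next
        case 2
        have sub: "z \<in> ball p \<rho>" if "z \<in> cball x (\<rho> / 2)" for z
          using that xy dist_triangle[of p z x] \<rho> by (simp add: dist_commute)
        have "dist x y \<le> \<rho> / 2 / 2"
          using xy dist_triangle_less_add[of x p "\<rho>/8" y "\<rho>/8"] by (simp add: dist_commute)
        hence "cmod (F n y) \<le> Schottky_bound B"
          using elim(1) \<rho> 2 sub by (intro Schottky_half[of _ x "\<rho> / 2"] holomorphic_on_subset[OF F]) auto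
        thus ?thesis by simp
      qed
    qed
    thus ?thesis by blast
  qed
  note * = this
  have "openin (top_of_set S) (S \<inter> ball p (\<rho> / 8))" "p \<in> S \<inter> ball p (\<rho> / 8)"
    using p \<rho> by (auto simp: openin_open)
  thus "\<exists>T. openin (top_of_set S) T \<and> p \<in> T \<and> (\<forall>x\<in>T. \<forall>y\<in>T. (\<exists>B. \<forall>\<^sub>F n in sequentially. cmod (F n x) \<le> B) \<longrightarrow>
            (\<exists>B. \<forall>\<^sub>F n in sequentially. cmod (F n y) \<le> B))"
  proof (intro exI[of _ "S \<inter> ball p (\<rho> / 8)"] conjI ballI impI)
    fix x y assume xy: "x \<in> S \<inter> ball p (\<rho> / 8)" "y \<in> S \<inter> ball p (\<rho> / 8)"
      and "\<exists>B. \<forall>\<^sub>F n in sequentially. cmod (F n x) \<le> B"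
    then obtain B where "\<forall>\<^sub>F n in sequentially. cmod (F n x) \<le> B" by blast
    from *[OF _ _ this] xy show "\<exists>B. \<forall>\<^sub>F n in sequentially. cmod (F n y) \<le> B" by blast
  qed
qed (fact ab | rule exI[of _ T] a)+

lemma bounded_on_compact:
  fixes F :: "nat \<Rightarrow> complex \<Rightarrow> complex"
  assumes F: "\<And>n. F n holomorphic_on UNIV" and S: "open S" "connected S"
    and sph: "\<And>p. p \<in> S \<Longrightarrow> locally_sph_bounded F p"
    and a: "a \<in> S" "\<forall>\<^sub>F n in sequentially. cmod (F n a) \<le> T" and K: "compact K" "K \<subseteq> S"
  shows "\<exists>B. \<forall>\<^sub>F n in sequentially. \<forall>z\<in>K. cmod (F n z) \<le> B"
proof -
  have "\<exists>r B. r > 0 \<and> (\<forall>\<^sub>F n in sequentially. \<forall>z\<in>ball p r. cmod (F n z) \<le> B)" if p: "p \<in> S" for p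
  proof -
    obtain B where B: "\<forall>\<^sub>F n in sequentially. cmod (F n p) \<le> B"
      using pointwise_bounded_propagates[OF F S sph a(1) p a(2)] by blast
    obtain r where r: "r > 0" "\<forall>\<^sub>F n in sequentially. \<forall>x\<in>ball p r. \<forall>y\<in>ball p r. cmod (F n x) \<le> B \<longrightarrow> cmod (F n y) \<le> B + 1"
      using pointwise_bounded_imp_near[OF F sph[OF p]] by blast
    have "\<forall>\<^sub>F n in sequentially. \<forall>z\<in>ball p r. cmod (F n z) \<le> B + 1"
      using r(2) B by eventually_elim (use r(1) in auto)
    thus ?thesis using r(1) by blast
  qed
  have "\<forall>p\<in>S. \<exists>q. fst q > 0 \<and> (\<forall>\<^sub>F n in sequentially. \<forall>z\<in>ball p (fst q). cmod (F n z) \<le> snd q)"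
  proof (intro ballI, goal_cases)
    case (1 p)
    then obtain r B where "r > 0" "\<forall>\<^sub>F n in sequentially. \<forall>z\<in>ball p r. cmod (F n z) \<le> B"
      using \<open>\<And>p. p \<in> S \<Longrightarrow> \<exists>r B. r > 0 \<and> (\<forall>\<^sub>F n in sequentially. \<forall>z\<in>ball p r. cmod (F n z) \<le> B)\<close>
      by blast
    thus ?case by (intro exI[of _ "(r, B)"]) simp
  qed
  from bchoice[OF this] obtain q where q: "\<forall>p\<in>S. fst (q p) > 0 \<and>
      (\<forall>\<^sub>F n in sequentially. \<forall>z\<in>ball p (fst (q p)). cmod (F n z) \<le> snd (q p))" by blast
  define r B where "r = (\<lambda>p. fst (q p))" and "B = (\<lambda>p. snd (q p))"
  have rB: "r p > 0" "\<forall>\<^sub>F n in sequentially. \<forall>z\<in>ball p (r p). cmod (F n z) \<le> B p" if "p \<in> S" for p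
    using q that by (auto simp: r_def B_def)
  have "K \<subseteq> (\<Union>p\<in>K. ball p (r p))" using rB(1) K(2) by force
  then obtain X where X: "X \<subseteq> K" "finite X" "K \<subseteq> (\<Union>p\<in>X. ball p (r p))"
    using compactE_image[OF K(1), of K "\<lambda>p. ball p (r p)"] by blast
  have "\<forall>\<^sub>F n in sequentially. \<forall>p\<in>X. \<forall>z\<in>ball p (r p). cmod (F n z) \<le> B p"
    using X K rB(2) by (intro eventually_ball_finite) auto
  hence "\<forall>\<^sub>F n in sequentially. \<forall>z\<in>K. cmod (F n z) \<le> Max (insert 0 (B ` X))"
  proof eventually_elim
    case (elim n)
    show ?case
    proof
      fix z assume "z \<in> K"
      then obtain p where "p \<in> X" "z \<in> ball p (r p)" using X by auto
      hence "cmod (F n z) \<le> B p" using elim by auto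
      also have "\<dots> \<le> Max (insert 0 (B ` X))" using X \<open>p \<in> X\<close> by (intro Max_ge) auto
      finally show "cmod (F n z) \<le> Max (insert 0 (B ` X))" .
    qed
  qed
  thus ?thesis by blast
qed

text \<open>A value of modulus at most \<open>T\<close> near \<open>p\<close> would by
  equicontinuity bound \<open>F n p\<close> by \<open>T + 1\<close>; so pointwise divergence is
  locally uniform.\<close>

lemma unbounded_on_compact:
  fixes F :: "nat \<Rightarrow> complex \<Rightarrow> complex"
  assumes F: "\<And>n. F n holomorphic_on UNIV" and K: "compact K"
    and sph: "\<And>p. p \<in> K \<Longrightarrow> locally_sph_bounded F p"
    and unb: "\<And>p B. p \<in> K \<Longrightarrow> \<forall>\<^sub>F n in sequentially. cmod (F n p) > B"
  shows "\<forall>\<^sub>F n in sequentially. \<forall>z\<in>K. cmod (F n z) > T"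
proof -
  have "\<exists>r>0. \<forall>\<^sub>F n in sequentially. \<forall>z\<in>ball p r. cmod (F n z) > T" if p: "p \<in> K" for p
  proof -
    obtain r where r: "r > 0" "\<forall>\<^sub>F n in sequentially. \<forall>x\<in>ball p r. \<forall>y\<in>ball p r. cmod (F n x) \<le> T \<longrightarrow> cmod (F n y) \<le> T + 1"
      using pointwise_bounded_imp_near[OF F sph[OF p]] by blast
    have "\<forall>\<^sub>F n in sequentially. \<forall>z\<in>ball p r. cmod (F n z) > T"
      using r(2) unb[OF p, of "T + 1"]
    proof eventually_elim
      case (elim n)
      show ?case
      proof (rule ballI, rule ccontr)
        fix z assume "z \<in> ball p r" "\<not> cmod (F n z) > T"
        hence "cmod (F n p) \<le> T + 1" using elim(1)[rule_format, of z p] r(1) by simp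
        thus False using elim(2) by simp
      qed
    qed
    thus ?thesis using r(1) by blast
  qed
  hence "\<forall>p\<in>K. \<exists>r. r > 0 \<and> (\<forall>\<^sub>F n in sequentially. \<forall>z\<in>ball p r. cmod (F n z) > T)" by blast
  from bchoice[OF this] obtain r where r: "\<forall>p\<in>K. r p > 0 \<and>
      (\<forall>\<^sub>F n in sequentially. \<forall>z\<in>ball p (r p). cmod (F n z) > T)" by blast
  have "K \<subseteq> (\<Union>p\<in>K. ball p (r p))" using r by force
  then obtain X where X: "X \<subseteq> K" "finite X" "K \<subseteq> (\<Union>p\<in>X. ball p (r p))"
    using compactE_image[OF K(1), of K "\<lambda>p. ball p (r p)"] by blast
  have "\<forall>\<^sub>F n in sequentially. \<forall>p\<in>X. \<forall>z\<in>ball p (r p). cmod (F n z) > T"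
    using X r by (intro eventually_ball_finite) auto
  thus ?thesis by eventually_elim (use X(3) in auto)
qed

subsection \<open>Rescaling at points of non-normality\<close>

text \<open>Keeps rescaled functions from tending to infinity. If \<open>g 0\<close> were huge, the
  dichotomy would give modulus above 1 on the ball of radius 1/20, and Schottky's theorem modulus
  above 200 on the disc of radius 1/80. Cauchy's estimate then bounds the derivative of
  \<open>1 / g\<close> at 0 by 80/200, whereas \<open>norm\<close> makes it at least 1.\<close>

lemma centre_value_bounded:
  assumes g: "g holomorphic_on UNIV" and sph: "sph_bound g 2 (ball 0 1)"
    and norm: "cmod (deriv g 0) \<ge> 1 + (cmod (g 0))\<^sup>2"
  shows "cmod (g 0) \<le> max 3 (Schottky_bound 200)"
proof (rule ccontr)
  assume "\<not> cmod (g 0) \<le> max 3 (Schottky_bound 200)"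
  hence big: "cmod (g 0) > 3" "cmod (g 0) > Schottky_bound 200" by auto
  have "(\<forall>z\<in>ball 0 (1/20). cmod (g z) \<le> 3) \<or> (\<forall>z\<in>ball 0 (1/20). cmod (g z) > 1)"
    by (rule sph_bound_dichotomy[OF holomorphic_on_subset[OF g] sph]) auto
  moreover have "(0::complex) \<in> ball 0 (1/20)" by simp
  ultimately have gt1: "\<And>z. z \<in> ball 0 (1/20) \<Longrightarrow> cmod (g z) > 1"
    using big(1) by (metis not_less)
  have gt: "cmod (g z) > 200" if z: "cmod z \<le> 1/80" for z
  proof (rule ccontr)
    assume "\<not> cmod (g z) > 200"
    hence "cmod (g 0) \<le> Schottky_bound 200"
    proof (intro Schottky_half[of g z "1/40"] holomorphic_on_subset[OF g])
      fix w assume "w \<in> cball z (1/40)"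
      hence "cmod w \<le> 1/40 + cmod z"
        using norm_triangle_ineq[of "w - z" z] by (simp add: dist_norm norm_minus_commute)
      thus "1 < cmod (g w)" using z by (intro gt1) simp
    qed (use z in auto)
    thus False using big by simp
  qed
  define u where "u = (\<lambda>z. 1 / g z)"
  have nz: "g z \<noteq> 0" if "z \<in> cball 0 (1/80)" for z using gt[of z] that by auto
  have u: "u holomorphic_on cball 0 (1/80)"
    unfolding u_def using nz by (intro holomorphic_intros holomorphic_on_subset[OF g]) auto
  have "cmod ((deriv ^^ 1) u 0) \<le> fact 1 * (1/200) / (1/80) ^ 1"
  proof (rule Cauchy_inequality)
    show "u holomorphic_on ball 0 (1/80)" by (rule holomorphic_on_subset[OF u]) auto
    show "continuous_on (cball 0 (1/80)) u" by (rule holomorphic_on_imp_continuous_on[OF u])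
    fix x :: complex assume "cmod (0 - x) = 1/80"
    hence "cmod (g x) > 200" using gt[of x] by simp
    thus "cmod (u x) \<le> 1/200" by (auto simp: u_def norm_divide divide_simps)
  qed auto
  moreover have "(u has_field_derivative - deriv g 0 / (g 0)\<^sup>2) (at 0)"
  proof -
    have "(g has_field_derivative deriv g 0) (at 0)"
      using g by (simp add: holomorphic_derivI)
    thus ?thesis unfolding u_def using nz[of 0]
      by (auto intro!: derivative_eq_intros simp: power2_eq_square)
  qed
  hence "deriv u 0 = - deriv g 0 / (g 0)\<^sup>2" by (rule DERIV_imp_deriv)
  ultimately have "cmod (deriv g 0) / (cmod (g 0))\<^sup>2 \<le> 80/200"
    by (simp add: norm_divide norm_power)
  hence "5 * cmod (deriv g 0) \<le> 2 * (cmod (g 0))\<^sup>2"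
    using nz[of 0] by (simp add: divide_simps)
  hence "cmod (deriv g 0) \<le> (cmod (g 0))\<^sup>2"
    using norm_ge_zero[of "deriv g 0"] by linarith
  thus False using norm by simp
qed

text \<open>The conclusion of Zalcman's lemma for the whole sequence \<open>F\<close> rather than
  for a subsequence, so that several points can have the property simultaneously.\<close>

definition zalcman_point :: "(nat \<Rightarrow> complex \<Rightarrow> complex) \<Rightarrow> complex \<Rightarrow> bool" where
  "zalcman_point F p \<longleftrightarrow> (\<exists>a \<rho> g. a \<longlonglongrightarrow> p \<and> \<rho> \<longlonglongrightarrow> 0 \<and> (\<forall>n. \<rho> n > (0::real)) \<and>
     g holomorphic_on UNIV \<and> \<not> g constant_on UNIV \<and>
     (\<forall>R. uniform_limit (cball 0 R) (\<lambda>n \<zeta>. F n (a n + of_real (\<rho> n) * \<zeta>)) g sequentially))"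

lemma zalcman_point_subseq:
  assumes "zalcman_point F p" "strict_mono \<sigma>"
  shows "zalcman_point (\<lambda>n. F (\<sigma> n)) p"
proof -
  obtain a \<rho> g where *: "a \<longlonglongrightarrow> p" "\<rho> \<longlonglongrightarrow> 0" "\<And>n. \<rho> n > (0::real)"
     "g holomorphic_on UNIV" "\<not> g constant_on UNIV"
     "\<And>R. uniform_limit (cball 0 R) (\<lambda>n \<zeta>. F n (a n + of_real (\<rho> n) * \<zeta>)) g sequentially"
    using assms(1) unfolding zalcman_point_def by blast
  have "uniform_limit (cball 0 R) (\<lambda>n \<zeta>. F (\<sigma> n) (a (\<sigma> n) + of_real (\<rho> (\<sigma> n)) * \<zeta>)) g sequentially" for R
    by (rule filterlim_compose[OF *(6)[of R] filterlim_subseq[OF assms(2)]])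
  thus ?thesis
    unfolding zalcman_point_def
    using LIMSEQ_subseq_LIMSEQ[OF *(1) assms(2)] LIMSEQ_subseq_LIMSEQ[OF *(2) assms(2)] *(3-5)
    by (intro exI[of _ "a \<circ> \<sigma>"] exI[of _ "\<rho> \<circ> \<sigma>"] exI[of _ g]) (simp add: o_def)
qed

text \<open>Rescaling at a point which maximises the spherical derivative, weighted with the distance to
  the boundary of a small disc.\<close>

lemma rescaling_point:
  assumes f: "f holomorphic_on UNIV" and "K \<ge> 1"
    and big: "z0 \<in> ball p (1 / (2 * K))" "cmod (deriv f z0) > 2 * K\<^sup>2 * (1 + (cmod (f z0))\<^sup>2)"
  shows "\<exists>a \<rho>. dist p a \<le> 1 / K \<and> 0 < \<rho> \<and> \<rho> \<le> 1 / K \<and> \<rho> * cmod (deriv f a) = 1 + (cmod (f a))\<^sup>2 \<and>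
    (\<forall>\<zeta>. cmod \<zeta> \<le> K / 2 \<longrightarrow> \<rho> * cmod (deriv f (a + of_real \<rho> * \<zeta>)) \<le> 2 * (1 + (cmod (f (a + of_real \<rho> * \<zeta>)))\<^sup>2))"
proof -
  have "K > 0" using \<open>K \<ge> 1\<close> by simp
  define S where "S = (\<lambda>z. cmod (deriv f z) / (1 + (cmod (f z))\<^sup>2))"
  define \<phi> where "\<phi> = (\<lambda>z. (1 / K - dist p z) * S z)"
  have pos: "1 + (cmod (f z))\<^sup>2 > 0" for z by (simp add: add_pos_nonneg)
  have "deriv f holomorphic_on UNIV" using f by (intro holomorphic_deriv) auto
  hence "continuous_on UNIV f" "continuous_on UNIV (deriv f)"
    using f by (auto intro: holomorphic_on_imp_continuous_on)
  hence "continuous_on (cball p (1 / K)) \<phi>"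
    unfolding \<phi>_def S_def using pos
    by (intro continuous_intros) (auto intro: continuous_on_subset simp: less_imp_neq[OF pos, symmetric])
  then obtain a where a: "a \<in> cball p (1 / K)" "\<And>z. z \<in> cball p (1 / K) \<Longrightarrow> \<phi> z \<le> \<phi> a"
    using continuous_attains_sup[of "cball p (1 / K)" \<phi>] \<open>K > 0\<close> by fastforce
  have half: "1 / K = 1 / (2 * K) + 1 / (2 * K)" using \<open>K > 0\<close> by (simp add: field_simps)
  have Sz0: "S z0 > 2 * K\<^sup>2" using big(2) pos[of z0] by (simp add: S_def divide_simps)
  have dz0: "1 / K - dist p z0 > 1 / (2 * K)" using big(1) half by simp
  have "0 < 1 / (2 * K)" using \<open>K > 0\<close> by simp
  hence "0 < 1 / K - dist p z0" using dz0 by linarith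
  hence "\<phi> z0 > 1 / (2 * K) * (2 * K\<^sup>2)"
    unfolding \<phi>_def by (rule mult_strict_mono[OF dz0 Sz0]) simp
  also have "1 / (2 * K) * (2 * K\<^sup>2) = K" using \<open>K > 0\<close> by (simp add: power2_eq_square)
  finally have "\<phi> z0 > K" .
  moreover have "z0 \<in> cball p (1 / K)"
  proof -
    have "dist p z0 < 1 / (2 * K)" using big(1) by simp
    also have "\<dots> \<le> 1 / K" using \<open>K > 0\<close> by (simp add: field_simps)
    finally show ?thesis by simp
  qed
  ultimately have \<phi>a: "\<phi> a > K" using a(2)[of z0] by simp
  define e where "e = 1 / K - dist p a"
  have "e \<ge> 0" using a(1) by (simp add: e_def)
  have eS: "e * S a > K" using \<phi>a by (simp add: \<phi>_def e_def)
  have S_nonneg: "S z \<ge> 0" for z by (simp add: S_def)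
  have e: "e > 0" using eS \<open>K > 0\<close> \<open>e \<ge> 0\<close> by (cases "e = 0") auto
  have Sa: "S a > 0" using eS \<open>K > 0\<close> S_nonneg[of a] by (cases "S a = 0") auto
  \<comment> \<open>This scale gives the rescaled function spherical derivative 1 at 0. Since
    \<open>\<rho> * K \<le> e\<close>, points within \<open>\<rho> * K / 2\<close> of
    \<open>a\<close> keep at least half of the weight \<open>e\<close>, and maximality of
    \<open>a\<close> yields \<open>S z \<le> 2 * S a\<close> there.\<close>
  define \<rho> where "\<rho> = 1 / S a"
  have \<rho>: "\<rho> > 0" using Sa by (simp add: \<rho>_def)
  have \<rho>K: "\<rho> * K \<le> e" using eS Sa by (simp add: \<rho>_def field_simps)
  have eK: "e \<le> 1 / K" by (simp add: e_def)
  show ?thesis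
  proof (intro exI[of _ a] exI[of _ \<rho>] conjI allI impI)
    show "dist p a \<le> 1 / K" using a(1) by simp
    show "0 < \<rho>" by (rule \<rho>)
    show "\<rho> * cmod (deriv f a) = 1 + (cmod (f a))\<^sup>2"
      using Sa pos[of a] by (cases "deriv f a = 0") (simp_all add: \<rho>_def S_def)
    show "\<rho> \<le> 1 / K"
    proof -
      have "S a * 1 \<ge> K * K"
      proof -
        have "K < e * S a" by (rule eS)
        also have "\<dots> \<le> 1 / K * S a" using eK Sa by (intro mult_right_mono) auto
        finally show ?thesis using \<open>K > 0\<close> by (simp add: field_simps)
      qed
      have "K * 1 \<le> K * K" using \<open>K \<ge> 1\<close> by (intro mult_left_mono) auto
      hence "K \<le> S a" using \<open>S a * 1 \<ge> K * K\<close> by simp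
      thus ?thesis using \<open>K > 0\<close> by (simp add: \<rho>_def frac_le)
    qed
    fix \<zeta> assume \<zeta>: "cmod \<zeta> \<le> K / 2"
    define z where "z = a + of_real \<rho> * \<zeta>"
    have "dist a z = \<rho> * cmod \<zeta>" using \<rho> by (simp add: z_def dist_norm norm_mult)
    also have "\<dots> \<le> \<rho> * (K / 2)" using \<zeta> \<rho> by (intro mult_left_mono) auto
    also have "\<dots> \<le> e / 2" using \<rho>K by simp
    finally have az: "dist a z \<le> e / 2" .
    have pz: "1 / K - dist p z \<ge> e / 2"
      using az dist_triangle[of p z a] by (simp add: e_def)
    have "e / 2 * S z \<le> \<phi> z" unfolding \<phi>_def using pz S_nonneg by (intro mult_right_mono) auto
    also have "\<dots> \<le> \<phi> a" using pz e by (intro a(2)) simp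
    also have "\<dots> = e * S a" by (simp add: \<phi>_def e_def)
    finally have "S z \<le> 2 * S a" using e by simp
    hence "\<rho> * S z \<le> 2" using Sa by (simp add: \<rho>_def field_simps)
    thus "\<rho> * cmod (deriv f (a + of_real \<rho> * \<zeta>)) \<le> 2 * (1 + (cmod (f (a + of_real \<rho> * \<zeta>)))\<^sup>2)"
      using pos[of z] unfolding S_def z_def[symmetric] by (simp add: field_simps)
  qed
qed

text \<open>The rescaled functions have spherical derivative at most 2 on discs of radius tending to
  infinity, and exactly 1 at 0. The first bound together with \<open>centre_value_bounded\<close>
  makes them bounded on compact sets, so Montel's theorem applies; the second keeps the limit from
  being constant.\<close>

theorem zalcman:
  fixes F :: "nat \<Rightarrow> complex \<Rightarrow> complex"
  assumes F: "\<And>n. F n holomorphic_on UNIV" and p: "\<not> locally_sph_bounded F p"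
  shows "\<exists>\<sigma>. strict_mono \<sigma> \<and> zalcman_point (\<lambda>n. F (\<sigma> n)) p"
proof -
  define K where "K = (\<lambda>k. real (Suc k))"
  define Q where "Q = (\<lambda>k n a \<rho>. dist p a \<le> 1 / K k \<and> 0 < \<rho> \<and> \<rho> \<le> 1 / K k \<and>
    \<rho> * cmod (deriv (F n) a) = 1 + (cmod (F n a))\<^sup>2 \<and>
    (\<forall>\<zeta>. cmod \<zeta> \<le> K k / 2 \<longrightarrow>
       \<rho> * cmod (deriv (F n) (a + of_real \<rho> * \<zeta>)) \<le> 2 * (1 + (cmod (F n (a + of_real \<rho> * \<zeta>)))\<^sup>2)))"
  have ex: "\<exists>n\<ge>m. \<exists>a \<rho>. Q k n a \<rho>" for k m
  proof -
    have "\<not> (\<forall>\<^sub>F n in sequentially. sph_bound (F n) (2 * (K k)\<^sup>2) (ball p (1 / (2 * K k))))"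
      using p by (auto simp: locally_sph_bounded_def K_def)
    then obtain n z where "n \<ge> m" "z \<in> ball p (1 / (2 * K k))"
      "cmod (deriv (F n) z) > 2 * (K k)\<^sup>2 * (1 + (cmod (F n z))\<^sup>2)"
      unfolding eventually_sequentially sph_bound_def by (meson not_le)
    moreover from this(2,3) have "\<exists>a \<rho>. Q k n a \<rho>"
      unfolding Q_def by (intro rescaling_point[OF F]) (auto simp: K_def)
    ultimately show ?thesis by blast
  qed
  define h where "h = (\<lambda>k m. SOME n. n \<ge> m \<and> (\<exists>a \<rho>. Q k n a \<rho>))"
  have h: "h k m \<ge> m" "\<exists>a \<rho>. Q k (h k m) a \<rho>" for k m
    using someI_ex[OF ex[of m k]] by (simp_all add: h_def)
  \<comment> \<open>Passing \<open>Suc n\<close> as the lower bound makes the selected indices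
    strictly increasing.\<close>
  define \<sigma> where "\<sigma> = rec_nat (h 0 0) (\<lambda>k n. h (Suc k) (Suc n))"
  have \<sigma>: "strict_mono \<sigma>"
    unfolding strict_mono_Suc_iff \<sigma>_def by (auto intro: Suc_le_lessD h(1))
  have "\<exists>a \<rho>. Q k (\<sigma> k) a \<rho>" for k
    by (cases k) (auto simp: \<sigma>_def h(2))
  then obtain a \<rho> where Q: "\<And>k. Q k (\<sigma> k) (a k) (\<rho> k)" by metis
  have \<rho>: "\<rho> k > 0" for k using Q by (auto simp: Q_def)
  have K0: "(\<lambda>k. 1 / K k) \<longlonglongrightarrow> 0"
    unfolding K_def by (rule LIMSEQ_Suc[OF lim_1_over_n])
  have alim: "a \<longlonglongrightarrow> p"
    by (rule metric_tendsto_imp_tendsto[OF K0]) (use Q in \<open>auto simp: Q_def K_def dist_commute\<close>)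
  have \<rho>lim: "\<rho> \<longlonglongrightarrow> 0"
    by (rule tendsto_sandwich[OF _ _ tendsto_const K0]) (use Q \<rho> in \<open>auto simp: Q_def less_imp_le\<close>)
  define g where "g = (\<lambda>k \<zeta>. F (\<sigma> k) (a k + of_real (\<rho> k) * \<zeta>))"
  have ghol: "g k holomorphic_on X" for k X
  proof -
    have "(F (\<sigma> k) \<circ> (\<lambda>\<zeta>. a k + of_real (\<rho> k) * \<zeta>)) holomorphic_on X"
      by (rule holomorphic_on_compose_gen[OF _ F]) (auto intro!: holomorphic_intros)
    thus ?thesis by (simp add: g_def o_def)
  qed
  have gderiv: "deriv (g k) \<zeta> = of_real (\<rho> k) * deriv (F (\<sigma> k)) (a k + of_real (\<rho> k) * \<zeta>)" for k \<zeta>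
  proof -
    have "(F (\<sigma> k) has_field_derivative deriv (F (\<sigma> k)) (a k + of_real (\<rho> k) * \<zeta>)) (at (a k + of_real (\<rho> k) * \<zeta>))"
      by (rule holomorphic_derivI[OF F]) auto
    hence "((\<lambda>\<zeta>. F (\<sigma> k) (a k + of_real (\<rho> k) * \<zeta>)) has_field_derivative
        deriv (F (\<sigma> k)) (a k + of_real (\<rho> k) * \<zeta>) * of_real (\<rho> k)) (at \<zeta>)"
      by (rule DERIV_chain2[where g = "\<lambda>\<zeta>. a k + of_real (\<rho> k) * \<zeta>"])
         (auto intro!: derivative_eq_intros)
    thus ?thesis
      unfolding g_def by (subst DERIV_imp_deriv) (auto simp: mult.commute)
  qed
  have gsph: "sph_bound (g k) 2 (cball 0 (K k / 2))" for k
    using Q[of k] \<rho>[of k] unfolding sph_bound_def gderiv by (auto simp: norm_mult Q_def g_def)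
  have g0: "cmod (deriv (g k) 0) = 1 + (cmod (g k 0))\<^sup>2" for k
    using Q[of k] \<rho>[of k] unfolding gderiv by (auto simp: norm_mult Q_def g_def)
  have locb: "locally_sph_bounded g q" for q
  proof -
    have "\<forall>\<^sub>F k in sequentially. sph_bound (g k) 2 (ball q 1)"
      unfolding eventually_sequentially
    proof (intro exI[of _ "nat \<lceil>2 * (cmod q + 1)\<rceil>"] allI impI)
      fix k assume "nat \<lceil>2 * (cmod q + 1)\<rceil> \<le> k"
      hence k: "cmod q + 1 \<le> K k / 2" by (simp add: K_def) linarith
      have "ball q 1 \<subseteq> cball 0 (K k / 2)"
      proof
        fix x assume "x \<in> ball q 1"
        thus "x \<in> cball 0 (K k / 2)" using k norm_triangle_ineq[of "x - q" q] by (simp add: dist_norm norm_minus_commute)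
      qed
      thus "sph_bound (g k) 2 (ball q 1)" by (rule sph_bound_subset[OF gsph])
    qed
    thus ?thesis unfolding locally_sph_bounded_def by (intro exI[of _ 1]) auto
  qed
  have bounded0: "\<forall>\<^sub>F k in sequentially. cmod (g k 0) \<le> max 3 (Schottky_bound 200)"
    unfolding eventually_sequentially
  proof (intro exI[of _ 1] allI impI)
    fix k :: nat assume "1 \<le> k"
    hence "ball 0 1 \<subseteq> cball (0::complex) (K k / 2)" by (auto simp: K_def)
    thus "cmod (g k 0) \<le> max 3 (Schottky_bound 200)"
      by (intro centre_value_bounded ghol sph_bound_subset[OF gsph]) (auto simp: g0)
  qed
  have bdd: "\<exists>B. \<forall>h\<in>range g. \<forall>z\<in>X. cmod (h z) \<le> B" if X: "compact X" for X
  proof -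
    obtain B where "\<forall>\<^sub>F k in sequentially. \<forall>z\<in>X. cmod (g k z) \<le> B"
      using bounded_on_compact[OF ghol open_UNIV connected_UNIV locb UNIV_I bounded0 X] by blast
    then obtain m where m: "\<And>k z. k \<ge> m \<Longrightarrow> z \<in> X \<Longrightarrow> cmod (g k z) \<le> B"
      by (auto simp: eventually_sequentially)
    have "\<exists>C. \<forall>z\<in>X. cmod (g k z) \<le> C" for k
    proof -
      have "compact (g k ` X)"
        by (intro compact_continuous_image holomorphic_on_imp_continuous_on ghol X)
      thus ?thesis by (auto dest!: compact_imp_bounded simp: bounded_iff)
    qed
    then obtain C where C: "\<And>k z. z \<in> X \<Longrightarrow> cmod (g k z) \<le> C k" by metis
    have "cmod (g k z) \<le> Max (insert B (C ` {..<m}))" if "z \<in> X" for k z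
    proof (cases "k < m")
      case True
      have "cmod (g k z) \<le> C k" by (rule C[OF that])
      also have "\<dots> \<le> Max (insert B (C ` {..<m}))" using True by (intro Max_ge) auto
      finally show ?thesis .
    next
      case False
      hence "cmod (g k z) \<le> B" using m that by simp
      also have "\<dots> \<le> Max (insert B (C ` {..<m}))" by (intro Max_ge) auto
      finally show ?thesis .
    qed
    thus ?thesis by blast
  qed
  obtain G \<tau> where G: "G holomorphic_on UNIV" "strict_mono \<tau>"
    "\<And>X. compact X \<Longrightarrow> uniform_limit X (g \<circ> \<tau>) G sequentially"
    by (rule Montel[of UNIV "range g" g]) (use ghol bdd in auto)
  \<comment> \<open>A function within 1/2 of a constant on the unit disc has derivative at most 1/2
    at 0, whereas \<open>g0\<close> gives at least 1.\<close>
  have nonconst: "\<not> G constant_on UNIV"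
  proof
    assume "G constant_on UNIV"
    then obtain y where y: "\<And>z. G z = y" by (auto simp: constant_on_def)
    have "uniform_limit (cball 0 1) (g \<circ> \<tau>) G sequentially" by (intro G) auto
    from this[unfolded uniform_limit_iff y o_def, rule_format, of "1 / 2"]
    have "\<forall>\<^sub>F n in sequentially. \<forall>z\<in>cball 0 1. dist (g (\<tau> n) z) y < 1 / 2"
      by simp
    from eventually_happens'[OF sequentially_bot this]
    obtain n where "\<forall>z\<in>cball 0 1. dist (g (\<tau> n) z) y < 1 / 2" ..
    hence n: "\<And>z. z \<in> cball 0 1 \<Longrightarrow> cmod (g (\<tau> n) z - y) < 1 / 2"
      by (simp add: dist_norm)
    have "cmod ((deriv ^^ 1) (\<lambda>z. g (\<tau> n) z - y) 0) \<le> fact 1 * (1 / 2) / 1 ^ 1"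
      by (rule Cauchy_inequality)
         (use n in \<open>auto intro!: holomorphic_intros ghol holomorphic_on_imp_continuous_on less_imp_le\<close>)
    moreover have "deriv (\<lambda>z. g (\<tau> n) z - y) 0 = deriv (g (\<tau> n)) 0"
      using ghol[of "\<tau> n" UNIV] by (subst deriv_diff) (auto simp: holomorphic_on_def)
    ultimately have "1 + (cmod (g (\<tau> n) 0))\<^sup>2 \<le> 1 / 2" by (simp add: g0)
    thus False using zero_le_power2[of "cmod (g (\<tau> n) 0)"] by linarith
  qed
  have "zalcman_point (\<lambda>n. F ((\<sigma> \<circ> \<tau>) n)) p"
    unfolding zalcman_point_def
  proof (intro exI[of _ "a \<circ> \<tau>"] exI[of _ "\<rho> \<circ> \<tau>"] exI[of _ G] conjI allI)
    show "(a \<circ> \<tau>) \<longlonglongrightarrow> p" "(\<rho> \<circ> \<tau>) \<longlonglongrightarrow> 0"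
      using LIMSEQ_subseq_LIMSEQ[OF _ G(2)] alim \<rho>lim by blast+
    show "uniform_limit (cball 0 R) (\<lambda>n \<zeta>. F ((\<sigma> \<circ> \<tau>) n) ((a \<circ> \<tau>) n + complex_of_real ((\<rho> \<circ> \<tau>) n) * \<zeta>)) G sequentially" for R
      using G(3)[of "cball 0 R"] by (simp add: g_def o_def)
  qed (use \<rho> G nonconst in auto)
  moreover have "strict_mono (\<sigma> \<circ> \<tau>)" using \<sigma> G(2) by (rule strict_mono_o)
  ultimately show ?thesis by blast
qed

text \<open>Each stage applies \<open>zalcman\<close> along the current subsequence, which preserves
  the points already found. Collecting stops early only if no point outside \<open>B\<close> and 0
  is left at which spherical derivatives are unbounded.\<close>

lemma zalcman_stages:
  fixes F :: "nat \<Rightarrow> complex \<Rightarrow> complex"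
  assumes F: "\<And>n. F n holomorphic_on UNIV" and start: "p0 \<noteq> 0" "\<not> locally_sph_bounded F p0"
  shows "\<exists>\<sigma> B. strict_mono \<sigma> \<and> finite B \<and> B \<noteq> {} \<and> 0 \<notin> B \<and> (\<forall>b\<in>B. zalcman_point (\<lambda>n. F (\<sigma> n)) b) \<and>
    (card B = Suc m \<or> (\<forall>p. p \<noteq> 0 \<longrightarrow> p \<notin> B \<longrightarrow> locally_sph_bounded (\<lambda>n. F (\<sigma> n)) p))"
proof (induction m)
  case 0
  obtain \<sigma> where "strict_mono \<sigma>" "zalcman_point (\<lambda>n. F (\<sigma> n)) p0"
    using zalcman[OF F start(2)] by blast
  thus ?case using start(1) by (intro exI[of _ \<sigma>] exI[of _ "{p0}"]) auto
next
  case (Suc m)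
  then obtain \<sigma> B where *: "strict_mono \<sigma>" "finite B" "B \<noteq> {}" "0 \<notin> B" "\<forall>b\<in>B. zalcman_point (\<lambda>n. F (\<sigma> n)) b"
    "card B = Suc m \<or> (\<forall>p. p \<noteq> 0 \<longrightarrow> p \<notin> B \<longrightarrow> locally_sph_bounded (\<lambda>n. F (\<sigma> n)) p)" by blast
  show ?case
  proof (cases "\<forall>p. p \<noteq> 0 \<longrightarrow> p \<notin> B \<longrightarrow> locally_sph_bounded (\<lambda>n. F (\<sigma> n)) p")
    case True
    thus ?thesis using * by blast
  next
    case False
    then obtain p where p: "p \<noteq> 0" "p \<notin> B" "\<not> locally_sph_bounded (\<lambda>n. F (\<sigma> n)) p" by blast
    obtain \<tau> where \<tau>: "strict_mono \<tau>" "zalcman_point (\<lambda>n. F (\<sigma> (\<tau> n))) p"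
      using zalcman[OF F p(3)] by auto
    have "strict_mono (\<lambda>n. \<sigma> (\<tau> n))" using strict_mono_o[OF *(1) \<tau>(1)] by (simp add: o_def)
    moreover have "zalcman_point (\<lambda>n. F (\<sigma> (\<tau> n))) b" if "b \<in> insert p B" for b
      using that \<tau> *(5) zalcman_point_subseq[of "\<lambda>n. F (\<sigma> n)" b \<tau>] by auto
    moreover have "card (insert p B) = Suc (Suc m)" using * p False by auto
    ultimately show ?thesis using * p by (intro exI[of _ "\<lambda>n. \<sigma> (\<tau> n)"] exI[of _ "insert p B"]) auto
  qed
qed

text \<open>Minimum modulus principle: without a zero of \<open>f x - t\<close>, its reciprocal
  would violate the maximum principle at \<open>x0\<close>.\<close>

lemma exists_zero_min_modulus:
  assumes f: "f holomorphic_on UNIV" and "r > 0" and bd: "\<And>x. x \<in> sphere c r \<Longrightarrow> cmod (f x - t) \<ge> m"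
    and x0: "x0 \<in> ball c r" "cmod (f x0 - t) < m"
  shows "\<exists>x\<in>ball c r. f x = t"
proof (rule ccontr)
  assume "\<not> (\<exists>x\<in>ball c r. f x = t)"
  moreover have m: "m > 0" using x0 by (meson norm_ge_zero le_less_trans)
  ultimately have nz: "f x - t \<noteq> 0" if "x \<in> cball c r" for x
    using that bd[of x] by (cases "x \<in> ball c r") (force simp: less_le)+
  have hol: "(\<lambda>x. 1 / (f x - t)) holomorphic_on cball c r"
    using nz by (intro holomorphic_intros holomorphic_on_subset[OF f]) auto
  have "cmod (1 / (f x0 - t)) \<le> 1 / m"
  proof (rule maximum_modulus_frontier[where S = "cball c r" and f = "\<lambda>x. 1 / (f x - t)"])
    show "(\<lambda>x. 1 / (f x - t)) holomorphic_on interior (cball c r)"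
      by (rule holomorphic_on_subset[OF hol interior_subset])
    show "continuous_on (closure (cball c r)) (\<lambda>x. 1 / (f x - t))"
      using holomorphic_on_imp_continuous_on[OF hol] by simp
    show "cmod (1 / (f z - t)) \<le> 1 / m" if "z \<in> frontier (cball c r)" for z
      using bd[of z] that m \<open>r > 0\<close> by (auto simp: norm_divide frac_le)
  qed (use x0 in auto)
  moreover have "cmod (f x0 - t) > 0" using nz[of x0] x0 by auto
  ultimately show False using x0 m by (simp add: norm_divide field_simps)
qed

text \<open>The arguments \<open>a n + of_real (\<rho> n) * \<zeta>\<close> tend to
  \<open>p\<close>, so either bound near \<open>p\<close> would pass to the limit \<open>g\<close>
  on the whole plane and contradict Liouville's theorem, applied to \<open>g\<close> or to
  \<open>1 / g\<close>.\<close>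

lemma zalcman_point_unbounded:
  assumes "zalcman_point F p" "e > 0"
  shows "\<not> (\<forall>\<^sub>F n in sequentially. \<forall>z\<in>ball p e. cmod (F n z) \<le> B)"
    and "\<not> (\<forall>\<^sub>F n in sequentially. \<forall>z\<in>ball p e. cmod (F n z) \<ge> 1)"
proof -
  obtain a \<rho> g where *: "a \<longlonglongrightarrow> p" "\<rho> \<longlonglongrightarrow> 0" "\<And>n. \<rho> n > (0::real)"
     "g holomorphic_on UNIV" "\<not> g constant_on UNIV"
     "\<And>R. uniform_limit (cball 0 R) (\<lambda>n \<zeta>. F n (a n + of_real (\<rho> n) * \<zeta>)) g sequentially"
    using assms(1) unfolding zalcman_point_def by blast
  have lim: "(\<lambda>n. F n (a n + of_real (\<rho> n) * \<zeta>)) \<longlonglongrightarrow> g \<zeta>" for \<zeta>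
    by (rule tendsto_uniform_limitI[OF *(6)[of "cmod \<zeta>"]]) simp
  have near: "\<forall>\<^sub>F n in sequentially. a n + of_real (\<rho> n) * \<zeta> \<in> ball p e" for \<zeta>
  proof -
    have "(\<lambda>n. a n + of_real (\<rho> n) * \<zeta>) \<longlonglongrightarrow> p + of_real 0 * \<zeta>"
      by (intro tendsto_intros *(1,2))
    hence "\<forall>\<^sub>F n in sequentially. dist (a n + of_real (\<rho> n) * \<zeta>) p < e"
      using \<open>e > 0\<close> by (auto dest: tendstoD)
    thus ?thesis by (simp add: dist_commute)
  qed
  show "\<not> (\<forall>\<^sub>F n in sequentially. \<forall>z\<in>ball p e. cmod (F n z) \<le> B)"
  proof
    assume "\<forall>\<^sub>F n in sequentially. \<forall>z\<in>ball p e. cmod (F n z) \<le> B"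
    hence "\<forall>\<^sub>F n in sequentially. cmod (F n (a n + of_real (\<rho> n) * \<zeta>)) \<le> B" for \<zeta>
      using near[of \<zeta>] by eventually_elim auto
    hence "cmod (g \<zeta>) \<le> B" for \<zeta>
      by (intro tendsto_upperbound[OF tendsto_norm[OF lim]]) auto
    hence "g constant_on UNIV"
      by (intro Liouville_theorem *(4)) (auto simp: bounded_iff)
    thus False using * by blast
  qed
  show "\<not> (\<forall>\<^sub>F n in sequentially. \<forall>z\<in>ball p e. cmod (F n z) \<ge> 1)"
  proof
    assume "\<forall>\<^sub>F n in sequentially. \<forall>z\<in>ball p e. cmod (F n z) \<ge> 1"
    hence "\<forall>\<^sub>F n in sequentially. cmod (F n (a n + of_real (\<rho> n) * \<zeta>)) \<ge> 1" for \<zeta>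
      using near[of \<zeta>] by eventually_elim auto
    hence g1: "cmod (g \<zeta>) \<ge> 1" for \<zeta>
      by (intro tendsto_lowerbound[OF tendsto_norm[OF lim]]) auto
    hence nz: "g \<zeta> \<noteq> 0" for \<zeta> by (metis norm_zero not_one_le_zero)
    have "(\<lambda>\<zeta>. 1 / g \<zeta>) constant_on UNIV"
      using g1 nz by (intro Liouville_theorem holomorphic_intros *(4))
        (auto simp: bounded_iff norm_divide divide_le_eq intro!: exI[of _ 1])
    then obtain y where "\<And>\<zeta>. 1 / g \<zeta> = y" by (auto simp: constant_on_def)
    hence "1 / (1 / g \<zeta>) = 1 / y" for \<zeta> by simp
    hence "g \<zeta> = 1 / y" for \<zeta> by simp
    hence "g constant_on UNIV" by (auto simp: constant_on_def)
    thus False using * by blast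
  qed
qed

subsection \<open>Islands and words\<close>

text \<open>The discs shrink to \<open>b\<close>, while the distance \<open>m\<close> kept by the
  images of their boundaries from \<open>t\<close> is the same for all large \<open>n\<close>. This
  contrast is what makes the disc condition reachable.\<close>

definition island_at :: "(nat \<Rightarrow> complex \<Rightarrow> complex) \<Rightarrow> complex \<Rightarrow> complex \<Rightarrow> (nat \<Rightarrow> complex) \<Rightarrow> (nat \<Rightarrow> real) \<Rightarrow> real \<Rightarrow> bool" where
  "island_at F b t c r m \<longleftrightarrow> m > 0 \<and> c \<longlonglongrightarrow> b \<and> r \<longlonglongrightarrow> 0 \<and> (\<forall>n. r n > 0) \<and>
     (\<forall>\<^sub>F n in sequentially. (\<forall>x\<in>sphere (c n) (r n). cmod (F n x - t) \<ge> m) \<and> (\<exists>x\<in>ball (c n) (r n). F n x = t))"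

text \<open>By Picard's little theorem the limit \<open>g\<close> omits at most one value. For any
  other \<open>t\<close>, a circle around an isolated solution of \<open>g \<zeta> = t\<close> is
  carried by the rescaling to shrinking circles, and uniform convergence preserves half of the
  distance to \<open>t\<close>.\<close>

lemma zalcman_point_islands:
  assumes F: "\<And>n. F n holomorphic_on UNIV" and "zalcman_point F b"
  shows "\<exists>e. \<forall>t. t \<noteq> e \<longrightarrow> (\<exists>c r m. island_at F b t c r m)"
proof -
  obtain a \<rho> g where *: "a \<longlonglongrightarrow> b" "\<rho> \<longlonglongrightarrow> 0" "\<And>n. \<rho> n > (0::real)"
     "g holomorphic_on UNIV" "\<not> g constant_on UNIV"
     "\<And>R. uniform_limit (cball 0 R) (\<lambda>n \<zeta>. F n (a n + of_real (\<rho> n) * \<zeta>)) g sequentially"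
    using assms(2) unfolding zalcman_point_def by blast
  have "\<exists>e. \<forall>t. t \<noteq> e \<longrightarrow> t \<in> range g"
  proof (cases "\<exists>e. e \<notin> range g")
    case True
    then obtain e where e: "e \<notin> range g" by blast
    have "t \<in> range g" if t: "t \<noteq> e" for t
    proof (rule ccontr)
      assume "t \<notin> range g"
      then obtain k where "g = (\<lambda>x. k)"
        using little_Picard[OF *(4) t] e by auto
      thus False using *(5) by (auto simp: constant_on_def)
    qed
    thus ?thesis by blast
  qed auto
  then obtain e where e: "\<And>t. t \<noteq> e \<Longrightarrow> t \<in> range g" by blast
  have "\<exists>c r m. island_at F b t c r m" if "t \<noteq> e" for t
  proof -
    from e[OF that] obtain \<alpha> where \<alpha>: "g \<alpha> = t" by auto
    obtain \<beta> where \<beta>: "g \<beta> \<noteq> t" using *(5) by (auto simp: constant_on_def)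
    obtain s where s: "s > 0" "\<And>z. z \<in> ball \<alpha> s - {\<alpha>} \<Longrightarrow> g z - t \<noteq> 0"
      by (rule isolated_zeros[of "\<lambda>z. g z - t" UNIV \<alpha> \<beta>])
         (use \<alpha> \<beta> in \<open>auto intro!: holomorphic_intros *(4)\<close>)
    define \<kappa> where "\<kappa> = s / 2"
    have \<kappa>: "\<kappa> > 0" "\<kappa> < s" using s by (auto simp: \<kappa>_def)
    have "continuous_on (sphere \<alpha> \<kappa>) (\<lambda>z. cmod (g z - t))"
      by (intro continuous_intros holomorphic_on_imp_continuous_on holomorphic_on_subset[OF *(4)]) auto
    then obtain z0 where z0: "z0 \<in> sphere \<alpha> \<kappa>" "\<And>z. z \<in> sphere \<alpha> \<kappa> \<Longrightarrow> cmod (g z0 - t) \<le> cmod (g z - t)"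
      using continuous_attains_inf[of "sphere \<alpha> \<kappa>" "\<lambda>z. cmod (g z - t)"] \<kappa> by auto
    define \<mu> where "\<mu> = cmod (g z0 - t)"
    have \<mu>: "\<mu> > 0" using s(2)[of z0] z0(1) \<kappa> by (auto simp: \<mu>_def)
    define c where "c = (\<lambda>n. a n + of_real (\<rho> n) * \<alpha>)"
    define r where "r = (\<lambda>n. \<rho> n * \<kappa>)"
    have "uniform_limit (cball 0 (cmod \<alpha> + \<kappa>)) (\<lambda>n \<zeta>. F n (a n + of_real (\<rho> n) * \<zeta>)) g sequentially"
      by (rule *(6))
    hence "\<forall>\<^sub>F n in sequentially. \<forall>\<zeta>\<in>cball 0 (cmod \<alpha> + \<kappa>). dist (F n (a n + of_real (\<rho> n) * \<zeta>)) (g \<zeta>) < \<mu> / 2"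
      using \<mu> by (auto simp: uniform_limit_iff dest!: spec[of _ "\<mu> / 2"])
    hence ev: "\<forall>\<^sub>F n in sequentially. (\<forall>x\<in>sphere (c n) (r n). cmod (F n x - t) \<ge> \<mu> / 2) \<and> (\<exists>x\<in>ball (c n) (r n). F n x = t)"
    proof eventually_elim
      case (elim n)
      have 1: "cmod (F n x - t) \<ge> \<mu> / 2" if x: "x \<in> sphere (c n) (r n)" for x
      proof -
        define \<zeta> where "\<zeta> = (x - a n) / of_real (\<rho> n)"
        have x': "x = a n + of_real (\<rho> n) * \<zeta>" using *(3)[of n] by (simp add: \<zeta>_def)
        have "cmod (of_real (\<rho> n) * (\<alpha> - \<zeta>)) = \<rho> n * \<kappa>"
          using x by (simp add: x' c_def r_def dist_norm algebra_simps)
        hence \<zeta>: "\<zeta> \<in> sphere \<alpha> \<kappa>" using *(3)[of n] by (simp add: norm_mult dist_norm)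
        have "\<zeta> \<in> cball 0 (cmod \<alpha> + \<kappa>)"
          using \<zeta> norm_triangle_ineq2[of \<zeta> \<alpha>] by (simp add: dist_norm norm_minus_commute)
        hence "cmod (F n x - g \<zeta>) < \<mu> / 2" using elim by (simp add: x' dist_norm)
        moreover have "\<mu> \<le> cmod (g \<zeta> - t)" using z0(2)[OF \<zeta>] by (simp add: \<mu>_def)
        moreover have "cmod (g \<zeta> - t) \<le> cmod (F n x - g \<zeta>) + cmod (F n x - t)"
          using norm_triangle_ineq4[of "F n x - t" "F n x - g \<zeta>"] by simp
        ultimately show ?thesis by linarith
      qed
      have "cmod (F n (c n) - t) < \<mu> / 2"
        using elim \<alpha> \<kappa> by (auto simp: c_def dist_norm)
      hence "\<exists>x\<in>ball (c n) (r n). F n x = t"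
        using 1 *(3)[of n] \<kappa> by (intro exists_zero_min_modulus[OF F, where ?x0.0 = "c n" and m = "\<mu> / 2"]) (auto simp: r_def)
      thus ?case using 1 by blast
    qed
    have "c \<longlonglongrightarrow> b + of_real 0 * \<alpha>" unfolding c_def by (intro tendsto_intros *(1,2))
    moreover have "r \<longlonglongrightarrow> 0 * \<kappa>" unfolding r_def by (intro tendsto_intros *(2))
    ultimately have "island_at F b t c r (\<mu> / 2)"
      using \<mu> \<kappa> *(3) ev unfolding island_at_def by (auto simp: r_def)
    thus ?thesis by blast
  qed
  thus ?thesis by blast
qed

section \<open>Counting words in Zalcman points\<close>

lemma card_determined_coordinate:
  assumes "finite B" and k: "k < N" and Y: "Y \<subseteq> PiE {..<N} (\<lambda>_. B)"
    and det: "\<And>u v. u \<in> Y \<Longrightarrow> v \<in> Y \<Longrightarrow> (\<And>j. j < N \<Longrightarrow> j \<noteq> k \<Longrightarrow> u j = v j) \<Longrightarrow> u k = v k"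
  shows "card Y \<le> card B ^ (N - 1)"
proof -
  define h where "h = (\<lambda>w :: nat \<Rightarrow> 'a. restrict w ({..<N} - {k}))"
  have "inj_on h Y"
  proof (rule inj_onI)
    fix u v assume uv: "u \<in> Y" "v \<in> Y" "h u = h v"
    have uP: "u \<in> PiE {..<N} (\<lambda>_. B)" and vP: "v \<in> PiE {..<N} (\<lambda>_. B)" using uv Y by auto
    have j: "u j = v j" if "j < N" "j \<noteq> k" for j
      using fun_cong[OF uv(3), of j] that by (simp add: h_def)
    hence "u k = v k" using det uv by blast
    show "u = v"
    proof
      fix j show "u j = v j"
        using j[of j] \<open>u k = v k\<close> PiE_arb[OF uP, of j] PiE_arb[OF vP, of j]
        by (cases "j < N"; cases "j = k") auto
    qed
  qed
  moreover have "h ` Y \<subseteq> PiE ({..<N} - {k}) (\<lambda>_. B)"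
  proof (rule image_subsetI)
    fix u assume "u \<in> Y"
    hence "u \<in> PiE {..<N} (\<lambda>_. B)" using Y by auto
    thus "h u \<in> PiE ({..<N} - {k}) (\<lambda>_. B)"
      unfolding h_def restrict_PiE_iff by (auto dest: PiE_mem)
  qed
  moreover have "finite (PiE ({..<N} - {k}) (\<lambda>_. B))" using \<open>finite B\<close> by (intro finite_PiE) auto
  ultimately have "card Y \<le> card (PiE ({..<N} - {k}) (\<lambda>_. B))"
    by (metis card_image card_mono)
  also have "\<dots> = card B ^ (N - 1)" using k by (simp add: card_PiE)
  finally show ?thesis .
qed

text \<open>The letter \<open>w i\<close> is the point near which entry i of the cycle will lie.
  Each forbidden equation determines one letter from the others, hence excludes at most
  \<open>card B ^ (N - 1)\<close> words. There are N equations with \<open>e\<close> and N - 1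
  equations \<open>w i = w 0\<close>, and \<open>2 * N - 1 < card B\<close>: this is the origin of
  the number 2N. In \<open>E i\<close> the equation is solved for the successor, since
  \<open>w i\<close> enters through the arbitrary function \<open>e\<close>.\<close>

lemma exists_word:
  fixes B :: "complex set" and e :: "complex \<Rightarrow> complex"
  assumes "finite B" "card B = 2 * N" "N \<ge> 3"
  shows "\<exists>w :: nat \<Rightarrow> complex. (\<forall>i<N. w i \<in> B) \<and> (\<forall>i\<in>{0<..<N}. w i \<noteq> w 0) \<and>
    (\<forall>i<N. w (Suc i mod N) + \<delta> * w ((i + N - 1) mod N) \<noteq> e (w i))"
proof -
  define X where "X = PiE {..<N} (\<lambda>_. B)"
  define E where "E = (\<lambda>i. {w \<in> X. w (Suc i mod N) + \<delta> * w ((i + N - 1) mod N) = e (w i)})"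
  define D where "D = (\<lambda>i. {w \<in> X. w i = w 0})"
  define M where "M = card B ^ (N - 1)"
  have fin: "finite X" unfolding X_def by (intro finite_PiE finite_lessThan assms(1))
  have E: "card (E i) \<le> M" if i: "i < N" for i
    unfolding M_def
  proof (rule card_determined_coordinate[OF \<open>finite B\<close>, where k = "Suc i mod N"])
    have "(i + N - 1) mod N = (if i = 0 then N - 1 else i - 1)"
    proof (cases "i = 0")
      case True
      have "(N - 1) mod N = N - 1" by (rule mod_less) (use \<open>N \<ge> 3\<close> in linarith)
      thus ?thesis unfolding True by (simp only: add_0 simp_thms if_True)
    next
      case False
      hence "i + N - 1 = (i - 1) + N" by linarith
      hence "(i + N - 1) mod N = (i - 1) mod N" by (simp only: mod_add_self2)
      also have "(i - 1) mod N = i - 1" by (rule mod_less) (use i in linarith)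
      finally show ?thesis using False by (simp only: if_False)
    qed
    moreover have "Suc i mod N = (if Suc i = N then 0 else Suc i)" using i by simp
    \<comment> \<open>For N = 2 successor and predecessor would be the same letter, with coefficient
      \<open>1 + \<delta>\<close>.\<close>
    ultimately have ne: "i \<noteq> Suc i mod N" "(i + N - 1) mod N \<noteq> Suc i mod N"
      using i \<open>N \<ge> 3\<close> by auto
    fix u v assume uv: "u \<in> E i" "v \<in> E i" "\<And>j. j < N \<Longrightarrow> j \<noteq> Suc i mod N \<Longrightarrow> u j = v j"
    have "u i = v i" "u ((i + N - 1) mod N) = v ((i + N - 1) mod N)"
      using uv(3) ne i by auto
    moreover have "u (Suc i mod N) = e (u i) - \<delta> * u ((i + N - 1) mod N)"
      "v (Suc i mod N) = e (v i) - \<delta> * v ((i + N - 1) mod N)"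
      using uv(1,2) by (auto simp: E_def eq_diff_eq)
    ultimately show "u (Suc i mod N) = v (Suc i mod N)" by simp
  qed (use i in \<open>auto simp: E_def X_def\<close>)
  have D: "card (D i) \<le> M" if i: "0 < i" "i < N" for i
    unfolding M_def
    by (rule card_determined_coordinate[OF \<open>finite B\<close>, where k = i])
       (use i in \<open>auto simp: D_def X_def\<close>)
  have "card ((\<Union>i\<in>{..<N}. E i) \<union> (\<Union>i\<in>{0<..<N}. D i)) \<le> card (\<Union>i\<in>{..<N}. E i) + card (\<Union>i\<in>{0<..<N}. D i)"
    by (rule card_Un_le)
  also have "\<dots> \<le> (\<Sum>i\<in>{..<N}. card (E i)) + (\<Sum>i\<in>{0<..<N}. card (D i))"
    by (intro add_mono card_UN_le) auto
  also have "\<dots> \<le> (\<Sum>i\<in>{..<N}. M) + (\<Sum>i\<in>{0<..<N}. M)"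
    by (intro add_mono sum_mono E D) auto
  also have "\<dots> = (N + (N - 1)) * M"
    by (simp add: add_mult_distrib)
  also have "\<dots> < 2 * N * M"
  proof (rule mult_strict_right_mono)
    show "N + (N - 1) < 2 * N" "0 < M"
      using assms(2,3) unfolding M_def by (simp_all del: mult_2)
  qed
  also have "\<dots> = card X"
    using assms by (cases N) (simp_all add: X_def M_def card_PiE)
  finally have "card ((\<Union>i\<in>{..<N}. E i) \<union> (\<Union>i\<in>{0<..<N}. D i)) < card X" .
  moreover have "finite ((\<Union>i\<in>{..<N}. E i) \<union> (\<Union>i\<in>{0<..<N}. D i))"
    using fin by (rule rev_finite_subset) (auto simp: E_def D_def)
  ultimately have "\<not> X \<subseteq> (\<Union>i\<in>{..<N}. E i) \<union> (\<Union>i\<in>{0<..<N}. D i)"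
    by (meson card_mono not_le)
  then obtain w where w: "w \<in> X" "w \<notin> (\<Union>i\<in>{..<N}. E i) \<union> (\<Union>i\<in>{0<..<N}. D i)"
    by blast
  have nE: "w \<notin> E i" if "i < N" for i
  proof
    assume "w \<in> E i"
    hence "w \<in> (\<Union>i\<in>{..<N}. E i)" by (rule UN_I[rotated]) (use that in simp)
    thus False using w(2) by (simp only: Un_iff simp_thms)
  qed
  have nD: "w \<notin> D i" if "i \<in> {0<..<N}" for i
  proof
    assume "w \<in> D i"
    hence "w \<in> (\<Union>i\<in>{0<..<N}. D i)" by (rule UN_I[rotated]) (use that in simp)
    thus False using w(2) by (simp only: Un_iff simp_thms)
  qed
  have "w i \<in> B" if "i < N" for i
    using PiE_mem[OF w(1)[unfolded X_def], of i] that by (simp only: lessThan_iff)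
  thus ?thesis
    using w(1) nE nD unfolding E_def D_def mem_Collect_eq
    by (intro exI[of _ w] conjI allI impI ballI notI) (simp_all only: simp_thms)
qed

section \<open>Transfer of periodic points from the rescaled maps\<close>

lemma minimal_period_rescale:
  assumes "\<rho> \<noteq> 0" and p: "minimal_period (henon_map (\<lambda>z. f (\<rho> * z) / \<rho>) \<delta>) N p"
  shows "minimal_period (henon_map f \<delta>) N (\<rho> * fst p, \<rho> * snd p)"
proof -
  define S where "S = (\<lambda>p::complex \<times> complex. (\<rho> * fst p, \<rho> * snd p))"
  have inj: "S p = S q \<longleftrightarrow> p = q" for p q using \<open>\<rho> \<noteq> 0\<close> by (auto simp: S_def prod_eq_iff)
  \<comment> \<open>Scaling conjugates the two maps because the term \<open>\<delta> * w\<close> is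
    linear.\<close>
  have "henon_map f \<delta> (S p) = S (henon_map (\<lambda>z. f (\<rho> * z) / \<rho>) \<delta> p)" for p
    using \<open>\<rho> \<noteq> 0\<close> by (simp add: henon_map_def S_def case_prod_unfold algebra_simps)
  hence "(henon_map f \<delta> ^^ k) (S p) = S ((henon_map (\<lambda>z. f (\<rho> * z) / \<rho>) \<delta> ^^ k) p)" for k
    by (induction k) auto
  hence "minimal_period (henon_map f \<delta>) N (S p)"
    using p by (simp add: minimal_period_def inj)
  thus ?thesis by (simp add: S_def)
qed

lemma infinite_cycles_if_unbounded:
  fixes H :: "complex \<times> complex \<Rightarrow> complex \<times> complex"
  assumes "\<And>B. \<exists>p. minimal_period H N p \<and> cmod (snd p) > B"
  shows "infinite (cycles_of_period H N)"
proof
  assume "finite (cycles_of_period H N)"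
  moreover have "finite C" if "C \<in> cycles_of_period H N" for C
    using that by (auto simp: cycles_of_period_def cycle_of_def)
  ultimately have "finite ((\<lambda>p. cmod (snd p)) ` \<Union>(cycles_of_period H N))" by auto
  then obtain B where B: "\<And>p. p \<in> \<Union>(cycles_of_period H N) \<Longrightarrow> cmod (snd p) \<le> B"
    using bdd_above_finite by (force simp: bdd_above_def)
  obtain p where p: "minimal_period H N p" "cmod (snd p) > B" using assms by blast
  have "0 < N" using p by (simp add: minimal_period_def)
  hence "p \<in> cycle_of H N p" by (auto simp: cycle_of_def intro!: exI[of _ 0])
  hence "p \<in> \<Union>(cycles_of_period H N)" using p unfolding cycles_of_period_def by blast
  thus False using B[of p] p(2) by linarith
qed

text \<open>The factors leave no gaps: every large \<open>w\<close> is
  \<open>of_nat (Suc n) * z\<close> with \<open>z\<close> of modulus between 1 and 2 and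
  \<open>n\<close> large. The unbounded case of \<open>rescale_not_normal\<close> depends on
  this.\<close>

definition rescale :: "(complex \<Rightarrow> complex) \<Rightarrow> nat \<Rightarrow> complex \<Rightarrow> complex" where
  "rescale f n z = f (of_nat (Suc n) * z) / of_nat (Suc n)"

lemma holomorphic_rescale:
  assumes "f holomorphic_on UNIV"
  shows "rescale f n holomorphic_on X"
proof -
  have "(f \<circ> (\<lambda>z. of_nat (Suc n) * z)) holomorphic_on X"
    by (rule holomorphic_on_compose_gen[OF _ assms]) (auto intro!: holomorphic_intros)
  from holomorphic_on_mult[OF holomorphic_on_const[of "1 / of_nat (Suc n)"] this]
  show ?thesis by (simp add: rescale_def[abs_def] o_def)
qed

text \<open>Scaling back moves a point at distance \<epsilon> from 0 to distance
  \<open>real (Suc n) * \<epsilon>\<close>, which exceeds any bound.\<close>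

lemma infinite_cycles_if_rescaled:
  assumes "\<epsilon> > 0" and "\<And>m. \<exists>n\<ge>m. \<exists>p. minimal_period (henon_map (rescale f n) \<delta>) N p \<and> cmod (snd p) \<ge> \<epsilon>"
  shows "infinite (cycles_of_period (henon_map f \<delta>) N)"
proof (rule infinite_cycles_if_unbounded)
  fix B :: real
  obtain n p where n: "n \<ge> nat \<lceil>B / \<epsilon>\<rceil>" and p: "minimal_period (henon_map (rescale f n) \<delta>) N p" "cmod (snd p) \<ge> \<epsilon>"
    using assms(2) by blast
  have "B / \<epsilon> < real (Suc n)" using n by linarith
  hence "B < real (Suc n) * \<epsilon>" using \<open>\<epsilon> > 0\<close> by (simp add: field_simps)
  also have "\<dots> \<le> real (Suc n) * cmod (snd p)" using p by (intro mult_left_mono) auto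
  also have "\<dots> = cmod (of_nat (Suc n) * snd p)" by (simp only: norm_mult norm_of_nat)
  finally have "B < cmod (of_nat (Suc n) * snd p)" .
  moreover have "minimal_period (henon_map f \<delta>) N (of_nat (Suc n) * fst p, of_nat (Suc n) * snd p)"
    using p(1) by (intro minimal_period_rescale) (simp_all only: rescale_def[abs_def] of_nat_neq_0 not_False_eq_True)
  ultimately show "\<exists>p. minimal_period (henon_map f \<delta>) N p \<and> cmod (snd p) > B" by force
qed

subsection \<open>Rescalings of a transcendental entire function\<close>

lemma locally_sph_bounded_subseq:
  assumes "locally_sph_bounded F p" "strict_mono \<tau>"
  shows "locally_sph_bounded (\<lambda>n. F (\<tau> n)) p"
proof -
  obtain r C where "r > 0" "\<forall>\<^sub>F n in sequentially. sph_bound (F n) C (ball p r)"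
    using assms(1) by (auto simp: locally_sph_bounded_def)
  moreover from eventually_subseq[OF assms(2) this(2)]
  have "\<forall>\<^sub>F n in sequentially. sph_bound (F (\<tau> n)) C (ball p r)" .
  ultimately show ?thesis unfolding locally_sph_bounded_def by blast
qed

lemma not_eventually_subseq:
  assumes "\<not> (\<forall>\<^sub>F n in sequentially. P n)"
  obtains \<tau> :: "nat \<Rightarrow> nat" where "strict_mono \<tau>" "\<And>n. \<not> P (\<tau> n)"
proof -
  have "infinite {n. \<not> P n}"
    using assms by (auto simp: eventually_sequentially infinite_nat_iff_unbounded_le)
  from infinite_enumerate[OF this] obtain \<tau> :: "nat \<Rightarrow> nat"
    where "strict_mono \<tau> \<and> (\<forall>n. \<tau> n \<in> {n. \<not> P n})" ..
  thus ?thesis using that[of \<tau>] by simp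
qed

text \<open>Failure of divergence at one point of \<open>S\<close> gives a subsequence bounded
  there, hence bounded on compact subsets by propagation. The unbounded alternative thus holds for
  \<open>F\<close> itself.\<close>

lemma bounded_subseq_or_unbounded:
  fixes F :: "nat \<Rightarrow> complex \<Rightarrow> complex"
  assumes F: "\<And>n. F n holomorphic_on UNIV" and S: "open S" "connected S"
    and sph: "\<And>p. p \<in> S \<Longrightarrow> locally_sph_bounded F p"
  obtains (bounded) \<tau> :: "nat \<Rightarrow> nat" where "strict_mono \<tau>"
      "\<And>K. compact K \<Longrightarrow> K \<subseteq> S \<Longrightarrow> \<exists>B. \<forall>\<^sub>F n in sequentially. \<forall>z\<in>K. cmod (F (\<tau> n) z) \<le> B"
    | (unbounded) "\<And>K T. compact K \<Longrightarrow> K \<subseteq> S \<Longrightarrow> \<forall>\<^sub>F n in sequentially. \<forall>z\<in>K. cmod (F n z) > T"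
proof (cases "\<forall>p\<in>S. \<forall>T. \<forall>\<^sub>F n in sequentially. cmod (F n p) > T")
  case True
  have "\<forall>\<^sub>F n in sequentially. \<forall>z\<in>K. cmod (F n z) > T" if "compact K" "K \<subseteq> S" for K T
    by (rule unbounded_on_compact[OF F that(1)]) (use sph True that(2) in auto)
  thus ?thesis by (rule unbounded)
next
  case False
  then obtain p T where p: "p \<in> S" "\<not> (\<forall>\<^sub>F n in sequentially. cmod (F n p) > T)" by blast
  show ?thesis
  proof (rule not_eventually_subseq[OF p(2)])
    fix \<tau> :: "nat \<Rightarrow> nat" assume \<tau>: "strict_mono \<tau>" "\<And>n. \<not> cmod (F (\<tau> n) p) > T"
    have "\<exists>B. \<forall>\<^sub>F n in sequentially. \<forall>z\<in>K. cmod (F (\<tau> n) z) \<le> B" if "compact K" "K \<subseteq> S" for K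
      by (rule bounded_on_compact[OF F S locally_sph_bounded_subseq[OF sph \<tau>(1)] p(1) _ that, where T = T])
         (use \<tau>(2) in \<open>auto simp: not_less\<close>)
    thus ?thesis by (intro bounded[OF \<tau>(1)])
  qed
qed

text \<open>Cauchy's estimates on the spheres of radius \<open>R n\<close> remove all Taylor
  coefficients from degree 2 on. A sequence of radii is all that the bounded alternative
  provides.\<close>

lemma affine_if_linear_growth_subseq:
  assumes f: "f holomorphic_on UNIV" and R: "filterlim R at_top sequentially"
    and bd: "\<forall>\<^sub>F n in sequentially. \<forall>z\<in>sphere 0 (R n). cmod (f z) \<le> B * R n"
  shows "\<exists>p. \<forall>z. f z = poly p z"
proof -
  have coeff: "(deriv ^^ k) f 0 = 0" if k: "k \<ge> 2" for k
  proof -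
    have ev: "\<forall>\<^sub>F n in sequentially. cmod ((deriv ^^ k) f 0) \<le> fact k * \<bar>B\<bar> / R n"
      using bd filterlim_at_top_dense[THEN iffD1, OF R, rule_format, of 1]
    proof eventually_elim
      case (elim n)
      have "cmod ((deriv ^^ k) f 0) \<le> fact k * (\<bar>B\<bar> * R n) / R n ^ k"
      proof (rule Cauchy_inequality)
        fix x :: complex assume "cmod (0 - x) = R n"
        hence "cmod (f x) \<le> B * R n" using elim by simp
        also have "\<dots> \<le> \<bar>B\<bar> * R n" using elim by (intro mult_right_mono) auto
        finally show "cmod (f x) \<le> \<bar>B\<bar> * R n" .
      qed (use elim in \<open>auto intro: holomorphic_on_subset[OF f] holomorphic_on_imp_continuous_on\<close>)
      also have "\<dots> \<le> fact k * (\<bar>B\<bar> * R n) / R n ^ 2"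
        using elim k by (intro divide_left_mono power_increasing mult_nonneg_nonneg mult_pos_pos zero_less_power) auto
      also have "\<dots> = fact k * \<bar>B\<bar> / R n"
        using elim by (simp add: power2_eq_square)
      finally show ?case .
    qed
    have "((\<lambda>n. fact k * \<bar>B\<bar> / R n) \<longlongrightarrow> 0) sequentially"
      by (intro real_tendsto_divide_at_top[OF tendsto_const R])
    from tendsto_lowerbound[OF this ev] show ?thesis by simp
  qed
  have "f z = poly [:f 0, deriv f 0:] z" for z
  proof -
    have "((\<lambda>n. (deriv ^^ n) f 0 / fact n * (z - 0) ^ n) sums f z)"
      by (rule holomorphic_power_series[of f 0 "cmod z + 1"])
         (auto intro: holomorphic_on_subset[OF f])
    moreover have "((\<lambda>n. (deriv ^^ n) f 0 / fact n * (z - 0) ^ n) sums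
        (\<Sum>n\<in>{0, 1}. (deriv ^^ n) f 0 / fact n * (z - 0) ^ n))"
      by (rule sums_finite) (auto intro!: coeff)
    ultimately have "f z = (\<Sum>n\<in>{0, 1}. (deriv ^^ n) f 0 / fact n * (z - 0) ^ n)"
      by (rule sums_unique2)
    thus ?thesis by (simp add: mult.commute)
  qed
  thus ?thesis by blast
qed

text \<open>Otherwise the alternative on the punctured plane gives either linear growth on a
  sequence of spheres, so that \<open>f\<close> is affine, or
  \<open>cmod (f w) \<ge> cmod w / 2\<close> for large \<open>w\<close>, so that \<open>f\<close>
  has a pole at infinity. Both make \<open>f\<close> a polynomial.\<close>

lemma rescale_not_normal:
  assumes f: "transcendental_entire f"
  shows "\<exists>p. p \<noteq> 0 \<and> \<not> locally_sph_bounded (rescale f) p"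
proof (rule ccontr)
  assume "\<not> ?thesis"
  hence sph: "locally_sph_bounded (rescale f) p" if "p \<in> - {0}" for p using that by auto
  have hol: "f holomorphic_on UNIV" and notpoly: "\<not> (\<exists>p. \<forall>z. f z = poly p z)"
    using f by (auto simp: transcendental_entire_def)
  have S: "open (- {0::complex})" "connected (- {0::complex})"
    by (auto simp: Compl_eq_Diff_UNIV intro!: connected_open_delete)
  show False
  proof (rule bounded_subseq_or_unbounded[OF holomorphic_rescale[OF hol] S sph])
    fix \<tau> :: "nat \<Rightarrow> nat"
    assume \<tau>: "strict_mono \<tau>"
      "\<And>K. compact K \<Longrightarrow> K \<subseteq> - {0} \<Longrightarrow> \<exists>B. \<forall>\<^sub>F n in sequentially. \<forall>z\<in>K. cmod (rescale f (\<tau> n) z) \<le> B"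
    obtain B where B: "\<forall>\<^sub>F n in sequentially. \<forall>z\<in>sphere 0 1. cmod (rescale f (\<tau> n) z) \<le> B"
      using \<tau>(2)[of "sphere 0 1"] by auto
    have "\<forall>\<^sub>F n in sequentially. \<forall>z\<in>sphere 0 (real (Suc (\<tau> n))). cmod (f z) \<le> B * real (Suc (\<tau> n))"
      using B
    proof eventually_elim
      case (elim n)
      show ?case
      proof
        fix z :: complex assume z: "z \<in> sphere 0 (real (Suc (\<tau> n)))"
        have "z / of_nat (Suc (\<tau> n)) \<in> sphere 0 1"
          using z by (simp add: norm_divide del: of_nat_Suc)
        hence "cmod (rescale f (\<tau> n) (z / of_nat (Suc (\<tau> n)))) \<le> B" using elim by blast
        thus "cmod (f z) \<le> B * real (Suc (\<tau> n))"
          by (simp add: rescale_def norm_divide pos_divide_le_eq del: of_nat_Suc)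
      qed
    qed
    moreover have "filterlim (\<lambda>n. real (Suc (\<tau> n))) at_top sequentially"
      by (intro filterlim_compose[OF filterlim_real_sequentially] filterlim_compose[OF filterlim_Suc]
          filterlim_subseq \<tau>(1))
    ultimately show False
      using affine_if_linear_growth_subseq[OF hol] notpoly by blast
  next
    assume unb: "\<And>K T. compact K \<Longrightarrow> K \<subseteq> - {0} \<Longrightarrow> \<forall>\<^sub>F n in sequentially. \<forall>z\<in>K. cmod (rescale f n z) > T"
    have "\<forall>\<^sub>F n in sequentially. \<forall>z\<in>cball 0 2 - ball 0 1. cmod (rescale f n z) > 1"
      by (rule unb) (auto intro: compact_diff)
    then obtain n0 where n0: "\<And>n z. n \<ge> n0 \<Longrightarrow> z \<in> cball 0 2 - ball 0 1 \<Longrightarrow> cmod (rescale f n z) > 1"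
      unfolding eventually_sequentially by blast
    have large: "cmod (f w) \<ge> cmod w / 2" if w: "cmod w \<ge> real n0 + 1" for w
    proof -
      \<comment> \<open>\<open>Suc n\<close> is the floor of \<open>cmod w\<close>.\<close>
      define n where "n = nat (\<lfloor>cmod w\<rfloor> - 1)"
      have n: "n \<ge> n0" "real (Suc n) \<le> cmod w" "cmod w < real (Suc n) + 1"
        using w by (auto simp: n_def) linarith+
      have "w / of_nat (Suc n) \<in> cball 0 2 - ball 0 1"
      proof -
        have "cmod (w / of_nat (Suc n)) = cmod w / real (Suc n)" by (simp only: norm_divide norm_of_nat)
        moreover have "1 \<le> cmod w / real (Suc n)" "cmod w / real (Suc n) \<le> 2"
          using n by (auto simp: divide_simps)
        ultimately show ?thesis by simp
      qed
      from n0[OF n(1) this] have "real (Suc n) < cmod (f w)"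
        by (simp add: rescale_def norm_divide pos_less_divide_eq del: of_nat_Suc)
      thus ?thesis using n by simp
    qed
    have "((inverse \<circ> f) \<longlongrightarrow> 0) at_infinity"
    proof (rule Lim_null_comparison)
      show "\<forall>\<^sub>F w in at_infinity. norm ((inverse \<circ> f) w) \<le> norm (2 / w)"
        unfolding eventually_at_infinity
      proof (intro exI[of _ "real n0 + 1"] allI impI)
        fix w :: complex assume w: "real n0 + 1 \<le> norm w"
        have "w \<noteq> 0" using w by auto
        have "inverse (cmod (f w)) \<le> inverse (cmod w / 2)"
          using large[OF w] \<open>w \<noteq> 0\<close> by (intro le_imp_inverse_le) auto
        thus "norm ((inverse \<circ> f) w) \<le> norm (2 / w)" by (simp add: norm_inverse norm_divide)
      qed
      have "((\<lambda>w::complex. 2 * inverse w) \<longlongrightarrow> 2 * 0) at_infinity"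
        by (intro tendsto_intros tendsto_inverse_0)
      thus "((\<lambda>w::complex. norm (2 / w)) \<longlongrightarrow> 0) at_infinity"
        using tendsto_norm_zero by (fastforce simp: divide_inverse)
    qed
    then obtain a n where "\<And>z. f z = (\<Sum>i\<le>n. a i * z ^ i)"
      using pole_at_infinity[OF hol] by metis
    hence "\<forall>z. f z = poly (\<Sum>i\<le>n. monom (a i) i) z"
      by (simp add: poly_sum poly_monom)
    thus False using notpoly by blast
  qed
qed

subsection \<open>Infinitely many cycles\<close>

lemma exists_common_lower_bound:
  fixes X :: "real set"
  assumes "finite X" "\<And>x. x \<in> X \<Longrightarrow> x > 0"
  obtains \<eta> where "\<eta> > 0" "\<And>x. x \<in> X \<Longrightarrow> \<eta> \<le> x"
  by (rule that[of "Min (insert 1 X)"]) (use assms in auto)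

text \<open>Entry j is sought in an island at \<open>w j\<close> whose target \<open>T j\<close> is
  what the equation prescribes when both neighbours sit exactly at their letters. As the islands
  shrink, the true right-hand side differs from \<open>T j\<close> by at most
  \<open>(1 + cmod \<delta>) * \<eta>\<close>.\<close>

lemma infinite_cycles_many_zalcman_points:
  assumes f: "f holomorphic_on UNIV" and \<sigma>: "strict_mono \<sigma>" and "N \<ge> 3"
    and B: "finite B" "card B = 2 * N" "0 \<notin> B"
    and zal: "\<And>b. b \<in> B \<Longrightarrow> zalcman_point (\<lambda>n. rescale f (\<sigma> n)) b"
  shows "infinite (cycles_of_period (henon_map f \<delta>) N)"
proof -
  define G where "G = (\<lambda>n. rescale f (\<sigma> n))"
  have G: "G n holomorphic_on X" for n X unfolding G_def by (rule holomorphic_rescale[OF f])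
  have "\<forall>b\<in>B. \<exists>e. \<forall>t. t \<noteq> e \<longrightarrow> (\<exists>c r m. island_at G b t c r m)"
  proof
    fix b assume "b \<in> B"
    hence "zalcman_point G b" using zal by (simp add: G_def)
    thus "\<exists>e. \<forall>t. t \<noteq> e \<longrightarrow> (\<exists>c r m. island_at G b t c r m)"
      by (rule zalcman_point_islands[OF G])
  qed
  from bchoice[OF this] obtain e
    where e: "\<forall>b\<in>B. \<forall>t. t \<noteq> e b \<longrightarrow> (\<exists>c r m. island_at G b t c r m)" ..
  obtain w :: "nat \<Rightarrow> complex" where "(\<forall>i<N. w i \<in> B) \<and> (\<forall>i\<in>{0<..<N}. w i \<noteq> w 0) \<and>
    (\<forall>i<N. w (Suc i mod N) + \<delta> * w ((i + N - 1) mod N) \<noteq> e (w i))"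
    using exists_word[OF B(1,2) \<open>N \<ge> 3\<close>, of \<delta> e] ..
  hence w: "\<And>i. i < N \<Longrightarrow> w i \<in> B" "\<And>i. 0 < i \<Longrightarrow> i < N \<Longrightarrow> w i \<noteq> w 0"
    "\<And>i. i < N \<Longrightarrow> w (Suc i mod N) + \<delta> * w ((i + N - 1) mod N) \<noteq> e (w i)"
    by auto
  define T where "T = (\<lambda>i. w (Suc i mod N) + \<delta> * w ((i + N - 1) mod N))"
  have "\<forall>j\<in>{..<N}. \<exists>q. island_at G (w j) (T j) (fst q) (fst (snd q)) (snd (snd q))"
  proof
    fix j assume "j \<in> {..<N}"
    hence "w j \<in> B" "T j \<noteq> e (w j)" using w by (auto simp: T_def)
    then obtain c r m where "island_at G (w j) (T j) c r m" using e by blast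
    thus "\<exists>q. island_at G (w j) (T j) (fst q) (fst (snd q)) (snd (snd q))"
      by (intro exI[of _ "(c, r, m)"]) simp
  qed
  from bchoice[OF this] obtain q where
    q: "\<forall>j\<in>{..<N}. island_at G (w j) (T j) (fst (q j)) (fst (snd (q j))) (snd (snd (q j)))" ..
  define c r m where "c = (\<lambda>j. fst (q j))" and "r = (\<lambda>j. fst (snd (q j)))" and "m = (\<lambda>j. snd (snd (q j)))"
  have isl: "island_at G (w j) (T j) (c j) (r j) (m j)" if "j < N" for j
    using q that by (simp add: c_def r_def m_def)
  have m: "m j > 0" if "j < N" for j using isl[OF that] by (simp add: island_at_def)
  have N0: "0 < N" using \<open>N \<ge> 3\<close> by simp
  have w0: "w 0 \<noteq> 0" using w(1)[OF N0] B(3) by metis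
  \<comment> \<open>\<eta> will be a lower bound of \<open>X\<close>. The three kinds of members
    keep the periodic point away from 0, make the error at most \<open>m j / 2\<close>, and separate
    the disc at \<open>w 0\<close> from the others.\<close>
  define X where "X = insert (cmod (w 0) / 2) ((\<lambda>j. m j / (2 * (1 + cmod \<delta>))) ` {..<N} \<union>
     (\<lambda>j. dist (w 0) (w j) / 2) ` {0<..<N})"
  have "finite X" by (simp add: X_def)
  moreover have "x > 0" if "x \<in> X" for x
  proof -
    have d: "2 * (1 + cmod \<delta>) > 0" by (simp add: add_pos_nonneg)
    have "m j / (2 * (1 + cmod \<delta>)) > 0" if "j < N" for j using m[OF that] d by (rule divide_pos_pos)
    moreover have "dist (w 0) (w j) / 2 > 0" if "0 < j" "j < N" for j using w(2)[OF that] by simp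
    moreover have "cmod (w 0) / 2 > 0" using w0 by simp
    ultimately show ?thesis using that unfolding X_def
      by (elim insertE UnE imageE) (simp_all only: lessThan_iff greaterThanLessThan_iff)
  qed
  ultimately obtain \<eta> where \<eta>: "\<eta> > 0" "\<And>x. x \<in> X \<Longrightarrow> \<eta> \<le> x"
    using exists_common_lower_bound by blast
  have \<eta>m: "\<eta> \<le> m j / (2 * (1 + cmod \<delta>))" if "j < N" for j
    by (rule \<eta>(2)[unfolded X_def]) (use that in blast)
  have \<eta>d: "\<eta> \<le> dist (w 0) (w j) / 2" if "0 < j" "j < N" for j
  proof (rule \<eta>(2)[unfolded X_def])
    have "j \<in> {0<..<N}" using that by simp
    thus "dist (w 0) (w j) / 2 \<in> insert (cmod (w 0) / 2) ((\<lambda>j. m j / (2 * (1 + cmod \<delta>))) ` {..<N} \<union>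
     (\<lambda>j. dist (w 0) (w j) / 2) ` {0<..<N})" by blast
  qed
  have \<eta>0: "\<eta> \<le> cmod (w 0) / 2" by (intro \<eta>(2)) (simp add: X_def)
  have "\<forall>\<^sub>F n in sequentially. dist (c j n) (w j) + 2 * r j n < \<eta>" if "j < N" for j
  proof -
    have "c j \<longlonglongrightarrow> w j" "r j \<longlonglongrightarrow> 0" using isl[OF that] by (auto simp: island_at_def)
    hence "(\<lambda>n. dist (c j n) (w j) + 2 * r j n) \<longlonglongrightarrow> dist (w j) (w j) + 2 * 0"
      by (intro tendsto_intros)
    thus ?thesis using \<eta>(1) by (intro order_tendstoD) simp_all
  qed
  hence near: "\<forall>\<^sub>F n in sequentially. \<forall>j\<in>{..<N}. dist (c j n) (w j) + 2 * r j n < \<eta>"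
    by (intro eventually_ball_finite) auto
  have "\<forall>\<^sub>F n in sequentially. \<forall>j\<in>{..<N}. (\<forall>x\<in>sphere (c j n) (r j n). cmod (G n x - T j) \<ge> m j) \<and>
      (\<exists>x\<in>ball (c j n) (r j n). G n x = T j)"
    using isl unfolding island_at_def by (intro eventually_ball_finite) auto
  hence ev: "\<forall>\<^sub>F n in sequentially. \<exists>p. minimal_period (henon_map (G n) \<delta>) N p \<and> cmod (snd p) \<ge> cmod (w 0) / 2"
    using near
  proof eventually_elim
    case (elim n)
    have r0: "r j n > 0" if "j < N" for j using isl[OF that] by (simp add: island_at_def)
    have near': "dist z (w j) < \<eta>" if "j < N" "dist (c j n) z < 2 * r j n" for j z
      using bspec[OF elim(2), of j] that dist_triangle[of z "w j" "c j n"] by (simp add: dist_commute)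
    have modN: "k mod N < N" for k using N0 by simp
    have SucN: "Suc N mod N = Suc 0" using \<open>N \<ge> 3\<close> by (simp add: mod_Suc)
    have "\<exists>p. minimal_period (henon_map (G n) \<delta>) N p \<and> snd p \<in> ball (c (N mod N) n) (r (N mod N) n)"
    proof (rule henon_cycle_through_discs[where c = "\<lambda>i. c (i mod N) n" and r = "\<lambda>i. r (i mod N) n"
          and R = "\<lambda>i. 2 * r (i mod N) n" and t = "\<lambda>i. T (i mod N)" and f = "G n" and N = N and \<delta> = \<delta>])
      fix i assume "i < N"
      have T: "T (Suc i mod N) = w (Suc (Suc i) mod N) + \<delta> * w (i mod N)"
      proof -
        have "(Suc i mod N + N - 1) mod N = (Suc i mod N + (N - 1)) mod N" using N0 by simp
        also have "\<dots> = (Suc i + (N - 1)) mod N" by (rule mod_add_left_eq)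
        also have "Suc i + (N - 1) = i + N" using N0 by simp
        finally show ?thesis by (simp add: T_def mod_Suc_eq)
      qed
      show "controlled_disc (G n) \<delta> (\<lambda>i. c (i mod N) n) (\<lambda>i. T (i mod N)) (\<lambda>i. r (i mod N) n) (\<lambda>i. 2 * r (i mod N) n) i"
        unfolding controlled_disc_def
      proof (intro conjI ballI)
        fix x y z assume x: "x \<in> sphere (c (Suc i mod N) n) (r (Suc i mod N) n)"
          and y: "y \<in> ball (c (Suc (Suc i) mod N) n) (2 * r (Suc (Suc i) mod N) n)"
          and z: "z \<in> ball (c (i mod N) n) (2 * r (i mod N) n)"
        have yz: "cmod (y - w (Suc (Suc i) mod N)) < \<eta>" "cmod (z - w (i mod N)) < \<eta>"
          using near'[OF modN, of "Suc (Suc i)" y] near'[OF modN, of i z] y z by (auto simp: dist_norm)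
        have "cmod (y + \<delta> * z - T (Suc i mod N)) = cmod ((y - w (Suc (Suc i) mod N)) + \<delta> * (z - w (i mod N)))"
          by (simp add: T algebra_simps)
        also have "\<dots> \<le> cmod (y - w (Suc (Suc i) mod N)) + cmod \<delta> * cmod (z - w (i mod N))"
          by (metis norm_triangle_ineq norm_mult)
        also have "\<dots> \<le> \<eta> + cmod \<delta> * \<eta>"
          using yz by (intro add_mono mult_left_mono) auto
        also have "\<dots> = (1 + cmod \<delta>) * \<eta>" by (simp add: algebra_simps)
        also have "\<dots> \<le> (1 + cmod \<delta>) * (m (Suc i mod N) / (2 * (1 + cmod \<delta>)))"
          using \<eta>m[OF modN] by (intro mult_left_mono) auto
        also have "\<dots> = m (Suc i mod N) / 2"
        proof -
          have "a * (x / (2 * a)) = x / 2" if "a \<noteq> 0" for a x :: real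
            using that by simp
          moreover have "1 + cmod \<delta> \<noteq> 0" using norm_ge_zero[of \<delta>] by linarith
          ultimately show ?thesis .
        qed
        also have "\<dots> < m (Suc i mod N)" using m[OF modN] by simp
        also have "\<dots> \<le> cmod (G n x - T (Suc i mod N))" using elim(1) x modN by blast
        finally show "cmod (y + \<delta> * z - T (Suc i mod N)) < cmod (G n x - T (Suc i mod N))" .
      qed (use elim(1) modN r0[OF modN] in auto)
    next
      fix i assume i: "0 < i" "i < N"
      show "ball (c (N mod N) n) (r (N mod N) n) \<inter> ball (c (i mod N) n) (r (i mod N) n) = {}"
      proof (rule ccontr)
        assume "\<not> ?thesis"
        then obtain z where z: "dist (c 0 n) z < r 0 n" "dist (c i n) z < r i n"
          using i by auto
        have "dist z (w 0) < \<eta>" "dist z (w i) < \<eta>"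
          using near'[OF N0, of z] near'[OF i(2), of z] z r0[OF N0] r0[OF i(2)] by auto
        hence "dist (w 0) (w i) < 2 * \<eta>" using dist_triangle[of "w 0" "w i" z] by (simp add: dist_commute)
        thus False using \<eta>d[OF i] by simp
      qed
    next
      fix p assume "minimal_period (henon_map (G n) \<delta>) N p" "snd p \<in> ball (c (N mod N) n) (r (N mod N) n)"
      thus ?thesis by blast
    qed (use \<open>N \<ge> 3\<close> G SucN in auto)
    then obtain p where p: "minimal_period (henon_map (G n) \<delta>) N p" "snd p \<in> ball (c 0 n) (r 0 n)"
      by auto
    have "dist (snd p) (w 0) < \<eta>" using near'[OF N0, of "snd p"] p(2) r0[OF N0] by auto
    hence "cmod (snd p) \<ge> cmod (w 0) / 2"
      using \<eta>0 norm_triangle_ineq2[of "w 0" "snd p"] by (simp add: dist_norm norm_minus_commute)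
    thus ?case using p(1) by blast
  qed
  show ?thesis
  proof (rule infinite_cycles_if_rescaled[where \<epsilon> = "cmod (w 0) / 2"])
    fix k
    obtain n0 where n0: "\<And>n. n \<ge> n0 \<Longrightarrow> \<exists>p. minimal_period (henon_map (G n) \<delta>) N p \<and> cmod (snd p) \<ge> cmod (w 0) / 2"
      using ev unfolding eventually_sequentially by blast
    have "\<sigma> (max n0 k) \<ge> k" using seq_suble[OF \<sigma>, of "max n0 k"] by simp
    thus "\<exists>n\<ge>k. \<exists>p. minimal_period (henon_map (rescale f n) \<delta>) N p \<and> cmod (w 0) / 2 \<le> cmod (snd p)"
      using n0[of "max n0 k"] unfolding G_def by auto
  qed (use w0 in auto)
qed

text \<open>A subsequence bounded on a circle around \<open>b\<close> would be bounded inside it by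
  the maximum principle, which a Zalcman point forbids. So the functions are large on circles around
  \<open>b\<close> and 0, yet take values of modulus below 1 near \<open>b\<close> and have bounded
  value at 0; the minimum principle gives zeros in both discs.\<close>

lemma infinite_cycles_finitely_many_zalcman_points:
  assumes f: "f holomorphic_on UNIV" and \<sigma>: "strict_mono \<sigma>" and "N \<ge> 2"
    and B: "finite B" "0 \<notin> B" "b \<in> B" and zal: "zalcman_point (\<lambda>n. rescale f (\<sigma> n)) b"
    and sph: "\<And>p. p \<noteq> 0 \<Longrightarrow> p \<notin> B \<Longrightarrow> locally_sph_bounded (\<lambda>n. rescale f (\<sigma> n)) p"
  shows "infinite (cycles_of_period (henon_map f \<delta>) N)"
proof -
  define G where "G = (\<lambda>n. rescale f (\<sigma> n))"
  have G: "G n holomorphic_on X" for n X unfolding G_def by (rule holomorphic_rescale[OF f])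
  define Y where "Y = insert 0 B"
  have Y: "finite Y" "0 \<in> Y" "b \<in> Y" using B by (auto simp: Y_def)
  have S: "open (- Y)" "connected (- Y)"
    using Y by (auto simp: finite_imp_closed open_Compl Compl_eq_Diff_UNIV intro!: connected_open_delete_finite)
  have b0: "b \<noteq> 0" using B by auto
  obtain d1 where d1: "d1 > 0" "\<And>x. x \<in> Y \<Longrightarrow> x \<noteq> 0 \<Longrightarrow> d1 \<le> dist 0 x"
    using finite_set_avoid[OF Y(1), of 0] by blast
  obtain d2 where d2: "d2 > 0" "\<And>x. x \<in> Y \<Longrightarrow> x \<noteq> b \<Longrightarrow> d2 \<le> dist b x"
    using finite_set_avoid[OF Y(1), of b] by blast
  \<comment> \<open>The circles of radius \<epsilon> around 0 and \<open>b\<close> then miss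
    \<open>Y\<close>, and \<open>4 * \<epsilon> \<le> cmod b\<close> keeps the two discs apart and
    the disc at \<open>b\<close> at distance at least \<epsilon> from 0.\<close>
  define \<epsilon> where "\<epsilon> = min d1 d2 / 4"
  have \<epsilon>: "\<epsilon> > 0" "\<epsilon> < d1" "\<epsilon> < d2" using d1 d2 by (auto simp: \<epsilon>_def)
  have b\<epsilon>: "4 * \<epsilon> \<le> cmod b" using d1(2)[OF Y(3) b0] by (auto simp: \<epsilon>_def)
  have sph0: "sphere 0 \<epsilon> \<subseteq> - Y"
  proof
    fix x :: complex assume x: "x \<in> sphere 0 \<epsilon>"
    show "x \<in> - Y" using d1(2)[of x] x \<epsilon> by auto
  qed
  have sphb: "sphere b \<epsilon> \<subseteq> - Y"
  proof
    fix x assume x: "x \<in> sphere b \<epsilon>"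
    show "x \<in> - Y" using d2(2)[of x] x \<epsilon> by auto
  qed
  have zalG: "zalcman_point G b" using zal by (simp add: G_def)
  have sphG: "locally_sph_bounded G p" if "p \<in> - Y" for p
    using sph[of p] that by (simp add: G_def Y_def)
  show ?thesis
  proof (rule bounded_subseq_or_unbounded[OF G S sphG])
    fix \<tau> :: "nat \<Rightarrow> nat"
    assume \<tau>: "strict_mono \<tau>"
      "\<And>K. compact K \<Longrightarrow> K \<subseteq> - Y \<Longrightarrow> \<exists>B. \<forall>\<^sub>F n in sequentially. \<forall>z\<in>K. cmod (G (\<tau> n) z) \<le> B"
    obtain C where "\<forall>\<^sub>F n in sequentially. \<forall>z\<in>sphere b \<epsilon>. cmod (G (\<tau> n) z) \<le> C"
      using \<tau>(2)[OF compact_sphere sphb] by blast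
    hence "\<forall>\<^sub>F n in sequentially. \<forall>z\<in>ball b \<epsilon>. cmod (G (\<tau> n) z) \<le> C"
    proof eventually_elim
      case (elim n)
      show ?case
      proof
        fix z assume z: "z \<in> ball b \<epsilon>"
        show "cmod (G (\<tau> n) z) \<le> C"
          by (rule maximum_modulus_frontier[where S = "cball b \<epsilon>" and f = "G (\<tau> n)"])
             (use elim z \<epsilon> in \<open>auto intro: G holomorphic_on_imp_continuous_on\<close>)
      qed
    qed
    thus ?thesis
      using zalcman_point_unbounded(1)[OF zalcman_point_subseq[OF zalG \<tau>(1)] \<epsilon>(1)] by blast
  next
    assume unb: "\<And>K T. compact K \<Longrightarrow> K \<subseteq> - Y \<Longrightarrow> \<forall>\<^sub>F n in sequentially. \<forall>z\<in>K. cmod (G n z) > T"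
    \<comment> \<open>The product bounds \<open>y + \<delta> * z\<close> for \<open>y\<close> and
      \<open>z\<close> in the doubled discs, \<open>cmod (f 0)\<close> bounds the value at 0, and 1
      bounds the small values near \<open>b\<close>.\<close>
    define T where "T = (1 + cmod \<delta>) * (cmod b + 2 * \<epsilon>) + cmod (f 0) + 1"
    have T: "T \<ge> 1" "T > cmod (f 0)" "T > (1 + cmod \<delta>) * (cmod b + 2 * \<epsilon>)"
      using \<epsilon> mult_nonneg_nonneg[of "1 + cmod \<delta>" "cmod b + 2 * \<epsilon>"] by (auto simp: T_def add_nonneg_pos)
    have "\<forall>\<^sub>F n in sequentially. \<forall>z\<in>sphere 0 \<epsilon> \<union> sphere b \<epsilon>. cmod (G n z) > T"
      using sph0 sphb by (intro unb compact_Un) auto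
    \<comment> \<open>Negating an eventual bound yields only infinitely many \<open>n\<close>, which
      is enough to produce unbounded periodic points.\<close>
    moreover have "\<exists>\<^sub>F n in sequentially. \<exists>z\<in>ball b \<epsilon>. cmod (G n z) < 1"
      using zalcman_point_unbounded(2)[OF zalG \<epsilon>(1)] by (simp add: not_eventually not_le)
    ultimately have fr: "\<exists>\<^sub>F n in sequentially. (\<exists>z\<in>ball b \<epsilon>. cmod (G n z) < 1) \<and>
        (\<forall>z\<in>sphere 0 \<epsilon> \<union> sphere b \<epsilon>. cmod (G n z) > T)"
      by (rule frequently_eventually_frequently[rotated])
    show ?thesis
    proof (rule infinite_cycles_if_rescaled[OF \<epsilon>(1)])
      fix k
      obtain n z0 where n: "n \<ge> k" "z0 \<in> ball b \<epsilon>" "cmod (G n z0) < 1"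
        "\<And>z. z \<in> sphere 0 \<epsilon> \<union> sphere b \<epsilon> \<Longrightarrow> cmod (G n z) > T"
        using fr unfolding frequently_sequentially by blast
      have G0: "cmod (G n 0) < T"
      proof -
        have "cmod (G n 0) = cmod (f 0) / real (Suc (\<sigma> n))"
          unfolding G_def rescale_def by (simp only: mult_zero_right norm_divide norm_of_nat)
        also have "\<dots> \<le> cmod (f 0)" by (simp add: divide_le_eq mult_le_cancel_left1 algebra_simps)
        finally show ?thesis using T by simp
      qed
      have hit0: "\<exists>x\<in>ball 0 \<epsilon>. G n x = 0"
        by (rule exists_zero_min_modulus[OF G \<epsilon>(1), where c = 0 and t = 0 and m = T and ?x0.0 = 0]) (use n(4) G0 \<epsilon> in \<open>auto intro: less_imp_le\<close>)
      have hitb: "\<exists>x\<in>ball b \<epsilon>. G n x = 0"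
        by (rule exists_zero_min_modulus[OF G \<epsilon>(1), where c = b and t = 0 and m = T and ?x0.0 = z0]) (use n T(1) in \<open>auto intro: less_imp_le\<close>)
      define c where "c = (\<lambda>i. if i mod N = 0 then b else 0)"
      have c: "c i = b \<or> c i = 0" for i by (simp add: c_def)
      have bound: "cmod x < cmod b + 2 * \<epsilon>" if "x \<in> ball (c i) (2 * \<epsilon>)" for x i
      proof -
        have "cmod x \<le> cmod (c i) + dist (c i) x"
          using norm_triangle_sub[of x "c i"] by (simp add: dist_norm norm_minus_commute)
        moreover have "cmod (c i) \<le> cmod b" using c[of i] by auto
        ultimately show ?thesis using that by simp
      qed
      have "\<exists>p. minimal_period (henon_map (G n) \<delta>) N p \<and> snd p \<in> ball (c N) \<epsilon>"
      proof (rule henon_cycle_through_discs[where c = c and r = "\<lambda>_. \<epsilon>" and R = "\<lambda>_. 2 * \<epsilon>" and t = "\<lambda>_. 0"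
            and f = "G n" and N = N and \<delta> = \<delta>])
        fix i assume "i < N"
        show "controlled_disc (G n) \<delta> c (\<lambda>_. 0) (\<lambda>_. \<epsilon>) (\<lambda>_. 2 * \<epsilon>) i"
          unfolding controlled_disc_def
        proof (intro conjI ballI)
          fix x y z assume x: "x \<in> sphere (c (Suc i)) \<epsilon>" and y: "y \<in> ball (c (Suc (Suc i))) (2 * \<epsilon>)"
            and z: "z \<in> ball (c i) (2 * \<epsilon>)"
          have "cmod (y + \<delta> * z) \<le> cmod y + cmod \<delta> * cmod z"
            by (metis norm_triangle_ineq norm_mult)
          also have "\<dots> \<le> (cmod b + 2 * \<epsilon>) + cmod \<delta> * (cmod b + 2 * \<epsilon>)"
            using bound[OF y] bound[OF z] by (intro add_mono mult_left_mono) auto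
          also have "\<dots> < T" using T(3) by (simp add: algebra_simps)
          also have "T < cmod (G n x)" using n(4)[of x] x c[of "Suc i"] by auto
          finally show "cmod (y + \<delta> * z - 0) < cmod (G n x - 0)" by simp
        qed (use hit0 hitb c[of "Suc i"] \<epsilon> in auto)
      next
        fix i assume i: "0 < i" "i < N"
        have "dist b z + dist 0 z \<ge> 4 * \<epsilon>" for z
          using b\<epsilon> dist_triangle[of b 0 z] by (simp add: dist_commute)
        hence "\<not> (dist b z < \<epsilon> \<and> dist 0 z < \<epsilon>)" for z
          using \<epsilon>(1) by (smt (verit))
        thus "ball (c N) \<epsilon> \<inter> ball (c i) \<epsilon> = {}"
          using i by (auto simp: c_def)
      next
        fix p assume "minimal_period (henon_map (G n) \<delta>) N p" "snd p \<in> ball (c N) \<epsilon>"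
        thus ?thesis by blast
      qed (use \<open>N \<ge> 2\<close> G in \<open>auto simp: c_def mod_Suc\<close>)
      then obtain p where p: "minimal_period (henon_map (G n) \<delta>) N p" "dist b (snd p) < \<epsilon>"
        by (auto simp: c_def)
      have "cmod (snd p) \<ge> \<epsilon>"
        using p(2) b\<epsilon> norm_triangle_ineq2[of b "snd p"] \<epsilon>(1) by (simp add: dist_norm)
      moreover have "\<sigma> n \<ge> k" using seq_suble[OF \<sigma>, of n] n(1) by simp
      ultimately show "\<exists>n\<ge>k. \<exists>p. minimal_period (henon_map (rescale f n) \<delta>) N p \<and> \<epsilon> \<le> cmod (snd p)"
        using p(1) unfolding G_def by blast
    qed
  qed
qed

theorem mainTheorem13:
  fixes f :: "complex \<Rightarrow> complex" and \<delta> :: complex and N :: nat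
  assumes "transcendental_entire f" and "\<delta> \<noteq> 0" and "N \<ge> 3"
  shows "infinite (cycles_of_period (henon_map f \<delta>) N)"
proof -
  have f: "f holomorphic_on UNIV" using assms(1) by (simp add: transcendental_entire_def)
  obtain p0 where p0: "p0 \<noteq> 0" "\<not> locally_sph_bounded (rescale f) p0"
    using rescale_not_normal[OF assms(1)] by blast
  \<comment> \<open>The parameter \<open>2 * N - 1\<close> makes the full collection have
    \<open>2 * N\<close> points, the alphabet size of \<open>exists_word\<close>.\<close>
  obtain \<sigma> B where *: "strict_mono \<sigma>" "finite B" "B \<noteq> {}" "0 \<notin> B"
    "\<forall>b\<in>B. zalcman_point (\<lambda>n. rescale f (\<sigma> n)) b" and
    alt: "card B = Suc (2 * N - 1) \<or> (\<forall>p. p \<noteq> 0 \<longrightarrow> p \<notin> B \<longrightarrow> locally_sph_bounded (\<lambda>n. rescale f (\<sigma> n)) p)"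
    using zalcman_stages[OF holomorphic_rescale[OF f] p0, of "2 * N - 1"] by blast
  show ?thesis
    using alt
  proof
    assume "card B = Suc (2 * N - 1)"
    hence "card B = 2 * N" using assms(3) by simp
    thus ?thesis
      using infinite_cycles_many_zalcman_points[OF f *(1) assms(3) *(2) _ *(4)] *(5) by blast
  next
    assume sph: "\<forall>p. p \<noteq> 0 \<longrightarrow> p \<notin> B \<longrightarrow> locally_sph_bounded (\<lambda>n. rescale f (\<sigma> n)) p"
    obtain b where "b \<in> B" using *(3) by blast
    thus ?thesis
      using infinite_cycles_finitely_many_zalcman_points[OF f *(1) _ *(2,4)] *(5) sph assms(3) by simp
  qed
qed

end
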